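(* Let $X$ be a nonempty locally compact Hausdorff space with no isolated points, and let $\kappa = \pi w_\downarrow(X)$. Then $$\mathrm{non}(\mathcal M_X) \leq \mathrm{cf}[\kappa]^\omega \cdot \mathrm{non}(\mathcal M).$$
   Context: For a topological space $X$, $\mathcal M_X$ is the collection of all meager subsets of $X$ (countable unions of nowhere dense sets), and $\mathcal M = \mathcal M_{\mathbb R}$. For an ideal $\mathcal I$ of subsets of a set $X$, $\mathrm{non}(\mathcal I) = \min\{|Y| : Y \subseteq X \text{ and } Y \notin \mathcal I\}$. A $\pi$-base for $X$ is a collection $\mathcal B$ of nonempty open subsets of $X$ such that every nonempty open subset of $X$ contains a member of $\mathcal B$. The $\pi$-weight $\pi w(X)$ is the minimum cardinality of a $\pi$-base for $X$, and $\pi w_\downarrow(X) = \min\{\kappa : \text{some nonempty open } U \subseteq X \text{ has } \pi\text{-weight } \kappa\}$. For an infinite cardinal $\kappa$, $[\kappa]^\omega$ is the set of all countably infinite subsets of $\kappa$; a family $\mathcal F \subseteq [\kappa]^\omega$ is cofinal if for every $A \in [\kappa]^\omega$ there is $B \in \mathcal F$ with $B \supseteq A$; and $\mathrm{cf}[\kappa]^\omega$ is the minimum cardinality of a cofinal subset of $[\kappa]^\omega$. The dot denotes cardinal multiplication. *)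

theory Defs
  imports "HOL-Analysis.Analysis"
begin

unbundle cardinal_syntax

text \<open>
  Cardinals are rendered as in the library's theory of cardinal orders: the cardinality of a set
  \<open>A\<close> is \<open>|A|\<close>, a relation on the type of the elements of \<open>A\<close>, and cardinals are compared with
  \<open>\<le>o\<close>, also across types. Isomorphic cardinals need not be equal, so a minimum is only determined
  up to \<open>=o\<close>; \<open>least_cardinal R\<close> picks one element of \<open>R\<close> that is \<open>\<le>o\<close> all the others. It is
  unspecified for empty \<open>R\<close>.
\<close>

definition least_cardinal :: "'b rel set \<Rightarrow> 'b rel" where
  "least_cardinal R = (SOME r. r \<in> R \<and> (\<forall>s\<in>R. r \<le>o s))"

lemma least_cardinal:
  assumes "R \<noteq> {}" and "\<forall>r\<in>R. Card_order r"
  shows "least_cardinal R \<in> R" and "\<forall>s\<in>R. least_cardinal R \<le>o s"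
proof -
  have "\<exists>r. r \<in> R \<and> (\<forall>s\<in>R. r \<le>o s)"
    using exists_minim_Card_order[OF assms] by blast
  from someI_ex[OF this] show "least_cardinal R \<in> R" "\<forall>s\<in>R. least_cardinal R \<le>o s"
    unfolding least_cardinal_def by auto
qed

definition nowhere_dense_in :: "'a topology \<Rightarrow> 'a set \<Rightarrow> bool" where
  "nowhere_dense_in X N \<longleftrightarrow> N \<subseteq> topspace X \<and> X interior_of (X closure_of N) = {}"

definition meager_sets :: "'a topology \<Rightarrow> 'a set set" where
  "meager_sets X = {\<Union>\<N> |\<N>. countable \<N> \<and> (\<forall>N\<in>\<N>. nowhere_dense_in X N)}"

definition non_ideal :: "'a set \<Rightarrow> 'a set set \<Rightarrow> 'a rel" where
  "non_ideal S \<I> = least_cardinal {|Y| |Y. Y \<subseteq> S \<and> Y \<notin> \<I>}"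

definition pi_base :: "'a topology \<Rightarrow> 'a set set \<Rightarrow> bool" where
  "pi_base X \<B> \<longleftrightarrow>
     (\<forall>B\<in>\<B>. openin X B \<and> B \<noteq> {}) \<and>
     (\<forall>U. openin X U \<and> U \<noteq> {} \<longrightarrow> (\<exists>B\<in>\<B>. B \<subseteq> U))"

definition pi_weight :: "'a topology \<Rightarrow> 'a set rel" where
  "pi_weight X = least_cardinal {|\<B>| |\<B>. pi_base X \<B>}"

definition pi_weight_down :: "'a topology \<Rightarrow> 'a set rel" where
  "pi_weight_down X =
     least_cardinal {pi_weight (subtopology X U) |U. openin X U \<and> U \<noteq> {}}"

text \<open>
  A cardinal \<open>\<kappa>\<close>, being a well-order relation, has \<open>Field \<kappa>\<close> as its underlying set.
\<close>

definition countably_infinite_subsets :: "'k rel \<Rightarrow> 'k set set" where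
  "countably_infinite_subsets \<kappa> = {A. A \<subseteq> Field \<kappa> \<and> countable A \<and> infinite A}"

definition cofinal_family :: "'k rel \<Rightarrow> 'k set set \<Rightarrow> bool" where
  "cofinal_family \<kappa> \<F> \<longleftrightarrow>
     \<F> \<subseteq> countably_infinite_subsets \<kappa> \<and>
     (\<forall>A\<in>countably_infinite_subsets \<kappa>. \<exists>B\<in>\<F>. A \<subseteq> B)"

definition cf_countable_subsets :: "'k rel \<Rightarrow> 'k set rel" where
  "cf_countable_subsets \<kappa> = least_cardinal {|\<F>| |\<F>. cofinal_family \<kappa> \<F>}"

end

theory Submission
  imports Defs
begin

text \<open>
  Some non-empty open set \<open>U\<close> has a \<open>\<pi>\<close>-base \<open>\<B>\<close> of cardinality \<open>\<kappa>\<close>. Given nowhere dense sets \<open>N n\<close>, every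
  member of \<open>\<B>\<close> shrinks to one with compact closure avoiding \<open>N n\<close>. If a countable \<open>A \<subseteq> \<B>\<close> is closed under
  these shrinkings, then a decreasing sequence of members of \<open>A\<close> coded by a sufficiently generic real ends
  in a point outside all \<open>N n\<close>. So \<open>non(\<M>)\<close> points for each \<open>A\<close> suffice, where \<open>A\<close> ranges over a family of
  countable sets that contains, for every choice of functions on \<open>\<B>\<close>, a member closed under them.

  That such a stationary family can be as small as a cofinal one is due to Shelah. Build an increasing
  chain of countable closed sets of length \<open>\<omega>\<^sub>1\<close>, each covered by a member of the cofinal family \<open>F\<close>. On a
  countable \<open>C \<in> F\<close>, the map sending \<open>\<beta>\<close> to the supremum of the chain below \<open>\<beta>\<close> is a maximum of finitely
  many functions that are canonically attached to points of scales modulo the pcf ideals, which leaves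
  only \<open>|F|\<close> possibilities; a closed stage of the chain can be reconstructed from this map, \<open>C\<close>, and a
  countable ordinal.
\<close>

section \<open>Well-ordered types and the first uncountable ordinal\<close>

text \<open>The obstacle: a member of a cofinal family contains any prescribed countable set but
  need not be closed under the shrinkings, and these depend on the sets \<open>N n\<close>, which
  are unknown when the family is fixed. All subsets of members of \<open>F\<close> together would
  catch a closed set, but at the price of a factor continuum, which the bound may not absorb; closed
  sets have to be decoded from \<open>|F|\<close> many data. Points of cofinality at most
  \<open>\<omega>\<^sub>1\<close> are harmless: the chain is made cofinal below them, and the
  supremum is taken to be the point itself. Below the other points the length
  \<open>\<omega>\<^sub>1\<close> is used twice. Products over countably many such points have
  everywhere bounds for \<open>\<omega>\<^sub>1\<close> many functions, whereas a countable
  coordinate set cannot support \<open>\<omega>\<^sub>1\<close> strict changes. And two sequences of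
  length \<open>\<omega>\<^sub>1\<close> cofinal in the same limit have equal partial suprema on a
  club, which makes the limit functions canonical. The maximum is finite because each limit function
  errs only on a set whose maximal cofinality is smaller.\<close>

lemma ex_leastE:
  fixes P :: "'a::wellorder \<Rightarrow> bool"
  assumes "P a"
  obtains x where "P x" "\<And>y. y < x \<Longrightarrow> \<not> P y" "\<And>y. P y \<Longrightarrow> x \<le> y"
  using that[of "LEAST x. P x"] assms by (auto intro: LeastI Least_le dest: not_less_Least)

text \<open>
  A copy of a type, well-ordered by choice and with a top element added, so that transfinite arguments
  over arbitrary sets can use the type class.
\<close>

datatype 'a wo = Elt 'a | Top

definition some_wo :: "'a rel" where "some_wo = (SOME r. well_order_on UNIV r)"

lemma some_wo: "well_order_on UNIV some_wo"
  unfolding some_wo_def by (rule someI_ex) (rule well_order_on)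

instantiation wo :: (type) wellorder
begin

fun less_eq_wo :: "'a wo \<Rightarrow> 'a wo \<Rightarrow> bool" where
  "Elt a \<le> Elt b \<longleftrightarrow> (a, b) \<in> some_wo"
| "x \<le> Top \<longleftrightarrow> True"
| "Top \<le> Elt b \<longleftrightarrow> False"

definition less_wo :: "'a wo \<Rightarrow> 'a wo \<Rightarrow> bool" where
  "x < y \<longleftrightarrow> x \<le> y \<and> \<not> y \<le> (x :: 'a wo)"

instance
proof
  have wo: "refl_on UNIV (some_wo :: 'a rel)" "trans (some_wo :: 'a rel)" "antisym (some_wo :: 'a rel)"
    "total_on UNIV (some_wo :: 'a rel)" and wf: "wf (some_wo - Id :: 'a rel)"
    using some_wo[where 'a='a] unfolding well_order_on_def linear_order_on_def partial_order_on_def preorder_on_def by auto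
  have tot: "(a, b) \<in> some_wo \<or> (b, a) \<in> some_wo" for a b :: 'a
    using wo(1,4) unfolding total_on_def refl_on_def by (cases "a = b") auto
  fix x y z :: "'a wo"
  show "x < y \<longleftrightarrow> x \<le> y \<and> \<not> y \<le> x" by (simp add: less_wo_def)
  show "x \<le> x" using wo(1) by (cases x) (auto simp: refl_on_def)
  show "x \<le> y \<Longrightarrow> y \<le> z \<Longrightarrow> x \<le> z" using wo(2) by (cases x; cases y; cases z) (auto dest: transD)
  show "x \<le> y \<Longrightarrow> y \<le> x \<Longrightarrow> x = y" using wo(3) by (cases x; cases y) (auto dest: antisymD)
  show "x \<le> y \<or> y \<le> x" using tot by (cases x; cases y) auto
  show "P x" if step: "\<And>x. (\<And>y. y < x \<Longrightarrow> P y) \<Longrightarrow> P x" for P and x :: "'a wo"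
  proof -
    have elt: "P (Elt a)" for a
    proof (induction a rule: wf_induct_rule[OF wf])
      case (1 a)
      show ?case
      proof (rule step)
        fix y assume "y < Elt a"
        then obtain c where "y = Elt c" "(c, a) \<in> some_wo - Id"
          using wo(1) by (cases y) (auto simp: less_wo_def refl_on_def)
        then show "P y" using 1 by simp
      qed
    qed
    show ?thesis
      by (cases x) (auto intro!: elt step[of Top] elim!: less_eq_wo.elims simp: less_wo_def)
  qed
qed

end

lemma Elt_less_Top [simp]: "Elt a < Top"
  by (simp add: less_wo_def)

text \<open>Since \<open>nat set\<close> is uncountable, the points with countable initial segment
  have order type \<open>\<omega>\<^sub>1\<close>. As a type of class \<open>wellorder\<close> they
  can index recursions directly.\<close>

typedef omega1 = "{x :: nat set wo. countable {..x}}"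
proof (rule exI[of _ "LEAST x. True"])
  have "{..(LEAST x :: nat set wo. True)} \<subseteq> {LEAST x. True}"
    by (auto intro: antisym Least_le)
  then show "(LEAST x. True) \<in> {x :: nat set wo. countable {..x}}"
    by (metis (no_types) countable_empty countable_insert countable_subset mem_Collect_eq)
qed

instantiation omega1 :: wellorder
begin

definition less_eq_omega1 :: "omega1 \<Rightarrow> omega1 \<Rightarrow> bool" where
  "x \<le> y \<longleftrightarrow> Rep_omega1 x \<le> Rep_omega1 y"

definition less_omega1 :: "omega1 \<Rightarrow> omega1 \<Rightarrow> bool" where
  "x < y \<longleftrightarrow> Rep_omega1 x < Rep_omega1 y"

instance
proof
  fix P and x :: omega1
  assume step: "\<And>x. (\<And>y. y < x \<Longrightarrow> P y) \<Longrightarrow> P (x :: omega1)"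
  show "P x"
  proof (induction "Rep_omega1 x" arbitrary: x rule: less_induct)
    case less
    show ?case by (rule step) (simp add: less less_omega1_def)
  qed
qed (auto simp: less_eq_omega1_def less_omega1_def Rep_omega1_inject[symmetric] antisym linear not_le less_le)

end

lemma countable_omega1_atMost: "countable {..x :: omega1}"
proof -
  have "Rep_omega1 ` {..x} \<subseteq> {..Rep_omega1 x}"
    by (auto simp: less_eq_omega1_def)
  then have "countable (Rep_omega1 ` {..x})"
    using Rep_omega1 countable_subset by blast
  then show ?thesis
    by (rule countable_image_inj_on) (auto simp: inj_on_def Rep_omega1_inject)
qed

lemma countable_omega1_lessThan: "countable {..<x :: omega1}"
  by (rule countable_subset[OF _ countable_omega1_atMost[of x]]) auto

text \<open>Below the least point \<open>x\<close> with uncountable \<open>{..x}\<close> there are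
  only elements of \<open>omega1\<close>; such a point exists because \<open>Top\<close> is a
  candidate.\<close>

lemma uncountable_omega1: "uncountable (UNIV :: omega1 set)"
proof
  assume "countable (UNIV :: omega1 set)"
  then have "countable (range Rep_omega1)" by (rule countable_image)
  then have A: "countable {x :: nat set wo. countable {..x}}"
    using type_definition.Rep_range[OF type_definition_omega1] by simp
  have "(UNIV :: nat set wo set) = {..Top}" by auto
  moreover have "uncountable (range (Elt :: nat set \<Rightarrow> _))"
  proof
    assume "countable (range (Elt :: nat set \<Rightarrow> _))"
    then have "countable (UNIV :: nat set set)"
      by (rule countable_image_inj_on) (auto simp: inj_on_def)
    then obtain g :: "nat \<Rightarrow> nat set" where "range g = UNIV"
      by (metis UNIV_not_empty uncountable_def)
    then have "\<exists>n. g n = {k. k \<notin> g k}" by (metis UNIV_I imageE)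
    then show False by blast
  qed
  ultimately have "uncountable {..Top :: nat set wo}"
    using countable_subset by (metis subset_UNIV)
  then obtain x :: "nat set wo" where x: "uncountable {..x}" "\<And>y. y < x \<Longrightarrow> countable {..y}"
    using ex_leastE[of "\<lambda>x. uncountable {..x}" Top] by metis
  have "{..x} \<subseteq> insert x {x :: nat set wo. countable {..x}}"
    using x(2) by (auto simp: order_le_less)
  with A x(1) show False
    by (meson countable_insert countable_subset)
qed

lemma countable_omega1_bounded:
  fixes A :: "omega1 set"
  assumes "countable A"
  shows "\<exists>y. \<forall>x\<in>A. x < y"
proof (rule ccontr)
  assume "\<not> ?thesis"
  then have "UNIV = (\<Union>x\<in>A. {..x})" by (force simp: not_less)
  moreover have "countable (\<Union>x\<in>A. {..x})"
    using assms countable_omega1_atMost by (rule countable_UN)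
  ultimately show False
    using uncountable_omega1 by simp
qed

text \<open>Applied with \<open>A\<close> the countable set of coordinates: it turns
  \<open>omega1\<close> many distinct witnesses into a contradiction.\<close>

lemma omega1_not_inj_countable:
  fixes g :: "omega1 \<Rightarrow> 'a"
  assumes "countable A" and "\<And>x. g x \<in> A" and "\<And>x y. x < y \<Longrightarrow> g x \<noteq> g y"
  shows False
proof -
  have "inj g"
    using assms(3) by (metis injI linorder_neqE)
  moreover have "countable (range g)"
    using assms(1,2) by (meson countable_subset image_subsetI)
  ultimately show False
    using uncountable_omega1 countable_image_inj_on by blast
qed

lemma omega1_gt_ex: "\<exists>y. (x :: omega1) < y"
  using countable_omega1_bounded[of "{x}"] by simp

text \<open>Closed unbounded sets of countable ordinals enter only as sets of closure points of a function.\<close>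

definition closed_under :: "(omega1 \<Rightarrow> omega1) \<Rightarrow> omega1 \<Rightarrow> bool" where
  "closed_under p \<xi> \<longleftrightarrow> (\<forall>\<eta><\<xi>. p \<eta> < \<xi>)"

lemma closed_under_ex:
  "\<exists>\<xi>>\<eta>. closed_under p \<xi>"
proof -
  have "\<exists>y. \<forall>z\<in>insert x (p ` {..x}). z < y" for x
    by (rule countable_omega1_bounded) (simp add: countable_omega1_atMost)
  then obtain s where "\<forall>x. \<forall>z\<in>insert x (p ` {..x}). z < s x"
    by metis
  then have s: "\<And>x. x < s x" "\<And>x \<zeta>. \<zeta> \<le> x \<Longrightarrow> p \<zeta> < s x"
    by auto
  define c where "c n = (s ^^ n) (s \<eta>)" for n
  obtain u where "\<forall>n. c n < u"
    using countable_omega1_bounded[of "range c"] by auto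
  \<comment> \<open>The supremum of the sequence \<open>c\<close>: every smaller point is at most
    some \<open>c n\<close>, and \<open>c (Suc n)\<close> bounds its image.\<close>
  then obtain \<xi> where \<xi>: "\<forall>n. c n < \<xi>" "\<And>y. y < \<xi> \<Longrightarrow> \<not> (\<forall>n. c n < y)"
    by (rule ex_leastE) blast
  have "\<eta> < \<xi>" using s(1)[of \<eta>] \<xi>(1)[rule_format, of 0] by (simp add: c_def)
  moreover have "p \<zeta> < \<xi>" if "\<zeta> < \<xi>" for \<zeta>
  proof -
    from \<xi>(2)[OF that] obtain n where "\<zeta> \<le> c n" by (auto simp: not_less)
    then have "p \<zeta> < c (Suc n)" using s(2) by (simp add: c_def)
    then show ?thesis using \<xi>(1) less_trans by blast
  qed
  ultimately show ?thesis unfolding closed_under_def by blast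
qed

text \<open>Countably many clubs contain a common club: take \<open>q\<close> above all
  \<open>p a\<close> at every argument.\<close>

lemma closed_under_countable:
  fixes p :: "'a \<Rightarrow> omega1 \<Rightarrow> omega1"
  assumes "countable A"
  shows "\<exists>q. \<forall>\<xi>. closed_under q \<xi> \<longrightarrow> (\<forall>a\<in>A. closed_under (p a) \<xi>)"
proof -
  have "\<exists>y. \<forall>z\<in>(\<lambda>a. p a x) ` A. z < y" for x
    using assms by (intro countable_omega1_bounded) simp
  then obtain q where "\<forall>x. \<forall>z\<in>(\<lambda>a. p a x) ` A. z < q x"
    by metis
  then have "\<And>x a. a \<in> A \<Longrightarrow> p a x < q x" by auto
  then have "closed_under q \<xi> \<longrightarrow> (\<forall>a\<in>A. closed_under (p a) \<xi>)" for \<xi>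
    unfolding closed_under_def by (auto intro: less_trans)
  then show ?thesis by blast
qed

text \<open>Wideness speaks about families indexed by \<open>omega1\<close>; repeating values makes
  it applicable to countable sets.\<close>

lemma omega1_onto_countable:
  assumes "countable A" and "A \<noteq> {}"
  shows "\<exists>g :: omega1 \<Rightarrow> 'a. range g = A"
proof -
  have "infinite (UNIV :: omega1 set)"
    using uncountable_omega1 countable_finite by blast
  then obtain i :: "nat \<Rightarrow> omega1" where "inj i"
    using infinite_countable_subset by blast
  then have "surj (inv i)" by (simp add: inj_imp_surj_inv)
  then have "range (from_nat_into A \<circ> inv i) = A"
    using assms by (metis image_comp range_from_nat_into)
  then show ?thesis by blast
qed

section \<open>Ultrafilters\<close>

text \<open>An ultrafilter on the whole type that contains \<open>b\<close> is the same thing as an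
  ultrafilter on \<open>b\<close>, and it spares relativising complements.\<close>

definition ultra :: "'a set \<Rightarrow> 'a set set \<Rightarrow> bool" where
  "ultra b D \<longleftrightarrow> b \<in> D \<and> {} \<notin> D \<and> (\<forall>A B. A \<in> D \<longrightarrow> A \<subseteq> B \<longrightarrow> B \<in> D) \<and>
     (\<forall>A B. A \<in> D \<longrightarrow> B \<in> D \<longrightarrow> A \<inter> B \<in> D) \<and> (\<forall>A. A \<in> D \<or> - A \<in> D)"

lemma ultra_exists:
  assumes fip: "\<And>\<E>. finite \<E> \<Longrightarrow> \<E> \<subseteq> \<B> \<Longrightarrow> b \<inter> \<Inter>\<E> \<noteq> {}"
  shows "\<exists>D. ultra b D \<and> \<B> \<subseteq> D"
proof -
  define \<A> where "\<A> = {\<C>. \<B> \<subseteq> \<C> \<and> (\<forall>\<E>. finite \<E> \<and> \<E> \<subseteq> \<C> \<longrightarrow> b \<inter> \<Inter>\<E> \<noteq> {})}"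
  have "\<exists>M\<in>\<A>. \<forall>X\<in>\<A>. M \<subseteq> X \<longrightarrow> X = M"
  proof (rule subset_Zorn_nonempty)
    show "\<A> \<noteq> {}" using fip unfolding \<A>_def by blast
    fix \<C> assume ne: "\<C> \<noteq> {}" and ch: "subset.chain \<A> \<C>"
    have "b \<inter> \<Inter>\<E> \<noteq> {}" if \<E>: "finite \<E>" "\<E> \<subseteq> \<Union>\<C>" for \<E>
    proof -
      obtain X where "X \<in> \<C>" "\<E> \<subseteq> X"
        using finite_subset_Union_chain[OF \<E> ne ch] by blast
      moreover from this have "X \<in> \<A>" using ch unfolding subset.chain_def by blast
      ultimately show ?thesis using \<E>(1) unfolding \<A>_def by simp
    qed
    moreover have "\<B> \<subseteq> \<Union>\<C>"
    proof -
      obtain X where "X \<in> \<C>" using ne by blast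
      moreover from this have "X \<in> \<A>" using ch unfolding subset.chain_def by blast
      ultimately show ?thesis unfolding \<A>_def by blast
    qed
    ultimately show "\<Union>\<C> \<in> \<A>" unfolding \<A>_def by blast
  qed
  then obtain D where "D \<in> \<A>" and max: "\<And>X. X \<in> \<A> \<Longrightarrow> D \<subseteq> X \<Longrightarrow> X = D"
    by metis
  then have D: "\<B> \<subseteq> D" "\<And>\<E>. finite \<E> \<Longrightarrow> \<E> \<subseteq> D \<Longrightarrow> b \<inter> \<Inter>\<E> \<noteq> {}"
    unfolding \<A>_def by simp_all
  \<comment> \<open>Maximality in usable form: a set outside \<open>D\<close> is refuted by finitely
    many members of \<open>D\<close>.\<close>
  have ex: "\<exists>\<E>. finite \<E> \<and> \<E> \<subseteq> D \<and> b \<inter> \<Inter>\<E> \<inter> X = {}" if "X \<notin> D" for X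
  proof -
    have "insert X D \<notin> \<A>" using max[of "insert X D"] that by blast
    moreover have "\<B> \<subseteq> insert X D" using D(1) by blast
    ultimately obtain \<E> where \<E>: "finite \<E>" "\<E> \<subseteq> insert X D" "b \<inter> \<Inter>\<E> = {}"
      unfolding \<A>_def mem_Collect_eq by metis
    then show ?thesis
      by (intro exI[of _ "\<E> - {X}"]) auto
  qed
  have "ultra b D" unfolding ultra_def
  proof (intro conjI allI impI)
    show "b \<in> D" using ex[of b] D(2) by blast
    show "{} \<notin> D" using D(2)[of "{{}}"] by auto
    fix A
    show "A \<in> D \<or> - A \<in> D"
    proof (rule ccontr)
      assume "\<not> ?thesis"
      then obtain \<E> \<E>' where "finite \<E>" "\<E> \<subseteq> D" "b \<inter> \<Inter>\<E> \<inter> A = {}"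
        "finite \<E>'" "\<E>' \<subseteq> D" "b \<inter> \<Inter>\<E>' \<inter> - A = {}"
        using ex by meson
      moreover from this have "b \<inter> \<Inter>(\<E> \<union> \<E>') \<noteq> {}" by (intro D(2)) auto
      then obtain x where "x \<in> b" "x \<in> \<Inter>\<E>" "x \<in> \<Inter>\<E>'" by blast
      ultimately show False by blast
    qed
    fix B
    show "B \<in> D" if "A \<in> D" "A \<subseteq> B"
    proof (rule ccontr)
      assume "B \<notin> D"
      then obtain \<E> where "finite \<E>" "\<E> \<subseteq> D" "b \<inter> \<Inter>\<E> \<inter> B = {}" using ex by meson
      moreover from this have "b \<inter> \<Inter>(insert A \<E>) \<noteq> {}" using that by (intro D(2)) auto
      then obtain x where "x \<in> b" "x \<in> \<Inter>\<E>" "x \<in> A" by blast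
      ultimately show False using that by blast
    qed
    show "A \<inter> B \<in> D" if "A \<in> D" "B \<in> D"
    proof (rule ccontr)
      assume "A \<inter> B \<notin> D"
      then obtain \<E> where "finite \<E>" "\<E> \<subseteq> D" "b \<inter> \<Inter>\<E> \<inter> (A \<inter> B) = {}" using ex by meson
      moreover from this have "b \<inter> \<Inter>(insert A (insert B \<E>)) \<noteq> {}" using that by (intro D(2)) auto
      then obtain x where "x \<in> b" "x \<in> \<Inter>\<E>" "x \<in> A" "x \<in> B" by blast
      ultimately show False by blast
    qed
  qed
  then show ?thesis using D(1) by blast
qed

lemma
  assumes "ultra b D"
  shows ultra_top: "b \<in> D" and ultra_empty: "{} \<notin> D"
    and ultra_mono: "A \<in> D \<Longrightarrow> A \<subseteq> B \<Longrightarrow> B \<in> D"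
    and ultra_int: "A \<in> D \<Longrightarrow> B \<in> D \<Longrightarrow> A \<inter> B \<in> D"
    and ultra_compl: "A \<notin> D \<Longrightarrow> - A \<in> D"
  using assms unfolding ultra_def by blast+

lemma ultra_un:
  assumes "ultra b D" and "A \<union> B \<in> D"
  shows "A \<in> D \<or> B \<in> D"
proof (rule ccontr)
  assume "\<not> ?thesis"
  then have "- A \<inter> - B \<in> D" using assms(1) by (meson ultra_compl ultra_int)
  then have "(- A \<inter> - B) \<inter> (A \<union> B) \<in> D" using assms by (meson ultra_int)
  moreover have "(- A \<inter> - B) \<inter> (A \<union> B) = {}" by blast
  ultimately show False using assms(1) ultra_empty by metis
qed

section \<open>Scales on products of wide points\<close>

text \<open>The points whose cofinality in \<open>K\<close> exceeds the first uncountable cardinal.\<close>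

definition wide :: "'k::wellorder set \<Rightarrow> 'k \<Rightarrow> bool" where
  "wide K \<beta> \<longleftrightarrow> (\<exists>x\<in>K. x < \<beta>) \<and>
     (\<forall>g :: omega1 \<Rightarrow> 'k. (\<forall>\<xi>. g \<xi> \<in> K \<and> g \<xi> < \<beta>) \<longrightarrow> (\<exists>y\<in>K. y < \<beta> \<and> (\<forall>\<xi>. g \<xi> < y)))"

text \<open>The object of study is the product of the sets \<open>K\<close> below \<open>n\<close>,
  over \<open>n\<close> in \<open>b\<close>. A family indexed below \<open>t\<close> dominates it
  everywhere, so all cofinalities of its ultraproducts are found in \<open>I\<close> and are at most
  \<open>t\<close>.\<close>

locale scales =
  fixes K :: "'k::wellorder set" and b :: "'k set" and I :: "'i::wellorder set" and t :: 'i
  assumes countable_b: "countable b" and wide_b: "n \<in> b \<Longrightarrow> wide K n"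
    and t_in: "t \<in> I"
    and dominating: "\<exists>d. (\<forall>i\<in>I. \<forall>n\<in>b. d i n \<in> K \<and> d i n < n) \<and>
      (\<forall>h. (\<forall>n\<in>b. h n \<in> K \<and> h n < n) \<longrightarrow> (\<exists>i\<in>I. i < t \<and> (\<forall>n\<in>b. h n \<le> d i n)))"
begin

definition P :: "('k \<Rightarrow> 'k) set" where
  "P = {h. \<forall>n\<in>b. h n \<in> K \<and> h n < n}"

definition Seg :: "'i \<Rightarrow> 'i set" where
  "Seg l = {i\<in>I. i < l}"

text \<open>The coordinates where \<open>h \<le> g\<close> fails. Membership in an ideal thus reads
  \<open>h \<le> g\<close> modulo the ideal; membership in an ultrafilter on \<open>b\<close> reads
  \<open>g < h\<close>, and non-membership \<open>h \<le> g\<close>.\<close>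

definition above :: "('k \<Rightarrow> 'k) \<Rightarrow> ('k \<Rightarrow> 'k) \<Rightarrow> 'k set" where
  "above h g = {n\<in>b. g n < h n}"

definition cofinal_mod :: "'k set set \<Rightarrow> 'i \<Rightarrow> bool" where
  "cofinal_mod D l \<longleftrightarrow> (\<exists>g. (\<forall>i\<in>Seg l. g i \<in> P) \<and> (\<forall>h\<in>P. \<exists>i\<in>Seg l. above h (g i) \<notin> D))"

text \<open>
  The cofinality of the ultraproduct, as a least index rather than a cardinal; minimality makes it
  regular, so that no cardinal arithmetic is needed. Then \<open>J l\<close> is the ideal usually written
  \<open>J\<^bsub><l\<^esub>\<close> in pcf theory.
\<close>

definition cofinality :: "'k set set \<Rightarrow> 'i" where
  "cofinality D = (LEAST l. l \<in> I \<and> cofinal_mod D l)"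

definition J :: "'i \<Rightarrow> 'k set set" where
  "J l = {c. c \<subseteq> b \<and> (\<forall>D. ultra b D \<longrightarrow> c \<in> D \<longrightarrow> cofinality D < l)}"

definition incr :: "'i \<Rightarrow> 'i set \<Rightarrow> ('i \<Rightarrow> 'k \<Rightarrow> 'k) \<Rightarrow> bool" where
  "incr l S f \<longleftrightarrow> (\<forall>i\<in>S. f i \<in> P) \<and> (\<forall>k\<in>S. \<forall>i\<in>S. k < i \<longrightarrow> above (f k) (f i) \<in> J l)"

lemma above_sub: "above h g \<subseteq> b"
  by (auto simp: above_def)

lemma above_trans: "above h g \<subseteq> above h k \<union> above k g"
  by (auto simp: above_def)

lemma SegD: "i \<in> Seg l \<Longrightarrow> i \<in> I \<and> i < l"
  by (simp add: Seg_def)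

lemma Seg_trans: "k \<in> Seg i \<Longrightarrow> i \<in> Seg l \<Longrightarrow> k \<in> Seg l"
  by (auto simp: Seg_def)

lemma P_nonempty: "\<exists>h. h \<in> P"
  using wide_b unfolding P_def wide_def mem_Collect_eq by metis

lemma P_max: "h \<in> P \<Longrightarrow> g \<in> P \<Longrightarrow> (\<lambda>n. max (h n) (g n)) \<in> P"
  by (auto simp: P_def max_def)

text \<open>Wideness gives a bound at each coordinate separately, and choice glues these. That the
  bound is strict and holds everywhere is what later separates successive stages.\<close>

lemma P_ub:
  fixes g :: "omega1 \<Rightarrow> 'k \<Rightarrow> 'k"
  assumes "\<And>\<xi>. g \<xi> \<in> P"
  shows "\<exists>h\<in>P. \<forall>\<xi>. \<forall>n\<in>b. g \<xi> n < h n"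
proof -
  have "\<exists>y. y \<in> K \<and> y < n \<and> (\<forall>\<xi>. g \<xi> n < y)" if "n \<in> b" for n
  proof -
    have "\<forall>\<xi>. g \<xi> n \<in> K \<and> g \<xi> n < n" using assms that unfolding P_def by auto
    moreover have "(\<forall>\<xi>. g \<xi> n \<in> K \<and> g \<xi> n < n) \<longrightarrow> (\<exists>y\<in>K. y < n \<and> (\<forall>\<xi>. g \<xi> n < y))"
      using wide_b[OF that] unfolding wide_def by (elim conjE allE[of _ "\<lambda>\<xi>. g \<xi> n"])
    ultimately show ?thesis by blast
  qed
  then have "\<forall>n\<in>b. \<exists>y. y \<in> K \<and> y < n \<and> (\<forall>\<xi>. g \<xi> n < y)" by simp
  from bchoice[OF this] obtain h where "\<forall>n\<in>b. h n \<in> K \<and> h n < n \<and> (\<forall>\<xi>. g \<xi> n < h n)" ..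
  then show ?thesis unfolding P_def by (intro bexI[of _ h]) simp_all
qed

lemma P_ub_below:
  fixes g :: "omega1 \<Rightarrow> 'k \<Rightarrow> 'k"
  assumes "\<And>\<eta>. \<eta> < \<xi> \<Longrightarrow> g \<eta> \<in> P"
  shows "\<exists>h\<in>P. \<forall>\<eta><\<xi>. \<forall>n\<in>b. g \<eta> n < h n"
proof -
  obtain e where "e \<in> P" using P_nonempty by blast
  then have "(if \<eta> < \<xi> then g \<eta> else e) \<in> P" for \<eta> using assms by simp
  then obtain h where "h \<in> P" "\<And>\<eta> n. n \<in> b \<Longrightarrow> (if \<eta> < \<xi> then g \<eta> else e) n < h n"
    using P_ub[of "\<lambda>\<eta>. if \<eta> < \<xi> then g \<eta> else e"] by blast
  moreover from this(2) have "g \<eta> n < h n" if "\<eta> < \<xi>" "n \<in> b" for \<eta> n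
    using that by metis
  ultimately show ?thesis by blast
qed

lemma P_ub_countable:
  assumes "countable G" and "G \<subseteq> P"
  shows "\<exists>h\<in>P. \<forall>g\<in>G. \<forall>n\<in>b. g n < h n"
proof (cases "G = {}")
  case True
  then show ?thesis using P_nonempty by auto
next
  case False
  then obtain g :: "omega1 \<Rightarrow> _" where g: "range g = G"
    using omega1_onto_countable assms(1) by blast
  have "g \<xi> \<in> P" for \<xi> using g assms(2) by blast
  from P_ub[of g, OF this] show ?thesis unfolding g[symmetric] by auto
qed

section \<open>Cofinalities of ultraproducts and the associated ideals\<close>

lemma cofinal_mod_t:
  assumes "ultra b D"
  shows "cofinal_mod D t"
proof -
  obtain d where d: "\<forall>i\<in>I. \<forall>n\<in>b. d i n \<in> K \<and> d i n < n"
    "\<And>h. \<forall>n\<in>b. h n \<in> K \<and> h n < n \<Longrightarrow> \<exists>i\<in>I. i < t \<and> (\<forall>n\<in>b. h n \<le> d i n)"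
    using dominating by blast
  have "\<exists>i\<in>Seg t. above h (d i) \<notin> D" if "h \<in> P" for h
  proof -
    have "\<forall>n\<in>b. h n \<in> K \<and> h n < n" using that by (simp add: P_def)
    then obtain i where "i \<in> I" "i < t" "\<forall>n\<in>b. h n \<le> d i n" using d(2) by blast
    moreover from this have "above h (d i) = {}" by (auto simp: above_def not_less)
    ultimately show ?thesis using ultra_empty[OF assms] by (auto simp: Seg_def)
  qed
  then show ?thesis using d(1) unfolding cofinal_mod_def by (intro exI[of _ d]) (auto simp: Seg_def P_def)
qed

lemma
  assumes "ultra b D"
  shows cofinality_in: "cofinality D \<in> I" and cofinal_mod_cofinality: "cofinal_mod D (cofinality D)"
  using LeastI[of "\<lambda>l. l \<in> I \<and> cofinal_mod D l" t] cofinal_mod_t[OF assms] t_in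
  unfolding cofinality_def by blast+

lemma not_cofinal:
  assumes "l \<in> I" and "l < cofinality D" and "\<And>i. i \<in> Seg l \<Longrightarrow> g i \<in> P"
  shows "\<exists>h\<in>P. \<forall>i\<in>Seg l. above h (g i) \<in> D"
proof -
  have "\<not> cofinal_mod D l" using assms(1,2) not_less_Least unfolding cofinality_def by blast
  then show ?thesis using assms(3) unfolding cofinal_mod_def by blast
qed

lemma J_subset: "c \<in> J l \<Longrightarrow> c' \<subseteq> c \<Longrightarrow> c' \<in> J l"
  unfolding J_def mem_Collect_eq by (meson subset_trans ultra_mono)

lemma J_un: "c \<in> J l \<Longrightarrow> c' \<in> J l \<Longrightarrow> c \<union> c' \<in> J l"
  unfolding J_def mem_Collect_eq by (meson Un_least ultra_un)

lemma J_empty: "{} \<in> J l"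
  unfolding J_def using ultra_empty by auto

lemma J_Union: "finite \<E> \<Longrightarrow> \<E> \<subseteq> J l \<Longrightarrow> \<Union>\<E> \<in> J l"
  by (induction rule: finite_induct) (auto intro: J_un J_empty)

lemma J_sub: "c \<in> J l \<Longrightarrow> c \<subseteq> b"
  by (simp add: J_def)

lemma not_JE:
  assumes "c \<notin> J l" and "c \<subseteq> b"
  obtains D where "ultra b D" "c \<in> D" "l \<le> cofinality D"
  using assms unfolding J_def mem_Collect_eq by (meson not_less)

lemma J_disjoint: "ultra b D \<Longrightarrow> c \<in> D \<Longrightarrow> c \<in> J l \<Longrightarrow> cofinality D < l"
  by (simp add: J_def)

lemma incr_above:
  assumes "incr l S f" and "k \<in> S" "i \<in> S" "k \<le> i"
  shows "above (f k) (f i) \<in> J l"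
proof (cases "k = i")
  case True
  then have "above (f k) (f i) = {}" by (auto simp: above_def)
  then show ?thesis using J_empty by simp
qed (use assms in \<open>auto simp: incr_def\<close>)

text \<open>Recursion on the index: bound the earlier values modulo the ideal, then take the maximum
  with \<open>u i\<close>, which only shrinks the exceptional sets.\<close>

lemma increasing_exists:
  assumes bd: "\<And>a' h. a' \<in> Seg a \<Longrightarrow> (\<And>i. i \<in> Seg a' \<Longrightarrow> h i \<in> P) \<Longrightarrow>
      \<exists>g\<in>P. \<forall>i\<in>Seg a'. above (h i) g \<in> J l"
    and u: "\<And>i. i \<in> Seg a \<Longrightarrow> u i \<in> P"
  shows "\<exists>f. incr l (Seg a) f \<and> (\<forall>i\<in>Seg a. \<forall>n\<in>b. u i n \<le> f i n)"
proof -
  define Q where "Q f i r \<longleftrightarrow> (i \<in> Seg a \<longrightarrow>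
    r \<in> P \<and> (\<forall>n\<in>b. u i n \<le> r n) \<and> (\<forall>k\<in>Seg i. above (f k) r \<in> J l))" for f i r
  have "\<exists>f. \<forall>i. Q f i (f i)"
  proof (rule dependent_wellorder_choice)
    show "Q f i r = Q g i r" if "\<And>x. x < i \<Longrightarrow> f x = g x" for r f g i
      using that unfolding Q_def Seg_def by auto
    fix i f assume IH: "\<And>k. k < i \<Longrightarrow> Q f k (f k)"
    show "\<exists>r. Q f i r"
    proof (cases "i \<in> Seg a")
      case True
      have "f k \<in> P" if "k \<in> Seg i" for k
        using IH[of k] that Seg_trans[OF that True] SegD[OF that] unfolding Q_def by blast
      from bd[OF True, of f, OF this] obtain g where g: "g \<in> P" "\<forall>k\<in>Seg i. above (f k) g \<in> J l" by blast
      have "above (f k) (\<lambda>n. max (u i n) (g n)) \<in> J l" if "k \<in> Seg i" for k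
        by (rule J_subset[OF g(2)[rule_format, OF that]]) (auto simp: above_def)
      then have "Q f i (\<lambda>n. max (u i n) (g n))"
        using P_max[OF u[OF True] g(1)] unfolding Q_def by auto
      then show ?thesis by blast
    qed (simp add: Q_def)
  qed
  then obtain f where "\<And>i. Q f i (f i)" by blast
  then show ?thesis unfolding Q_def incr_def
    by (intro exI[of _ f]) (auto simp: Seg_def)
qed

text \<open>
  If no bound exists, one finds bounds \<open>G \<xi>\<close>, increasing with the countable ordinal \<open>\<xi>\<close>, such that for
  a single late index \<open>k\<close> the sets \<open>above (f k) (G \<xi>)\<close> decrease strictly. This is impossible inside the
  countable set \<open>b\<close>.
\<close>

lemma bounding:
  assumes "a \<in> I" and "a < l" and "\<And>i. i \<in> Seg a \<Longrightarrow> h i \<in> P"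
  shows "\<exists>g\<in>P. \<forall>i\<in>Seg a. above (h i) g \<in> J l"
  using assms
proof (induction a arbitrary: h rule: less_induct)
  case (less a)
  have "\<exists>f. incr l (Seg a) f \<and> (\<forall>i\<in>Seg a. \<forall>n\<in>b. h i n \<le> f i n)"
  proof (rule increasing_exists)
    fix a' h' assume "a' \<in> Seg a" "\<And>i. i \<in> Seg a' \<Longrightarrow> h' i \<in> P"
    then show "\<exists>g\<in>P. \<forall>i\<in>Seg a'. above (h' i) g \<in> J l"
      using less.IH[of a' h'] less.prems(2) by (auto simp: Seg_def)
  qed (use less.prems in blast)
  then obtain f where f: "incr l (Seg a) f" and hf: "\<And>i n. i \<in> Seg a \<Longrightarrow> n \<in> b \<Longrightarrow> h i n \<le> f i n"
    by blast
  have fP: "f i \<in> P" if "i \<in> Seg a" for i using f that by (simp add: incr_def)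
  have suff: ?case if "\<exists>g\<in>P. \<forall>i\<in>Seg a. above (f i) g \<in> J l"
  proof -
    from that obtain g where "g \<in> P" and g: "\<forall>i\<in>Seg a. above (f i) g \<in> J l" by blast
    moreover have "above (h i) g \<in> J l" if "i \<in> Seg a" for i
      by (rule J_subset[OF g[rule_format, OF that]]) (use hf[OF that] in \<open>force simp: above_def\<close>)
    ultimately show ?thesis by blast
  qed
  \<comment> \<open>If \<open>omega1\<close> many indices are cofinal in the segment, an everywhere
    bound of their functions suffices. Otherwise every \<open>omega1\<close>-sequence of indices is
    bounded, which provides the late index \<open>k\<close>.\<close>
  show ?case
  proof (cases "\<exists>e :: omega1 \<Rightarrow> 'i. (\<forall>\<xi>. e \<xi> \<in> Seg a) \<and> (\<forall>i\<in>Seg a. \<exists>\<xi>. i \<le> e \<xi>)")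
    case True
    then obtain e :: "omega1 \<Rightarrow> 'i" where e: "\<And>\<xi>. e \<xi> \<in> Seg a" "\<And>i. i \<in> Seg a \<Longrightarrow> \<exists>\<xi>. i \<le> e \<xi>" by blast
    obtain g where g: "g \<in> P" "\<And>\<xi> n. n \<in> b \<Longrightarrow> f (e \<xi>) n < g n"
      using P_ub[of "\<lambda>\<xi>. f (e \<xi>)"] fP e(1) by blast
    have "above (f i) g \<in> J l" if "i \<in> Seg a" for i
    proof -
      obtain \<xi> where "i \<le> e \<xi>" using e(2)[OF \<open>i \<in> Seg a\<close>] by blast
      then have "above (f i) (f (e \<xi>)) \<in> J l" by (rule incr_above[OF f \<open>i \<in> Seg a\<close> e(1)])
      moreover have "above (f i) g \<subseteq> above (f i) (f (e \<xi>))"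
        using g(2)[of _ \<xi>] by (auto simp: above_def intro: less_trans)
      ultimately show ?thesis by (rule J_subset)
    qed
    then show ?thesis using suff g(1) by blast
  next
    case False
    have bounded: "\<exists>i\<in>Seg a. \<forall>\<xi>. e \<xi> < i" if "\<And>\<xi>. e \<xi> \<in> Seg a" for e :: "omega1 \<Rightarrow> 'i"
      using False that by (meson not_le)
    show ?thesis
    proof (rule ccontr)
      assume "\<not> ?thesis"
      with suff have nb: "\<And>g. g \<in> P \<Longrightarrow> \<exists>i\<in>Seg a. above (f i) g \<notin> J l" by blast
      \<comment> \<open>If \<open>g\<close> fails, it fails modulo some \<open>D\<close> of
        cofinality at least \<open>l\<close>. As \<open>a\<close> is smaller, the whole sequence has
        a bound \<open>g'\<close> modulo \<open>D\<close>, and for late \<open>k\<close> both facts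
        meet at one coordinate: \<open>g n < f k n \<le> g' n\<close>.\<close>
      have step: "\<exists>g' i. g' \<in> P \<and> i \<in> Seg a \<and> (\<forall>k\<in>Seg a. i \<le> k \<longrightarrow>
          (\<exists>n. n \<in> above (f k) g \<and> f k n \<le> g' n))" if g: "g \<in> P" for g
      proof -
        obtain i where i: "i \<in> Seg a" "above (f i) g \<notin> J l" using nb[OF g] by blast
        obtain D where D: "ultra b D" "above (f i) g \<in> D" "l \<le> cofinality D"
          using not_JE[OF i(2) above_sub] by metis
        have "a < cofinality D" using D(3) less.prems(2) by simp
        from not_cofinal[of a D f, OF less.prems(1) this fP] obtain h'
          where h': "h' \<in> P" "\<And>k. k \<in> Seg a \<Longrightarrow> above h' (f k) \<in> D" by blast
        have "\<exists>n. n \<in> above (f k) g \<and> f k n \<le> h' n" if k: "k \<in> Seg a" "i \<le> k" for k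
        proof -
          have "above (f i) (f k) \<notin> D"
            using incr_above[OF f i(1) k] J_disjoint[OF D(1)] D(3) by (meson not_less)
          moreover have "above (f i) (f k) \<union> above (f k) g \<in> D"
            by (rule ultra_mono[OF D(1,2) above_trans])
          ultimately have "above (f k) g \<in> D" using ultra_un[OF D(1)] by blast
          then have "above (f k) g \<inter> above h' (f k) \<in> D"
            using h'(2)[OF k(1)] ultra_int[OF D(1)] by blast
          then have "above (f k) g \<inter> above h' (f k) \<noteq> {}" using ultra_empty[OF D(1)] by metis
          then show ?thesis by (auto simp: above_def)
        qed
        then show ?thesis using h'(1) i(1) by blast
      qed
      then obtain nx ix where nx: "\<And>g. g \<in> P \<Longrightarrow> nx g \<in> P" and ix: "\<And>g. g \<in> P \<Longrightarrow> ix g \<in> Seg a"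
        and wit: "\<And>g k. g \<in> P \<Longrightarrow> k \<in> Seg a \<Longrightarrow> ix g \<le> k \<Longrightarrow> \<exists>n. n \<in> above (f k) g \<and> f k n \<le> nx g n"
        by metis
      have "\<exists>G :: omega1 \<Rightarrow> _. \<forall>\<xi>. G \<xi> \<in> P \<and> (\<forall>\<eta><\<xi>. \<forall>n\<in>b. nx (G \<eta>) n < G \<xi> n)"
      proof (rule dependent_wellorder_choice)
        fix \<xi> :: omega1 and G :: "omega1 \<Rightarrow> 'k \<Rightarrow> 'k"
        assume "\<And>\<eta>. \<eta> < \<xi> \<Longrightarrow> G \<eta> \<in> P \<and> (\<forall>\<zeta><\<eta>. \<forall>n\<in>b. nx (G \<zeta>) n < G \<eta> n)"
        then show "\<exists>r. r \<in> P \<and> (\<forall>\<eta><\<xi>. \<forall>n\<in>b. nx (G \<eta>) n < r n)"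
          using P_ub_below[of \<xi> "\<lambda>\<eta>. nx (G \<eta>)"] nx by blast
      qed auto
      then obtain G :: "omega1 \<Rightarrow> _" where G: "\<And>\<xi>. G \<xi> \<in> P"
        "\<And>\<eta> \<xi> n. \<eta> < \<xi> \<Longrightarrow> n \<in> b \<Longrightarrow> nx (G \<eta>) n < G \<xi> n" by blast
      obtain k where k: "k \<in> Seg a" "\<And>\<xi>. ix (G \<xi>) < k"
        using bounded[of "\<lambda>\<xi>. ix (G \<xi>)"] ix G(1) by blast
      then have "\<exists>n. n \<in> above (f k) (G \<xi>) \<and> f k n \<le> nx (G \<xi>) n" for \<xi>
        using wit[OF G(1)] less_imp_le by blast
      then obtain N where N: "\<And>\<xi>. N \<xi> \<in> above (f k) (G \<xi>)" "\<And>\<xi>. f k (N \<xi>) \<le> nx (G \<xi>) (N \<xi>)"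
        by metis
      \<comment> \<open>A common coordinate \<open>n\<close> would give
        \<open>f k n \<le> nx (G \<eta>) n < G \<xi> n < f k n\<close>.\<close>
      have "N \<eta> \<noteq> N \<xi>" if "\<eta> < \<xi>" for \<eta> \<xi>
      proof
        assume eq: "N \<eta> = N \<xi>"
        have "N \<xi> \<in> b" "G \<xi> (N \<xi>) < f k (N \<xi>)" using N(1)[of \<xi>] by (auto simp: above_def)
        moreover have "f k (N \<xi>) \<le> nx (G \<eta>) (N \<xi>)" using N(2)[of \<eta>] eq by simp
        ultimately show False using G(2)[OF that, of "N \<xi>"] by (meson leD less_trans order.strict_trans2)
      qed
      then show False
        using omega1_not_inj_countable[OF countable_b, of N] N(1) above_sub by blast
    qed
  qed
qed

end

text \<open>Modulo the ideal, a finite intersection of sets \<open>c i\<close> is the one with the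
  largest index and hence positive. So these sets and the complements of members of the ideal have
  the finite intersection property.\<close>

lemma ultra_exists_ideal:
  fixes c :: "'i::linorder \<Rightarrow> 'a set"
  assumes un: "\<And>\<E>. finite \<E> \<Longrightarrow> \<E> \<subseteq> \<J> \<Longrightarrow> \<Union>\<E> \<in> \<J>" and sub: "\<And>A B. A \<in> \<J> \<Longrightarrow> B \<subseteq> A \<Longrightarrow> B \<in> \<J>"
    and "S \<noteq> {}" and cb: "\<And>i. i \<in> S \<Longrightarrow> c i \<subseteq> b" and pos: "\<And>i. i \<in> S \<Longrightarrow> c i \<notin> \<J>"
    and decr: "\<And>i k. i \<in> S \<Longrightarrow> k \<in> S \<Longrightarrow> i \<le> k \<Longrightarrow> c k - c i \<in> \<J>"
  shows "\<exists>D. ultra b D \<and> (\<forall>i\<in>S. c i \<in> D) \<and> (\<forall>e\<in>\<J>. e \<notin> D)"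
proof -
  have "\<exists>D. ultra b D \<and> c ` S \<union> (\<lambda>e. b - e) ` \<J> \<subseteq> D"
  proof (rule ultra_exists, rule notI)
    fix \<E> assume "finite \<E>" and \<E>: "\<E> \<subseteq> c ` S \<union> (\<lambda>e. b - e) ` \<J>" and empty: "b \<inter> \<Inter>\<E> = {}"
    obtain S' where S': "finite S'" "S' \<subseteq> S" "\<E> \<inter> c ` S = c ` S'"
      using finite_subset_image[of "\<E> \<inter> c ` S" c S] \<open>finite \<E>\<close> by blast
    obtain \<F> where \<F>: "finite \<F>" "\<F> \<subseteq> \<J>" "\<E> \<inter> (\<lambda>e. b - e) ` \<J> = (\<lambda>e. b - e) ` \<F>"
      using finite_subset_image[of "\<E> \<inter> (\<lambda>e. b - e) ` \<J>" "\<lambda>e. b - e" \<J>] \<open>finite \<E>\<close> by blast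
    obtain s where s: "s \<in> S" using \<open>S \<noteq> {}\<close> by blast
    \<comment> \<open>The extra element \<open>s\<close> keeps the maximum meaningful when no
      \<open>c i\<close> occurs in \<open>\<E>\<close>.\<close>
    define k where "k = Max (insert s S')"
    have kS: "k \<in> S" using Max_in[of "insert s S'"] S' s unfolding k_def by auto
    have le: "i \<le> k" if "i \<in> S'" for i using that S'(1) unfolding k_def by simp
    define \<G> where "\<G> = (\<lambda>i. c k - c i) ` S' \<union> \<F>"
    have "\<G> \<subseteq> \<J>" using decr kS le S'(2) \<F>(2) unfolding \<G>_def by blast
    then have "\<Union>\<G> \<in> \<J>" using S'(1) \<F>(1) by (intro un) (simp_all add: \<G>_def)
    moreover have "c k \<subseteq> \<Union>\<G>"
    proof
      fix n assume n: "n \<in> c k"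
      then have "n \<in> b" using cb kS by blast
      then have "n \<notin> \<Inter>\<E>" using empty by blast
      then obtain E where "E \<in> \<E>" "n \<notin> E" by blast
      then have "E \<in> \<E> \<inter> c ` S \<or> E \<in> \<E> \<inter> (\<lambda>e. b - e) ` \<J>" using \<E> by blast
      then have "E \<in> c ` S' \<or> E \<in> (\<lambda>e. b - e) ` \<F>" unfolding S'(3) \<F>(3) .
      then show "n \<in> \<Union>\<G>" using n \<open>n \<in> b\<close> \<open>n \<notin> E\<close> unfolding \<G>_def by (elim disjE imageE) (simp_all, blast+)
    qed
    ultimately show False using sub pos kS by blast
  qed
  then obtain D where D: "ultra b D" "c ` S \<union> (\<lambda>e. b - e) ` \<J> \<subseteq> D" by blast
  have "e \<notin> D" if "e \<in> \<J>" for e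
  proof
    assume "e \<in> D"
    moreover have "b - e \<in> D" using D(2) that by blast
    ultimately have "e \<inter> (b - e) \<in> D" using D(1) ultra_int by blast
    moreover have "e \<inter> (b - e) = {}" by blast
    ultimately show False using D(1) ultra_empty by metis
  qed
  then show ?thesis using D by blast
qed

context scales
begin

section \<open>Maximal cofinalities and universal sequences\<close>

lemma J_mono: "l \<le> l' \<Longrightarrow> J l \<subseteq> J l'"
  unfolding J_def by (auto intro: less_le_trans)

lemma above_eq_UNIV: "b \<subseteq> above h g \<union> above g h'" if "\<And>n. n \<in> b \<Longrightarrow> h' n < h n"
  using that by (force simp: above_def)

text \<open>A cofinal sequence of length below \<open>l\<close> would be bounded modulo
  \<open>J l\<close> by \<open>bounding\<close>, hence modulo \<open>D\<close>; a function strictly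
  above that bound contradicts cofinality.\<close>

lemma disjoint_J_imp_le:
  assumes "ultra b D" and "\<And>c. c \<in> J l \<Longrightarrow> c \<notin> D"
  shows "l \<le> cofinality D"
proof (rule ccontr)
  assume "\<not> l \<le> cofinality D"
  then have "cofinality D < l" by simp
  obtain g where g: "\<And>i. i \<in> Seg (cofinality D) \<Longrightarrow> g i \<in> P" "\<And>h. h \<in> P \<Longrightarrow> \<exists>i\<in>Seg (cofinality D). above h (g i) \<notin> D"
    using cofinal_mod_cofinality[OF assms(1)] unfolding cofinal_mod_def by blast
  obtain h where h: "h \<in> P" "\<And>i. i \<in> Seg (cofinality D) \<Longrightarrow> above (g i) h \<in> J l"
    using bounding[of "cofinality D" l g, OF cofinality_in[OF assms(1)] \<open>cofinality D < l\<close> g(1)] by blast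
  obtain h' where h': "h' \<in> P" "\<And>n. n \<in> b \<Longrightarrow> h n < h' n"
    using P_ub_countable[of "{h}"] h(1) by auto
  obtain i where i: "i \<in> Seg (cofinality D)" "above h' (g i) \<notin> D" using g(2)[OF h'(1)] by blast
  have "above h' (g i) \<union> above (g i) h \<in> D"
    by (rule ultra_mono[OF assms(1) ultra_top[OF assms(1)] above_eq_UNIV]) (rule h'(2))
  then have "above (g i) h \<in> D" using i(2) ultra_un[OF assms(1)] by blast
  then show False using assms(2) h(2)[OF i(1)] by blast
qed

text \<open>The ideals \<open>J l\<close>, for \<open>l\<close> the cofinality of an ultrafilter
  containing \<open>c\<close>, form a chain, and none of them contains \<open>c\<close>. An
  ultrafilter that contains \<open>c\<close> and misses their union has cofinality at least every
  such \<open>l\<close>.\<close>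

lemma max_cofinality_exists:
  assumes "c \<subseteq> b" and "c \<noteq> {}"
  shows "\<exists>D. ultra b D \<and> c \<in> D \<and> (\<forall>D'. ultra b D' \<longrightarrow> c \<in> D' \<longrightarrow> cofinality D' \<le> cofinality D)"
proof -
  define L where "L = {cofinality D |D. ultra b D \<and> c \<in> D}"
  define \<J> where "\<J> = \<Union>(J ` L)"
  have "\<exists>D. ultra b D \<and> {c} \<subseteq> D"
  proof (rule ultra_exists)
    fix \<E> assume "\<E> \<subseteq> {c}"
    then show "b \<inter> \<Inter>\<E> \<noteq> {}" using assms by (cases "\<E> = {}") auto
  qed
  then have "L \<noteq> {}" unfolding L_def by blast
  have "\<exists>D. ultra b D \<and> (\<forall>i\<in>{()}. c \<in> D) \<and> (\<forall>e\<in>\<J>. e \<notin> D)"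
  proof (rule ultra_exists_ideal)
    fix \<E> assume "finite \<E>" "\<E> \<subseteq> \<J>"
    then show "\<Union>\<E> \<in> \<J>"
    proof (induction rule: finite_induct)
      case empty
      then show ?case using \<open>L \<noteq> {}\<close> J_empty unfolding \<J>_def by auto
    next
      case (insert e \<E>)
      then obtain l l' where l: "l \<in> L" "l' \<in> L" "e \<in> J l" "\<Union>\<E> \<in> J l'" unfolding \<J>_def by auto
      have "max l l' \<in> L" using l by (simp add: max_def)
      moreover have "e \<in> J (max l l')" "\<Union>\<E> \<in> J (max l l')"
        using l J_mono[of l "max l l'"] J_mono[of l' "max l l'"] by auto
      then have "\<Union>(insert e \<E>) \<in> J (max l l')" using J_un by simp
      ultimately show ?case unfolding \<J>_def by blast
    qed
  next
    fix A B assume "A \<in> \<J>" "B \<subseteq> A"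
    then show "B \<in> \<J>" unfolding \<J>_def using J_subset by blast
  next
    show "c \<notin> \<J>" unfolding \<J>_def L_def J_def by blast
  next
    show "c - c \<in> \<J>" using \<open>L \<noteq> {}\<close> J_empty unfolding \<J>_def by auto
  qed (use assms in auto)
  then obtain D where D: "ultra b D" "c \<in> D" "\<And>e. e \<in> \<J> \<Longrightarrow> e \<notin> D" by blast
  have "cofinality D' \<le> cofinality D" if "ultra b D'" "c \<in> D'" for D'
  proof (rule disjoint_J_imp_le[OF D(1)])
    have "cofinality D' \<in> L" using that unfolding L_def by blast
    then show "e \<notin> D" if "e \<in> J (cofinality D')" for e using D(3) that unfolding \<J>_def by blast
  qed
  then show ?thesis using D by blast
qed

text \<open>Known as max pcf of \<open>c\<close>.\<close>

definition top_cofinality :: "'k set \<Rightarrow> 'i" where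
  "top_cofinality c = cofinality (SOME D. ultra b D \<and> c \<in> D \<and> (\<forall>D'. ultra b D' \<longrightarrow> c \<in> D' \<longrightarrow> cofinality D' \<le> cofinality D))"

lemma top_cofinality:
  assumes "c \<subseteq> b" and "c \<noteq> {}"
  shows "\<exists>D. ultra b D \<and> c \<in> D \<and> cofinality D = top_cofinality c" and "\<And>D. ultra b D \<Longrightarrow> c \<in> D \<Longrightarrow> cofinality D \<le> top_cofinality c"
  using someI_ex[OF max_cofinality_exists[OF assms]] unfolding top_cofinality_def by blast+

lemma top_cofinality_in:
  assumes "c \<subseteq> b" and "c \<noteq> {}"
  shows "top_cofinality c \<in> I"
  using top_cofinality(1)[OF assms] cofinality_in by metis

lemma not_J_top_cofinality:
  assumes "c \<subseteq> b" and "c \<noteq> {}"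
  shows "c \<notin> J (top_cofinality c)"
  using top_cofinality(1)[OF assms] unfolding J_def by force

lemma top_cofinality_less:
  assumes "c \<in> J l" and "c \<noteq> {}"
  shows "top_cofinality c < l"
  using top_cofinality(1)[OF J_sub[OF assms(1)] assms(2)] assms(1) unfolding J_def by force

text \<open>By minimality no shorter segment is cofinal, so for each \<open>\<xi>\<close> some
  function exceeds all members of a cofinal sequence up to \<open>e \<xi>\<close>. Were
  \<open>e\<close> unbounded, a common bound of these functions would exceed the entire
  sequence.\<close>

lemma cofinality_omega1_bounded:
  fixes e :: "omega1 \<Rightarrow> 'i"
  assumes D: "ultra b D" and e: "\<And>\<xi>. e \<xi> \<in> Seg (cofinality D)"
  shows "\<exists>i\<in>Seg (cofinality D). \<forall>\<xi>. e \<xi> < i"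
proof (rule ccontr)
  assume "\<not> ?thesis"
  then have unb: "\<And>i. i \<in> Seg (cofinality D) \<Longrightarrow> \<exists>\<xi>. i \<le> e \<xi>" by (meson not_less)
  obtain g where g: "\<And>i. i \<in> Seg (cofinality D) \<Longrightarrow> g i \<in> P" "\<And>h. h \<in> P \<Longrightarrow> \<exists>i\<in>Seg (cofinality D). above h (g i) \<notin> D"
    using cofinal_mod_cofinality[OF D] unfolding cofinal_mod_def by blast
  have "\<exists>h. h \<in> P \<and> (\<forall>i\<in>Seg (cofinality D). i \<le> e \<xi> \<longrightarrow> above h (g i) \<in> D)" for \<xi>
  proof -
    have "\<exists>h\<in>P. \<forall>i\<in>Seg (e \<xi>). above h (g i) \<in> D"
      using SegD[OF e] by (intro not_cofinal g(1) Seg_trans[OF _ e]) auto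
    then obtain h where h: "h \<in> P" "\<And>i. i \<in> Seg (e \<xi>) \<Longrightarrow> above h (g i) \<in> D" by blast
    have "g (e \<xi>) \<in> P" using g(1) e by blast
    then obtain h' where h': "h' \<in> P" "\<And>n. n \<in> b \<Longrightarrow> h n < h' n" "\<And>n. n \<in> b \<Longrightarrow> g (e \<xi>) n < h' n"
      using P_ub_countable[of "{h, g (e \<xi>)}"] h(1) by auto
    have "above h' (g i) \<in> D" if i: "i \<in> Seg (cofinality D)" "i \<le> e \<xi>" for i
    proof (cases "i = e \<xi>")
      case True
      then have "above h' (g i) = b" using h'(3) by (auto simp: above_def)
      then show ?thesis using D ultra_top by metis
    next
      case False
      then have "i \<in> Seg (e \<xi>)" using i by (auto simp: Seg_def)
      moreover have "above h (g i) \<subseteq> above h' (g i)" using h'(2) by (auto simp: above_def intro: less_trans)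
      ultimately show ?thesis using h(2) ultra_mono[OF D] by blast
    qed
    then show ?thesis using h'(1) by blast
  qed
  then obtain H where H: "\<And>\<xi>. H \<xi> \<in> P" "\<And>\<xi> i. i \<in> Seg (cofinality D) \<Longrightarrow> i \<le> e \<xi> \<Longrightarrow> above (H \<xi>) (g i) \<in> D"
    by metis
  obtain h where h: "h \<in> P" "\<And>\<xi> n. n \<in> b \<Longrightarrow> H \<xi> n < h n" using P_ub[of H] H(1) by blast
  obtain i where i: "i \<in> Seg (cofinality D)" "above h (g i) \<notin> D" using g(2)[OF h(1)] by blast
  obtain \<xi> where "i \<le> e \<xi>" using unb[OF i(1)] by blast
  then have "above (H \<xi>) (g i) \<in> D" by (rule H(2)[OF i(1)])
  moreover have "above (H \<xi>) (g i) \<subseteq> above h (g i)"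
    using h(2) by (auto simp: above_def intro: less_trans)
  ultimately show False using i(2) ultra_mono[OF D] by blast
qed

text \<open>Shelah's universal sequences: a single sequence is cofinal for all ultrafilters of
  cofinality \<open>l\<close> at once.\<close>

definition universal :: "'i \<Rightarrow> ('i \<Rightarrow> 'k \<Rightarrow> 'k) \<Rightarrow> bool" where
  "universal l f \<longleftrightarrow> incr l (Seg l) f \<and>
     (\<forall>D. ultra b D \<longrightarrow> cofinality D = l \<longrightarrow> (\<forall>h\<in>P. \<exists>i\<in>Seg l. above h (f i) \<notin> D))"

text \<open>
  As in \<open>bounding\<close>: if every candidate \<open>G \<eta>\<close> fails for some ultrafilter, and \<open>G \<zeta>\<close> for \<open>\<zeta> > \<eta>\<close> repairs the
  failure of \<open>G \<eta>\<close>, then the sets \<open>above h (G \<zeta> k)\<close> decrease strictly for \<open>\<omega>\<^sub>1\<close> steps.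
\<close>

lemma universal_exists:
  assumes D0: "ultra b D0" and l: "l = cofinality D0"
  shows "\<exists>f. universal l f"
proof (rule ccontr)
  assume "\<not> ?thesis"
  then have fail: "\<exists>D h. ultra b D \<and> cofinality D = l \<and> h \<in> P \<and> (\<forall>i\<in>Seg l. above h (f i) \<in> D)"
    if "incr l (Seg l) f" for f
    using that unfolding universal_def by meson
  have "\<exists>D h g. ultra b D \<and> cofinality D = l \<and> h \<in> P \<and> (\<forall>i\<in>Seg l. above h (f i) \<in> D) \<and>
      (\<forall>i\<in>Seg l. g i \<in> P) \<and> (\<forall>h\<in>P. \<exists>i\<in>Seg l. above h (g i) \<notin> D)"
    if f: "incr l (Seg l) f" for f
  proof -
    obtain D h where D: "ultra b D" "cofinality D = l" and h: "h \<in> P" "\<forall>i\<in>Seg l. above h (f i) \<in> D"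
      using fail[OF f] by blast
    moreover obtain g where "\<forall>i\<in>Seg l. g i \<in> P" "\<forall>h\<in>P. \<exists>i\<in>Seg l. above h (g i) \<notin> D"
      using cofinal_mod_cofinality[OF D(1)] D(2) unfolding cofinal_mod_def by blast
    ultimately show ?thesis by blast
  qed
  then have "\<forall>f. \<exists>T. incr l (Seg l) f \<longrightarrow> ultra b (fst T) \<and> cofinality (fst T) = l \<and> fst (snd T) \<in> P \<and>
      (\<forall>i\<in>Seg l. above (fst (snd T)) (f i) \<in> fst T) \<and>
      (\<forall>i\<in>Seg l. snd (snd T) i \<in> P) \<and> (\<forall>h\<in>P. \<exists>i\<in>Seg l. above h (snd (snd T) i) \<notin> fst T)"
    by (metis fst_conv snd_conv)
  from choice[OF this] obtain F where
    F: "\<And>f. incr l (Seg l) f \<Longrightarrow> ultra b (fst (F f)) \<and> cofinality (fst (F f)) = l \<and> fst (snd (F f)) \<in> P \<and>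
      (\<forall>i\<in>Seg l. above (fst (snd (F f))) (f i) \<in> fst (F f)) \<and>
      (\<forall>i\<in>Seg l. snd (snd (F f)) i \<in> P) \<and>
      (\<forall>h\<in>P. \<exists>i\<in>Seg l. above h (snd (snd (F f)) i) \<notin> fst (F f))" by blast
  define Dx hx tx where "Dx f = fst (F f)" and "hx f = fst (snd (F f))" and "tx f = snd (snd (F f))" for f
  have Dx: "ultra b (Dx f)" "cofinality (Dx f) = l" and hx: "hx f \<in> P"
      "\<And>i. i \<in> Seg l \<Longrightarrow> above (hx f) (f i) \<in> Dx f"
    and tx: "\<And>i. i \<in> Seg l \<Longrightarrow> tx f i \<in> P" "\<And>h. h \<in> P \<Longrightarrow> \<exists>i\<in>Seg l. above h (tx f i) \<notin> Dx f"
    if "incr l (Seg l) f" for f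
    using F[OF that] unfolding Dx_def hx_def tx_def by simp_all
  \<comment> \<open>A new candidate lies everywhere above the earlier candidates and above the truly
    cofinal sequences \<open>tx\<close> attached to their failures; the latter is what repairs those
    failures.\<close>
  define Q where "Q G \<xi> r \<longleftrightarrow> incr l (Seg l) r \<and>
    (\<forall>\<eta><\<xi>. \<forall>i\<in>Seg l. \<forall>n\<in>b. tx (G \<eta>) i n \<le> r i n \<and> G \<eta> i n \<le> r i n)"
    for G :: "omega1 \<Rightarrow> 'i \<Rightarrow> 'k \<Rightarrow> 'k" and \<xi> r
  have "\<exists>G. \<forall>\<xi>. Q G \<xi> (G \<xi>)"
  proof (rule dependent_wellorder_choice)
    show "Q f \<xi> r = Q g \<xi> r" if "\<And>x. x < \<xi> \<Longrightarrow> f x = g x" for r f g \<xi>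
      using that unfolding Q_def by auto
    fix \<xi> G assume IH: "\<And>\<eta>. \<eta> < \<xi> \<Longrightarrow> Q G \<eta> (G \<eta>)"
    have inc: "incr l (Seg l) (G \<eta>)" if "\<eta> < \<xi>" for \<eta> using IH[OF that] unfolding Q_def by blast
    have "\<exists>u. u \<in> P \<and> (\<forall>\<eta><\<xi>. \<forall>n\<in>b. tx (G \<eta>) i n \<le> u n \<and> G \<eta> i n \<le> u n)" if i: "i \<in> Seg l" for i
    proof -
      have "(\<lambda>n. max (tx (G \<eta>) i n) (G \<eta> i n)) \<in> P" if "\<eta> < \<xi>" for \<eta>
        using inc[OF that] i by (intro P_max tx(1)) (auto simp: incr_def)
      from P_ub_below[of \<xi> "\<lambda>\<eta> n. max (tx (G \<eta>) i n) (G \<eta> i n)", OF this]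
      obtain h where "h \<in> P" "\<And>\<eta> n. \<eta> < \<xi> \<Longrightarrow> n \<in> b \<Longrightarrow> max (tx (G \<eta>) i n) (G \<eta> i n) < h n" by blast
      then show ?thesis by (intro exI[of _ h]) (auto simp: less_imp_le)
    qed
    then obtain u where u: "\<And>i. i \<in> Seg l \<Longrightarrow> u i \<in> P"
      "\<And>i \<eta> n. i \<in> Seg l \<Longrightarrow> \<eta> < \<xi> \<Longrightarrow> n \<in> b \<Longrightarrow> tx (G \<eta>) i n \<le> u i n \<and> G \<eta> i n \<le> u i n"
      by metis
    have "\<exists>f. incr l (Seg l) f \<and> (\<forall>i\<in>Seg l. \<forall>n\<in>b. u i n \<le> f i n)"
    proof (rule increasing_exists)
      fix a h assume "a \<in> Seg l" "\<And>i. i \<in> Seg a \<Longrightarrow> h i \<in> P"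
      then show "\<exists>g\<in>P. \<forall>i\<in>Seg a. above (h i) g \<in> J l" using SegD by (intro bounding) auto
    qed (rule u(1))
    then obtain f where f: "incr l (Seg l) f" "\<And>i n. i \<in> Seg l \<Longrightarrow> n \<in> b \<Longrightarrow> u i n \<le> f i n" by blast
    then have "Q G \<xi> f" unfolding Q_def using u(2) order_trans by blast
    then show "\<exists>r. Q G \<xi> r" by blast
  qed
  then obtain G where "\<And>\<xi>. Q G \<xi> (G \<xi>)" by blast
  then have inc: "\<And>\<xi>. incr l (Seg l) (G \<xi>)"
    and Gt: "\<And>\<eta> \<xi> i n. \<eta> < \<xi> \<Longrightarrow> i \<in> Seg l \<Longrightarrow> n \<in> b \<Longrightarrow> tx (G \<eta>) i n \<le> G \<xi> i n"
    and Gm: "\<And>\<eta> \<xi> i n. \<eta> < \<xi> \<Longrightarrow> i \<in> Seg l \<Longrightarrow> n \<in> b \<Longrightarrow> G \<eta> i n \<le> G \<xi> i n"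
    unfolding Q_def by blast+
  obtain h where h: "h \<in> P" "\<And>\<xi> n. n \<in> b \<Longrightarrow> hx (G \<xi>) n < h n"
    using P_ub[of "\<lambda>\<xi>. hx (G \<xi>)"] hx(1) inc by blast
  have "\<exists>i. i \<in> Seg l \<and> above h (tx (G \<xi>) i) \<notin> Dx (G \<xi>)" for \<xi>
    using tx(2)[OF inc h(1)] by blast
  then obtain e where e: "\<And>\<xi>. e \<xi> \<in> Seg l" "\<And>\<xi>. above h (tx (G \<xi>) (e \<xi>)) \<notin> Dx (G \<xi>)" by metis
  obtain k where k: "k \<in> Seg l" "\<And>\<xi>. e \<xi> < k"
    using cofinality_omega1_bounded[OF D0, of e] e(1) l by blast
  \<comment> \<open>Modulo \<open>Dx (G \<eta>)\<close> one has \<open>h \<le> tx (G \<eta>) (e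
    \<eta>) \<le> G \<zeta> (e \<eta>) \<le> G \<zeta> k\<close>; the last inequality holds because
    an ultrafilter of cofinality \<open>l\<close> misses \<open>J l\<close>.\<close>
  have not_in: "above h (G \<zeta> k) \<notin> Dx (G \<eta>)" if "\<eta> < \<zeta>" for \<eta> \<zeta>
  proof
    assume *: "above h (G \<zeta> k) \<in> Dx (G \<eta>)"
    have "above h (G \<zeta> k) \<subseteq> above h (tx (G \<eta>) (e \<eta>)) \<union> above (G \<zeta> (e \<eta>)) (G \<zeta> k)"
    proof
      fix n assume n: "n \<in> above h (G \<zeta> k)"
      then have "tx (G \<eta>) (e \<eta>) n \<le> G \<zeta> (e \<eta>) n"
        using Gt[OF that e(1)[of \<eta>]] by (simp add: above_def)
      then show "n \<in> above h (tx (G \<eta>) (e \<eta>)) \<union> above (G \<zeta> (e \<eta>)) (G \<zeta> k)"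
        using n by (auto simp: above_def not_less)
    qed
    then have "above h (tx (G \<eta>) (e \<eta>)) \<union> above (G \<zeta> (e \<eta>)) (G \<zeta> k) \<in> Dx (G \<eta>)"
      by (rule ultra_mono[OF Dx(1)[OF inc] *])
    then have "above (G \<zeta> (e \<eta>)) (G \<zeta> k) \<in> Dx (G \<eta>)"
      using e(2) ultra_un[OF Dx(1)[OF inc]] by blast
    moreover have "above (G \<zeta> (e \<eta>)) (G \<zeta> k) \<in> J l"
      using inc e(1) k by (auto simp: incr_def)
    ultimately have "cofinality (Dx (G \<eta>)) < l" using J_disjoint Dx(1) inc by blast
    then show False using Dx(2)[OF inc] by simp
  qed
  \<comment> \<open>Comparing each stage with its immediate successor makes the coordinates lost at
    different stages distinct.\<close>
  define sc where "sc \<eta> = (LEAST y. \<eta> < y)" for \<eta> :: omega1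
  have sc: "\<eta> < sc \<eta>" "\<eta> < \<zeta> \<Longrightarrow> sc \<eta> \<le> \<zeta>" for \<eta> \<zeta>
    unfolding sc_def using LeastI_ex[OF omega1_gt_ex] by (auto intro: Least_le)
  have "\<exists>n. n \<in> above h (G \<eta> k) \<and> n \<notin> above h (G (sc \<eta>) k)" for \<eta>
  proof (rule ccontr)
    assume "\<not> ?thesis"
    moreover have "above (hx (G \<eta>)) (G \<eta> k) \<subseteq> above h (G \<eta> k)"
      using h(2) by (auto simp: above_def intro: less_trans)
    ultimately have "above (hx (G \<eta>)) (G \<eta> k) \<subseteq> above h (G (sc \<eta>) k)" by blast
    then have "above h (G (sc \<eta>) k) \<in> Dx (G \<eta>)"
      by (rule ultra_mono[OF Dx(1)[OF inc] hx(2)[OF inc k(1)]])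
    then show False using not_in[OF sc(1)] by blast
  qed
  then obtain N where N: "\<And>\<eta>. N \<eta> \<in> above h (G \<eta> k)" "\<And>\<eta>. N \<eta> \<notin> above h (G (sc \<eta>) k)" by metis
  have "N \<eta> \<noteq> N \<zeta>" if "\<eta> < \<zeta>" for \<eta> \<zeta>
  proof
    assume eq: "N \<eta> = N \<zeta>"
    have "N \<zeta> \<in> b" "G \<zeta> k (N \<zeta>) < h (N \<zeta>)" using N(1)[of \<zeta>] by (auto simp: above_def)
    moreover have "h (N \<zeta>) \<le> G (sc \<eta>) k (N \<zeta>)"
      using N(2)[of \<eta>] eq \<open>N \<zeta> \<in> b\<close> by (auto simp: above_def)
    moreover have "G (sc \<eta>) k (N \<zeta>) \<le> G \<zeta> k (N \<zeta>)"
      using Gm[OF _ k(1) \<open>N \<zeta> \<in> b\<close>, of "sc \<eta>" \<zeta>] sc(2)[OF that] by (cases "sc \<eta> = \<zeta>") auto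
    ultimately show False by simp
  qed
  moreover have "N \<eta> \<in> b" for \<eta> using N(1)[of \<eta>] above_sub by blast
  ultimately show False using omega1_not_inj_countable[OF countable_b, of N] by blast
qed

text \<open>If all exceptional sets were positive on \<open>c\<close>, an ultrafilter containing
  them and missing the ideal would have cofinality exactly \<open>top_cofinality c\<close>, against
  universality. On \<open>c\<close> one thus gets a genuine scale modulo the ideal.\<close>

lemma universal_cofinal:
  assumes c: "c \<subseteq> b" "c \<noteq> {}" and f: "universal (top_cofinality c) f" and h: "h \<in> P"
  shows "\<exists>i\<in>Seg (top_cofinality c). c \<inter> above h (f i) \<in> J (top_cofinality c)"
proof (rule ccontr)
  assume neg: "\<not> ?thesis"
  obtain D0 where D0: "ultra b D0" "cofinality D0 = top_cofinality c" using top_cofinality(1)[OF c] by blast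
  have inc: "incr (top_cofinality c) (Seg (top_cofinality c)) f" using f unfolding universal_def by blast
  have "\<exists>D. ultra b D \<and> (\<forall>i\<in>Seg (top_cofinality c). c \<inter> above h (f i) \<in> D) \<and> (\<forall>e\<in>J (top_cofinality c). e \<notin> D)"
  proof (rule ultra_exists_ideal)
    show "Seg (top_cofinality c) \<noteq> {}" using f D0 h unfolding universal_def by blast
    show "c \<inter> above h (f k) - c \<inter> above h (f i) \<in> J (top_cofinality c)"
      if "i \<in> Seg (top_cofinality c)" "k \<in> Seg (top_cofinality c)" "i \<le> k" for i k
      by (rule J_subset[OF incr_above[OF inc that]]) (auto simp: above_def)
    show "c \<inter> above h (f i) \<notin> J (top_cofinality c)" if "i \<in> Seg (top_cofinality c)" for i
      using neg that by blast
    show "c \<inter> above h (f i) \<subseteq> b" for i using c(1) by blast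
    show "B \<in> J (top_cofinality c)" if "A \<in> J (top_cofinality c)" "B \<subseteq> A" for A B using J_subset that .
  qed (rule J_Union)
  then obtain D where D: "ultra b D" "\<And>i. i \<in> Seg (top_cofinality c) \<Longrightarrow> c \<inter> above h (f i) \<in> D"
    "\<And>e. e \<in> J (top_cofinality c) \<Longrightarrow> e \<notin> D" by blast
  have "Seg (top_cofinality c) \<noteq> {}" using f D0 h unfolding universal_def by blast
  then obtain i where "c \<inter> above h (f i) \<in> D" using D(2) by blast
  then have "c \<in> D" by (rule ultra_mono[OF D(1)]) blast
  then have "cofinality D \<le> top_cofinality c" using top_cofinality(2)[OF c] D(1) by blast
  moreover have "top_cofinality c \<le> cofinality D" using disjoint_J_imp_le D by blast
  ultimately have "cofinality D = top_cofinality c" by simp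
  then obtain i where i: "i \<in> Seg (top_cofinality c)" "above h (f i) \<notin> D"
    using f D(1) h unfolding universal_def by blast
  have "above h (f i) \<in> D" by (rule ultra_mono[OF D(1) D(2)[OF i(1)]]) blast
  then show False using i(2) by blast
qed

section \<open>Suprema of chains lie in a small family\<close>

definition scale :: "'i \<Rightarrow> 'i \<Rightarrow> 'k \<Rightarrow> 'k" where
  "scale l = (SOME f. universal l f)"

definition scale_index :: "(omega1 \<Rightarrow> 'k \<Rightarrow> 'k) \<Rightarrow> 'k set \<Rightarrow> omega1 \<Rightarrow> 'i" where
  "scale_index x c j = (LEAST i. i \<in> Seg (top_cofinality c) \<and> c \<inter> above (x j) (scale (top_cofinality c) i) \<in> J (top_cofinality c))"

definition index_sup :: "(omega1 \<Rightarrow> 'k \<Rightarrow> 'k) \<Rightarrow> 'k set \<Rightarrow> omega1 \<Rightarrow> 'i" where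
  "index_sup x c \<xi> = (LEAST i. i \<in> I \<and> (\<forall>\<eta><\<xi>. scale_index x c \<eta> < i))"

definition index_limit :: "(omega1 \<Rightarrow> 'k \<Rightarrow> 'k) \<Rightarrow> 'k set \<Rightarrow> 'i" where
  "index_limit x c = (LEAST i. i \<in> I \<and> (\<forall>\<eta>. scale_index x c \<eta> < i))"

text \<open>The part of \<open>c\<close> where stage \<open>i\<close> still exceeds the scale taken
  at the supremum of the first \<open>\<xi>\<close> indices. For \<open>i < \<xi>\<close> it belongs
  to the ideal, so its maximal cofinality is smaller than that of \<open>c\<close>.\<close>

definition residue :: "(omega1 \<Rightarrow> 'k \<Rightarrow> 'k) \<Rightarrow> 'k set \<Rightarrow> omega1 \<Rightarrow> omega1 \<Rightarrow> 'k set" where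
  "residue x c i \<xi> = c \<inter> above (x i) (scale (top_cofinality c) (index_sup x c \<xi>))"

text \<open>
  The countably many subsets of \<open>b\<close> on which the approximation of \<open>x\<close> by scales has to be repeated up to
  stage \<open>j\<close>, and the scale functions that later members of \<open>x\<close> are required to exceed. Both depend only
  on \<open>x\<close> up to \<open>j\<close>.
\<close>

inductive_set accessible :: "(omega1 \<Rightarrow> 'k \<Rightarrow> 'k) \<Rightarrow> omega1 \<Rightarrow> 'k set set" for x j where
  base: "b \<in> accessible x j"
| step: "c \<in> accessible x j \<Longrightarrow> i \<le> j \<Longrightarrow> \<xi> \<le> j \<Longrightarrow> residue x c i \<xi> \<in> accessible x j"

definition demands :: "(omega1 \<Rightarrow> 'k \<Rightarrow> 'k) \<Rightarrow> omega1 \<Rightarrow> ('k \<Rightarrow> 'k) set" where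
  "demands x j = (\<Union>c\<in>accessible x j. \<Union>\<xi>\<in>{..j}. {scale (top_cofinality c) (scale_index x c \<xi>), scale (top_cofinality c) (index_sup x c \<xi>)}) \<inter> P"

text \<open>Chosen from \<open>g\<close> without reference to any chain, so that all limit functions
  can be listed in advance.\<close>

definition seg_cofmap :: "'i \<Rightarrow> omega1 \<Rightarrow> 'i" where
  "seg_cofmap g = (SOME e. (\<forall>\<xi>. e \<xi> \<in> Seg g) \<and> (\<forall>i\<in>Seg g. \<exists>\<xi>. i \<le> e \<xi>))"

definition seg_cofmap_sup :: "'i \<Rightarrow> omega1 \<Rightarrow> 'i" where
  "seg_cofmap_sup g \<xi> = (LEAST i. i \<in> I \<and> (\<forall>\<eta><\<xi>. seg_cofmap g \<eta> < i))"

text \<open>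
  The least value reached on a closed unbounded set of indices. It depends on \<open>l\<close> and \<open>g\<close> only: a chain
  with index limit \<open>g\<close> approaches \<open>g\<close> along \<open>index_sup\<close>, which agrees on a club with the canonical
  \<open>seg_cofmap_sup\<close>.
\<close>

definition limit_fun :: "'i \<Rightarrow> 'i \<Rightarrow> 'k \<Rightarrow> 'k" where
  "limit_fun l g n = (LEAST y. y \<in> K \<and> (\<exists>p. \<forall>\<xi>. closed_under p \<xi> \<longrightarrow> scale l (seg_cofmap_sup g \<xi>) n \<le> y))"

lemma scale_universal:
  assumes "c \<subseteq> b" and "c \<noteq> {}"
  shows "universal (top_cofinality c) (scale (top_cofinality c))"
proof -
  obtain D where "ultra b D" "cofinality D = top_cofinality c" using top_cofinality(1)[OF assms] by blast
  then have "\<exists>f. universal (top_cofinality c) f" using universal_exists by metis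
  then show ?thesis unfolding scale_def by (rule someI_ex)
qed

section \<open>Countability and locality of the demands\<close>

lemma accessible_sub: "c \<in> accessible x j \<Longrightarrow> c \<subseteq> b"
  by (induction rule: accessible.induct) (auto simp: residue_def)

lemma accessible_mono: "c \<in> accessible x j \<Longrightarrow> j \<le> j' \<Longrightarrow> c \<in> accessible x j'"
  by (induction rule: accessible.induct) (auto intro: accessible.intros)

lemma countable_accessible: "countable (accessible x j)"
proof -
  \<comment> \<open>An accessible set is coded by the finite list of residue steps that leads to
    it.\<close>
  have "c \<in> (\<lambda>ps. foldr (\<lambda>(i, \<xi>) c. residue x c i \<xi>) ps b) ` lists ({..j} \<times> {..j})" if "c \<in> accessible x j" for c
    using that
  proof (induction rule: accessible.induct)
    case base
    show ?case by (rule image_eqI[of _ _ "[]"]) auto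
  next
    case (step c i \<xi>)
    then obtain ps where "c = foldr (\<lambda>(i, \<xi>) c. residue x c i \<xi>) ps b" "ps \<in> lists ({..j} \<times> {..j})" by blast
    then show ?case using step by (intro image_eqI[of _ _ "(i, \<xi>) # ps"]) auto
  qed
  moreover have "countable (lists ({..j} \<times> {..j}))"
    using countable_omega1_atMost by (intro countable_lists countable_SIGMA)
  ultimately show ?thesis by (meson countable_image countable_subset subsetI)
qed

lemma countable_demands: "countable (demands x j)"
  unfolding demands_def
  by (intro countable_Int1 countable_UN countable_accessible countable_omega1_atMost) simp

lemma demands_sub: "demands x j \<subseteq> P"
  by (simp add: demands_def)

lemma scale_index_cong: "x \<xi> = x' \<xi> \<Longrightarrow> scale_index x c \<xi> = scale_index x' c \<xi>"
  by (simp add: scale_index_def)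

lemma index_sup_cong: "(\<And>\<eta>. \<eta> < \<xi> \<Longrightarrow> x \<eta> = x' \<eta>) \<Longrightarrow> index_sup x c \<xi> = index_sup x' c \<xi>"
  unfolding index_sup_def using scale_index_cong[of x _ x' c] by (metis (no_types, lifting))

lemma accessible_cong_sub:
  assumes "\<And>i. i \<le> j \<Longrightarrow> x i = x' i"
  shows "accessible x j \<subseteq> accessible x' j"
proof
  fix c assume "c \<in> accessible x j"
  then show "c \<in> accessible x' j"
  proof (induction rule: accessible.induct)
    case (step c i \<xi>)
    have "index_sup x c \<xi> = index_sup x' c \<xi>" using assms step.hyps(3) by (intro index_sup_cong) simp
    then have "residue x c i \<xi> = residue x' c i \<xi>" using assms step.hyps(2) unfolding residue_def by simp
    then show ?case using step by (simp add: accessible.step)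
  qed (rule accessible.base)
qed

text \<open>The chain is built by recursion on its stages while meeting these demands, so the
  demands at \<open>j\<close> may depend only on the stages up to \<open>j\<close>.\<close>

lemma demands_cong:
  assumes "\<And>i. i \<le> j \<Longrightarrow> x i = x' i"
  shows "demands x j = demands x' j"
proof -
  have "accessible x j = accessible x' j"
    using accessible_cong_sub[of j x x'] accessible_cong_sub[of j x' x] assms by force
  moreover have "scale_index x c \<xi> = scale_index x' c \<xi>" if "\<xi> \<le> j" for c \<xi>
    using assms that by (intro scale_index_cong) simp
  moreover have "index_sup x c \<xi> = index_sup x' c \<xi>" if "\<xi> \<le> j" for c \<xi>
    using assms that by (intro index_sup_cong) simp
  ultimately show ?thesis unfolding demands_def by simp
qed

section \<open>Approximation of the supremum of one chain by scales\<close>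

context
  fixes x :: "omega1 \<Rightarrow> 'k \<Rightarrow> 'k" and X :: "'k \<Rightarrow> 'k"
  assumes x_P: "\<And>j. x j \<in> P"
    and x_mono: "\<And>i j n. i \<le> j \<Longrightarrow> n \<in> b \<Longrightarrow> x i n \<le> x j n"
    and x_demands: "\<And>j h. h \<in> demands x j \<Longrightarrow> \<exists>j'. \<forall>n\<in>b. h n < x j' n"
    and X_in: "\<And>n. n \<in> b \<Longrightarrow> X n \<in> K"
    and X_ub: "\<And>n j. n \<in> b \<Longrightarrow> x j n \<le> X n"
    and X_lub: "\<And>n y. n \<in> b \<Longrightarrow> y \<in> K \<Longrightarrow> y < X n \<Longrightarrow> \<exists>j. y < x j n"
begin

context
  fixes c j0
  assumes c_accessible: "c \<in> accessible x j0" and c_ne: "c \<noteq> {}"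
begin

lemma c_sub: "c \<subseteq> b"
  using c_accessible accessible_sub by blast

lemma scale_P: "i \<in> Seg (top_cofinality c) \<Longrightarrow> scale (top_cofinality c) i \<in> P"
  using scale_universal[OF c_sub c_ne] unfolding universal_def incr_def by blast

lemma scale_above: "k \<in> Seg (top_cofinality c) \<Longrightarrow> i \<in> Seg (top_cofinality c) \<Longrightarrow> k \<le> i \<Longrightarrow> above (scale (top_cofinality c) k) (scale (top_cofinality c) i) \<in> J (top_cofinality c)"
  using scale_universal[OF c_sub c_ne] unfolding universal_def by (blast intro: incr_above)

lemma scale_index: "scale_index x c j \<in> Seg (top_cofinality c)" "c \<inter> above (x j) (scale (top_cofinality c) (scale_index x c j)) \<in> J (top_cofinality c)"
  using LeastI_ex[of "\<lambda>i. i \<in> Seg (top_cofinality c) \<and> c \<inter> above (x j) (scale (top_cofinality c) i) \<in> J (top_cofinality c)"]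
    universal_cofinal[OF c_sub c_ne scale_universal[OF c_sub c_ne] x_P[of j]]
  unfolding scale_index_def by blast+

lemma demand_scale_index: "\<exists>j'. \<forall>n\<in>b. scale (top_cofinality c) (scale_index x c j) n < x j' n"
proof (rule x_demands[of _ "max j j0"])
  have "c \<in> accessible x (max j j0)" using c_accessible by (rule accessible_mono) simp
  then show "scale (top_cofinality c) (scale_index x c j) \<in> demands x (max j j0)"
    unfolding demands_def using scale_P[OF scale_index(1)] by (intro IntI UN_I[of c] UN_I[of j]) auto
qed

text \<open>Some later stage exceeds everywhere the scale function that catches stage
  \<open>j\<close>. Were its own index no larger, the opposite inequality modulo the ideal would put
  all of \<open>c\<close> into the ideal.\<close>

lemma scale_index_unbounded: "\<exists>j'. scale_index x c j < scale_index x c j'"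
proof -
  obtain j' where j': "\<And>n. n \<in> b \<Longrightarrow> scale (top_cofinality c) (scale_index x c j) n < x j' n" using demand_scale_index by blast
  have "scale_index x c j < scale_index x c j'"
  proof (rule ccontr)
    assume "\<not> ?thesis"
    then have "above (scale (top_cofinality c) (scale_index x c j')) (scale (top_cofinality c) (scale_index x c j)) \<in> J (top_cofinality c)"
      using scale_index(1) by (intro scale_above) auto
    with scale_index(2)[of j'] have "c \<inter> above (x j') (scale (top_cofinality c) (scale_index x c j')) \<union>
        above (scale (top_cofinality c) (scale_index x c j')) (scale (top_cofinality c) (scale_index x c j)) \<in> J (top_cofinality c)" by (rule J_un)
    moreover have "c \<subseteq> c \<inter> above (x j') (scale (top_cofinality c) (scale_index x c j')) \<union>
        above (scale (top_cofinality c) (scale_index x c j')) (scale (top_cofinality c) (scale_index x c j))"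
    proof
      fix n assume "n \<in> c"
      then have "n \<in> b" using c_sub by blast
      then show "n \<in> c \<inter> above (x j') (scale (top_cofinality c) (scale_index x c j')) \<union>
        above (scale (top_cofinality c) (scale_index x c j')) (scale (top_cofinality c) (scale_index x c j))"
        using j'[of n] \<open>n \<in> c\<close> by (auto simp: above_def not_less)
    qed
    ultimately have "c \<in> J (top_cofinality c)" by (rule J_subset)
    then show False using not_J_top_cofinality[OF c_sub c_ne] by blast
  qed
  then show ?thesis by blast
qed

lemma scale_index_bounded: "\<exists>i\<in>Seg (top_cofinality c). \<forall>\<eta>. scale_index x c \<eta> < i"
proof -
  obtain D where D: "ultra b D" "cofinality D = top_cofinality c" using top_cofinality(1)[OF c_sub c_ne] by blast
  show ?thesis using cofinality_omega1_bounded[OF D(1), of "scale_index x c"] scale_index(1) unfolding D(2) by blast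
qed

lemma index_limit: "index_limit x c \<in> I" "scale_index x c \<eta> < index_limit x c"
  and index_limit_least: "i \<in> Seg (index_limit x c) \<Longrightarrow> \<exists>\<eta>. i \<le> scale_index x c \<eta>"
proof -
  have "\<exists>i. i \<in> I \<and> (\<forall>\<eta>. scale_index x c \<eta> < i)" using scale_index_bounded by (auto simp: Seg_def)
  from LeastI_ex[OF this] show "index_limit x c \<in> I" "scale_index x c \<eta> < index_limit x c" unfolding index_limit_def by auto
  show "\<exists>\<eta>. i \<le> scale_index x c \<eta>" if "i \<in> Seg (index_limit x c)"
    using that not_less_Least[of i "\<lambda>i. i \<in> I \<and> (\<forall>\<eta>. scale_index x c \<eta> < i)"]
    unfolding index_limit_def Seg_def by (auto simp: not_less)
qed

lemma index_sup: "index_sup x c \<xi> \<in> Seg (top_cofinality c)" "\<eta> < \<xi> \<Longrightarrow> scale_index x c \<eta> < index_sup x c \<xi>"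
proof -
  obtain i where i: "i \<in> I" "i < top_cofinality c" "\<And>\<eta>. scale_index x c \<eta> < i" using scale_index_bounded by (auto simp: Seg_def)
  have "index_sup x c \<xi> \<in> I \<and> (\<forall>\<eta><\<xi>. scale_index x c \<eta> < index_sup x c \<xi>)"
    unfolding index_sup_def by (rule LeastI[of _ i]) (use i in blast)
  moreover have "index_sup x c \<xi> \<le> i" unfolding index_sup_def by (rule Least_le) (use i in blast)
  ultimately show "index_sup x c \<xi> \<in> Seg (top_cofinality c)" "\<eta> < \<xi> \<Longrightarrow> scale_index x c \<eta> < index_sup x c \<xi>"
    using i(2) by (auto simp: Seg_def)
qed

lemma demand_index_sup: "\<exists>j'. \<forall>n\<in>b. scale (top_cofinality c) (index_sup x c \<xi>) n < x j' n"
proof (rule x_demands[of _ "max \<xi> j0"])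
  have "c \<in> accessible x (max \<xi> j0)" using c_accessible by (rule accessible_mono) simp
  then show "scale (top_cofinality c) (index_sup x c \<xi>) \<in> demands x (max \<xi> j0)"
    unfolding demands_def using scale_P[OF index_sup(1)] by (intro IntI UN_I[of c] UN_I[of \<xi>]) auto
qed

lemma scale_index_Seg_index_limit: "scale_index x c \<xi> \<in> Seg (index_limit x c)"
  using index_limit(2) SegD[OF scale_index(1)] by (auto simp: Seg_def)

lemma seg_cofmap: "seg_cofmap (index_limit x c) \<xi> \<in> Seg (index_limit x c)" "i \<in> Seg (index_limit x c) \<Longrightarrow> \<exists>\<xi>. i \<le> seg_cofmap (index_limit x c) \<xi>"
proof -
  \<comment> \<open>The indices of the chain themselves show that a cofinal
    \<open>omega1\<close>-sequence exists, so the choice is proper.\<close>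
  have "(\<forall>\<xi>. seg_cofmap (index_limit x c) \<xi> \<in> Seg (index_limit x c)) \<and> (\<forall>i\<in>Seg (index_limit x c). \<exists>\<xi>. i \<le> seg_cofmap (index_limit x c) \<xi>)"
    unfolding seg_cofmap_def by (rule someI[of _ "scale_index x c"]) (use scale_index_Seg_index_limit index_limit_least in blast)
  then show "seg_cofmap (index_limit x c) \<xi> \<in> Seg (index_limit x c)" "i \<in> Seg (index_limit x c) \<Longrightarrow> \<exists>\<xi>. i \<le> seg_cofmap (index_limit x c) \<xi>" by auto
qed

text \<open>Two sequences cofinal in the same limit interleave; at stages closed under both
  interleaving maps their partial suprema coincide.\<close>

lemma seg_cofmap_sup_eq: "\<exists>p. \<forall>\<xi>. closed_under p \<xi> \<longrightarrow> seg_cofmap_sup (index_limit x c) \<xi> = index_sup x c \<xi>"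
proof -
  have "\<exists>\<zeta>. seg_cofmap (index_limit x c) \<eta> < scale_index x c \<zeta>" for \<eta>
    using index_limit_least[OF seg_cofmap(1)] scale_index_unbounded by (meson le_less_trans)
  then obtain p where p: "\<And>\<eta>. seg_cofmap (index_limit x c) \<eta> < scale_index x c (p \<eta>)" by metis
  have "\<exists>\<zeta>. scale_index x c \<eta> < seg_cofmap (index_limit x c) \<zeta>" for \<eta>
    using seg_cofmap(2)[OF scale_index_Seg_index_limit] scale_index_unbounded by (meson less_le_trans)
  then obtain q where q: "\<And>\<eta>. scale_index x c \<eta> < seg_cofmap (index_limit x c) (q \<eta>)" by metis
  have "seg_cofmap_sup (index_limit x c) \<xi> = index_sup x c \<xi>" if "closed_under (\<lambda>\<eta>. max (p \<eta>) (q \<eta>)) \<xi>" for \<xi>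
  proof -
    have lt: "p \<eta> < \<xi>" "q \<eta> < \<xi>" if "\<eta> < \<xi>" for \<eta>
      using \<open>closed_under (\<lambda>\<eta>. max (p \<eta>) (q \<eta>)) \<xi>\<close> that unfolding closed_under_def by auto
    have "(\<forall>\<eta><\<xi>. seg_cofmap (index_limit x c) \<eta> < i) \<longleftrightarrow> (\<forall>\<eta><\<xi>. scale_index x c \<eta> < i)" for i
      using lt p q less_trans by meson
    then show ?thesis unfolding seg_cofmap_sup_def index_sup_def by simp
  qed
  then show ?thesis by blast
qed

text \<open>By the demands, the scale at \<open>index_sup\<close> lies below some stage of the
  chain, so \<open>X n\<close> is a candidate in the minimum that defines the limit
  function.\<close>

lemma limit_fun:
  assumes n: "n \<in> b"
  shows limit_fun_le_X: "limit_fun (top_cofinality c) (index_limit x c) n \<le> X n"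
    and limit_fun_in: "limit_fun (top_cofinality c) (index_limit x c) n \<in> K"
    and limit_fun_attained: "\<exists>p. \<forall>\<xi>. closed_under p \<xi> \<longrightarrow>
      scale (top_cofinality c) (seg_cofmap_sup (index_limit x c) \<xi>) n \<le> limit_fun (top_cofinality c) (index_limit x c) n"
proof -
  let ?Q = "\<lambda>y. y \<in> K \<and> (\<exists>p. \<forall>\<xi>. closed_under p \<xi> \<longrightarrow>
    scale (top_cofinality c) (seg_cofmap_sup (index_limit x c) \<xi>) n \<le> y)"
  obtain p where p: "\<And>\<xi>. closed_under p \<xi> \<Longrightarrow> seg_cofmap_sup (index_limit x c) \<xi> = index_sup x c \<xi>"
    using seg_cofmap_sup_eq by blast
  have "scale (top_cofinality c) (seg_cofmap_sup (index_limit x c) \<xi>) n \<le> X n" if "closed_under p \<xi>" for \<xi>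
  proof -
    obtain j where "scale (top_cofinality c) (index_sup x c \<xi>) n < x j n" using demand_index_sup n by blast
    then show ?thesis using p[OF that] X_ub[OF n, of j] by simp
  qed
  then have Q: "?Q (X n)" using X_in[OF n] by blast
  show "limit_fun (top_cofinality c) (index_limit x c) n \<le> X n"
    unfolding limit_fun_def by (rule Least_le) (rule Q)
  from LeastI[of ?Q, OF Q] show "limit_fun (top_cofinality c) (index_limit x c) n \<in> K"
    "\<exists>p. \<forall>\<xi>. closed_under p \<xi> \<longrightarrow>
      scale (top_cofinality c) (seg_cofmap_sup (index_limit x c) \<xi>) n \<le> limit_fun (top_cofinality c) (index_limit x c) n"
    unfolding limit_fun_def by auto
qed

text \<open>As \<open>b\<close> is countable, one stage \<open>i\<close> exceeds the limit function
  at all coordinates where it is too small, and some \<open>\<xi> > i\<close> lies in the clubs of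
  all coordinates. These coordinates then fall into the residue, which is in the ideal because the
  index of stage \<open>i\<close> is at most \<open>index_sup\<close> at
  \<open>\<xi>\<close>.\<close>

lemma bad_subset_residue:
  "\<exists>i \<xi>. residue x c i \<xi> \<in> J (top_cofinality c) \<and> (\<forall>n\<in>c. limit_fun (top_cofinality c) (index_limit x c) n < X n \<longrightarrow> n \<in> residue x c i \<xi>)"
proof -
  let ?g = "limit_fun (top_cofinality c) (index_limit x c)"
  have "\<forall>n\<in>b. \<exists>p. \<forall>\<xi>. closed_under p \<xi> \<longrightarrow> scale (top_cofinality c) (seg_cofmap_sup (index_limit x c) \<xi>) n \<le> ?g n"
    using limit_fun_attained by simp
  from bchoice[OF this] obtain p
    where p: "\<And>n \<xi>. n \<in> b \<Longrightarrow> closed_under (p n) \<xi> \<Longrightarrow> scale (top_cofinality c) (seg_cofmap_sup (index_limit x c) \<xi>) n \<le> ?g n" by blast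
  obtain q where q: "\<And>\<xi> n. closed_under q \<xi> \<Longrightarrow> n \<in> b \<Longrightarrow> closed_under (p n) \<xi>"
    using closed_under_countable[OF countable_b, of p] by blast
  obtain r where r: "\<And>\<xi>. closed_under r \<xi> \<Longrightarrow> seg_cofmap_sup (index_limit x c) \<xi> = index_sup x c \<xi>" using seg_cofmap_sup_eq by blast
  have "\<forall>n\<in>b. \<exists>j. ?g n < X n \<longrightarrow> ?g n < x j n" using X_lub limit_fun_in by blast
  from bchoice[OF this] obtain jj where jj: "\<And>n. n \<in> b \<Longrightarrow> ?g n < X n \<Longrightarrow> ?g n < x (jj n) n" by blast
  obtain i where i: "\<And>n. n \<in> b \<Longrightarrow> jj n < i"
    using countable_omega1_bounded[of "jj ` b"] countable_b by auto
  obtain \<xi> where \<xi>: "i < \<xi>" "closed_under (\<lambda>\<eta>. max (q \<eta>) (r \<eta>)) \<xi>"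
    using closed_under_ex by blast
  then have cl: "closed_under q \<xi>" "closed_under r \<xi>" unfolding closed_under_def by auto
  have "residue x c i \<xi> \<in> J (top_cofinality c)"
  proof (rule J_subset[OF J_un[OF scale_index(2)[of i] scale_above[OF scale_index(1)[of i] index_sup(1)[of \<xi>]]]])
    show "scale_index x c i \<le> index_sup x c \<xi>" using index_sup(2)[OF \<xi>(1)] by simp
    show "residue x c i \<xi> \<subseteq> c \<inter> above (x i) (scale (top_cofinality c) (scale_index x c i)) \<union>
        above (scale (top_cofinality c) (scale_index x c i)) (scale (top_cofinality c) (index_sup x c \<xi>))"
      unfolding residue_def using above_trans by blast
  qed
  moreover have "n \<in> residue x c i \<xi>" if n: "n \<in> c" "?g n < X n" for n
  proof -
    have nb: "n \<in> b" using n(1) c_sub by blast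
    have "scale (top_cofinality c) (index_sup x c \<xi>) n \<le> ?g n" using p[OF nb q[OF cl(1) nb]] r[OF cl(2)] by simp
    also have "\<dots> < x (jj n) n" by (rule jj[OF nb n(2)])
    also have "\<dots> \<le> x i n" using i[OF nb] by (intro x_mono nb) simp
    finally show ?thesis using n(1) nb unfolding residue_def above_def by blast
  qed
  ultimately show ?thesis by blast
qed

end

text \<open>One limit function is right on \<open>c\<close> outside a residue, where the maximal
  cofinality has dropped, and well-founded induction handles the residue. Every limit function used
  stays below \<open>X\<close> on all of \<open>b\<close>, so combining them never
  overshoots.\<close>

lemma X_finite_max_accessible:
  assumes "c \<in> accessible x j0"
  shows "\<exists>\<Phi>. finite \<Phi> \<and> \<Phi> \<subseteq> I \<times> I \<and> (\<forall>n\<in>b. \<forall>(l, g)\<in>\<Phi>. limit_fun l g n \<le> X n) \<and>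
    (\<forall>n\<in>c. \<exists>(l, g)\<in>\<Phi>. limit_fun l g n = X n)"
  using assms
proof (induction "top_cofinality c" arbitrary: c j0 rule: less_induct)
  case less
  show ?case
  proof (cases "c = {}")
    case True
    then show ?thesis by (intro exI[of _ "{}"]) simp
  next
    case False
    obtain i \<xi> where J: "residue x c i \<xi> \<in> J (top_cofinality c)"
      and bad: "\<And>n. n \<in> c \<Longrightarrow> limit_fun (top_cofinality c) (index_limit x c) n < X n \<Longrightarrow> n \<in> residue x c i \<xi>"
      using bad_subset_residue[OF less.prems False] by blast
    have "\<exists>\<Phi>. finite \<Phi> \<and> \<Phi> \<subseteq> I \<times> I \<and> (\<forall>n\<in>b. \<forall>(l, g)\<in>\<Phi>. limit_fun l g n \<le> X n) \<and>
      (\<forall>n\<in>residue x c i \<xi>. \<exists>(l, g)\<in>\<Phi>. limit_fun l g n = X n)"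
    proof (cases "residue x c i \<xi> = {}")
      case True
      then show ?thesis by (intro exI[of _ "{}"]) simp
    next
      case False
      have "c \<in> accessible x (max j0 (max i \<xi>))" using less.prems by (rule accessible_mono) simp
      then have "residue x c i \<xi> \<in> accessible x (max j0 (max i \<xi>))" by (rule accessible.step) (simp_all add: le_max_iff_disj)
      then show ?thesis by (rule less.hyps[OF top_cofinality_less[OF J False]])
    qed
    then obtain \<Phi> where \<Phi>: "finite \<Phi>" "\<Phi> \<subseteq> I \<times> I" "\<forall>n\<in>b. \<forall>(l, g)\<in>\<Phi>. limit_fun l g n \<le> X n"
      "\<forall>n\<in>residue x c i \<xi>. \<exists>(l, g)\<in>\<Phi>. limit_fun l g n = X n" by blast
    have le: "limit_fun (top_cofinality c) (index_limit x c) n \<le> X n" if "n \<in> b" for n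
      by (rule limit_fun_le_X[OF less.prems False that])
    have "\<exists>(l, g)\<in>insert (top_cofinality c, index_limit x c) \<Phi>. limit_fun l g n = X n" if "n \<in> c" for n
    proof (cases "limit_fun (top_cofinality c) (index_limit x c) n = X n")
      case False
      moreover have "n \<in> b" using that accessible_sub[OF less.prems] by blast
      ultimately have "n \<in> residue x c i \<xi>" using bad[OF that] le[of n] by simp
      then show ?thesis using \<Phi>(4) by blast
    qed blast
    moreover have "top_cofinality c \<in> I" "index_limit x c \<in> I"
      using top_cofinality_in[OF accessible_sub[OF less.prems] False] index_limit(1)[OF less.prems False] by auto
    ultimately show ?thesis using \<Phi>(1-3) le
      by (intro exI[of _ "insert (top_cofinality c, index_limit x c) \<Phi>"]) auto
  qed
qed

lemma X_finite_max:
  "\<exists>\<Phi>. finite \<Phi> \<and> \<Phi> \<subseteq> I \<times> I \<and> (\<forall>n\<in>b. X n = Max ((\<lambda>(l, g). limit_fun l g n) ` \<Phi>))"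
proof -
  obtain \<Phi> where \<Phi>: "finite \<Phi>" "\<Phi> \<subseteq> I \<times> I" "\<forall>n\<in>b. \<forall>(l, g)\<in>\<Phi>. limit_fun l g n \<le> X n"
    "\<forall>n\<in>b. \<exists>(l, g)\<in>\<Phi>. limit_fun l g n = X n"
    using X_finite_max_accessible[OF accessible.base] by blast
  have "X n = Max ((\<lambda>(l, g). limit_fun l g n) ` \<Phi>)" if "n \<in> b" for n
  proof (rule Max_eqI[symmetric])
    show "X n \<in> (\<lambda>(l, g). limit_fun l g n) ` \<Phi>" using \<Phi>(4) that by force
    show "y \<le> X n" if "y \<in> (\<lambda>(l, g). limit_fun l g n) ` \<Phi>" for y using \<Phi>(3) \<open>n \<in> b\<close> that by auto
  qed (use \<Phi>(1) in simp)
  then show ?thesis using \<Phi>(1,2) by blast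
qed

end

end

section \<open>A small stationary family of countable sets\<close>

lemma countable_closed_superset:
  fixes f :: "nat \<Rightarrow> 'a \<Rightarrow> 'a"
  assumes "countable A" and "A \<subseteq> K" and f: "\<And>n x. x \<in> K \<Longrightarrow> f n x \<in> K"
  shows "\<exists>B. countable B \<and> A \<subseteq> B \<and> B \<subseteq> K \<and> (\<forall>n. \<forall>x\<in>B. f n x \<in> B)"
proof -
  define g where "g X = X \<union> (\<Union>n. f n ` X)" for X
  define h where "h k = (g ^^ k) A" for k
  have h: "countable (h k) \<and> h k \<subseteq> K" for k
    by (induction k) (use assms in \<open>auto simp: h_def g_def\<close>)
  have "f n x \<in> h (Suc k)" if "x \<in> h k" for n x k
    using that by (auto simp: h_def g_def)
  then have "\<forall>n. \<forall>x\<in>(\<Union>k. h k). f n x \<in> (\<Union>k. h k)" by blast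
  moreover have "A \<subseteq> (\<Union>k. h k)" using UN_upper[of 0 UNIV h] by (simp add: h_def)
  moreover have "countable (\<Union>k. h k)" "(\<Union>k. h k) \<subseteq> K" using h by auto
  ultimately show ?thesis by blast
qed

lemma wide_countable_bound:
  assumes "wide K \<beta>" and "countable A"
  shows "\<exists>y. y \<in> K \<and> y < \<beta> \<and> (\<forall>a\<in>A. a \<in> K \<longrightarrow> a < \<beta> \<longrightarrow> a < y)"
proof (cases "{a\<in>A. a \<in> K \<and> a < \<beta>} = {}")
  case True
  then show ?thesis using assms(1) unfolding wide_def by blast
next
  case False
  moreover have "countable {a\<in>A. a \<in> K \<and> a < \<beta>}"
    by (rule countable_subset[OF _ assms(2)]) blast
  ultimately obtain g :: "omega1 \<Rightarrow> _" where g: "range g = {a\<in>A. a \<in> K \<and> a < \<beta>}"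
    using omega1_onto_countable by metis
  then have "\<forall>\<xi>. g \<xi> \<in> K \<and> g \<xi> < \<beta>" by blast
  moreover have "(\<forall>\<xi>. g \<xi> \<in> K \<and> g \<xi> < \<beta>) \<longrightarrow> (\<exists>y\<in>K. y < \<beta> \<and> (\<forall>\<xi>. g \<xi> < y))"
    using assms(1) unfolding wide_def by (elim conjE allE[of _ g])
  ultimately obtain y where "y \<in> K" "y < \<beta>" "\<And>\<xi>. g \<xi> < y" by blast
  moreover have "a < y" if "a \<in> A" "a \<in> K" "a < \<beta>" for a
  proof -
    have "a \<in> range g" using that g by blast
    then show ?thesis using calculation(3) by blast
  qed
  ultimately show ?thesis by blast
qed

definition strict_sup :: "'k::wellorder set \<Rightarrow> 'k set \<Rightarrow> 'k \<Rightarrow> 'k" where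
  "strict_sup K A \<beta> = (LEAST y. y \<in> K \<and> (\<forall>m\<in>A. m < \<beta> \<longrightarrow> m < y))"

lemma strict_sup:
  assumes "y \<in> K" and "\<And>m. m \<in> A \<Longrightarrow> m < \<beta> \<Longrightarrow> m < y"
  shows "strict_sup K A \<beta> \<in> K" "strict_sup K A \<beta> \<le> y" "m \<in> A \<Longrightarrow> m < \<beta> \<Longrightarrow> m < strict_sup K A \<beta>"
proof -
  have *: "y \<in> K \<and> (\<forall>m\<in>A. m < \<beta> \<longrightarrow> m < y)" using assms by blast
  show "strict_sup K A \<beta> \<in> K" "m \<in> A \<Longrightarrow> m < \<beta> \<Longrightarrow> m < strict_sup K A \<beta>"
    using LeastI[of "\<lambda>y. y \<in> K \<and> (\<forall>m\<in>A. m < \<beta> \<longrightarrow> m < y)", OF *] unfolding strict_sup_def by blast+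
  show "strict_sup K A \<beta> \<le> y"
    unfolding strict_sup_def by (rule Least_le) (rule *)
qed

lemma less_strict_supD:
  assumes "z < strict_sup K A \<beta>" and "z \<in> K"
  shows "\<exists>m\<in>A. m < \<beta> \<and> z \<le> m"
  using not_less_Least[OF assms(1)[unfolded strict_sup_def]] assms(2) by (auto simp: not_less)

lemma strict_sup_countable:
  assumes "wide K \<beta>" and "countable A" and "A \<subseteq> K"
  shows "strict_sup K A \<beta> \<in> K" "strict_sup K A \<beta> < \<beta>" "m \<in> A \<Longrightarrow> m < \<beta> \<Longrightarrow> m < strict_sup K A \<beta>"
proof -
  obtain y where y: "y \<in> K" "y < \<beta>" "\<And>m. m \<in> A \<Longrightarrow> m < \<beta> \<Longrightarrow> m < y"
    using wide_countable_bound[OF assms(1,2)] assms(3) by blast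
  show "strict_sup K A \<beta> \<in> K" "m \<in> A \<Longrightarrow> m < \<beta> \<Longrightarrow> m < strict_sup K A \<beta>"
    using strict_sup[OF y(1), of A \<beta>] y(3) by blast+
  have "strict_sup K A \<beta> \<le> y" using strict_sup(2)[OF y(1), of A \<beta>] y(3) by blast
  then show "strict_sup K A \<beta> < \<beta>" using y(2) by simp
qed

text \<open>It depends on \<open>K\<close> and \<open>\<beta>\<close> only, so walks can use it
  without knowing the chain. It is meaningful where some \<open>omega1\<close>-sequence is cofinal
  below \<open>\<beta>\<close>.\<close>

definition cofmap :: "'k::wellorder set \<Rightarrow> 'k \<Rightarrow> omega1 \<Rightarrow> 'k" where
  "cofmap K \<beta> = (SOME e. (\<forall>\<xi>. e \<xi> \<in> K \<and> e \<xi> < \<beta>) \<and> (\<forall>y\<in>K. y < \<beta> \<longrightarrow> (\<exists>\<xi>. y \<le> e \<xi>)))"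

lemma cofmap:
  fixes e :: "omega1 \<Rightarrow> 'k::wellorder"
  assumes "\<And>\<xi>. e \<xi> \<in> K" "\<And>\<xi>. e \<xi> < \<beta>" "\<And>y. y \<in> K \<Longrightarrow> y < \<beta> \<Longrightarrow> \<exists>\<xi>. y \<le> e \<xi>"
  shows "cofmap K \<beta> \<xi> \<in> K" "cofmap K \<beta> \<xi> < \<beta>" "y \<in> K \<Longrightarrow> y < \<beta> \<Longrightarrow> \<exists>\<xi>. y \<le> cofmap K \<beta> \<xi>"
proof -
  have "(\<forall>\<xi>. cofmap K \<beta> \<xi> \<in> K \<and> cofmap K \<beta> \<xi> < \<beta>) \<and> (\<forall>y\<in>K. y < \<beta> \<longrightarrow> (\<exists>\<xi>. y \<le> cofmap K \<beta> \<xi>))"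
    unfolding cofmap_def by (rule someI[of _ e]) (use assms in blast)
  then show "cofmap K \<beta> \<xi> \<in> K" "cofmap K \<beta> \<xi> < \<beta>" "y \<in> K \<Longrightarrow> y < \<beta> \<Longrightarrow> \<exists>\<xi>. y \<le> cofmap K \<beta> \<xi>"
    by blast+
qed

lemma cofmap_not_wide:
  assumes "\<not> wide K \<beta>" and "x \<in> K" "x < \<beta>"
  shows "cofmap K \<beta> \<xi> \<in> K" "cofmap K \<beta> \<xi> < \<beta>" "y \<in> K \<Longrightarrow> y < \<beta> \<Longrightarrow> \<exists>\<xi>. y \<le> cofmap K \<beta> \<xi>"
proof -
  obtain e :: "omega1 \<Rightarrow> _" where e: "\<And>\<xi>. e \<xi> \<in> K \<and> e \<xi> < \<beta>" "\<not> (\<exists>y\<in>K. y < \<beta> \<and> (\<forall>\<xi>. e \<xi> < y))"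
    using assms unfolding wide_def by blast
  have "\<exists>\<xi>. y \<le> e \<xi>" if "y \<in> K" "y < \<beta>" for y using e(2) that by (meson not_less)
  then show "cofmap K \<beta> \<xi> \<in> K" "cofmap K \<beta> \<xi> < \<beta>" "y \<in> K \<Longrightarrow> y < \<beta> \<Longrightarrow> \<exists>\<xi>. y \<le> cofmap K \<beta> \<xi>"
    using cofmap[of e K \<beta>] e(1) by blast+
qed

text \<open>
  A closed stage \<open>N\<close> of a chain is recovered from a countable cover \<open>C\<close> and from \<open>s\<close>, the map sending \<open>\<beta>\<close> to
  the supremum of the whole chain below \<open>\<beta>\<close>: if \<open>\<alpha> \<in> N\<close> were missed, then the least \<open>\<beta> > \<alpha>\<close> that is reached
  admits a step to some point of \<open>[\<alpha>, \<beta>)\<close>.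
\<close>

inductive_set walks :: "'k::wellorder set \<Rightarrow> 'k \<Rightarrow> 'k set \<Rightarrow> ('k \<Rightarrow> 'k) \<Rightarrow> omega1 \<Rightarrow> 'k set"
  for K T C s j where
  top: "T \<in> walks K T C s j"
| step: "\<beta> \<in> walks K T C s j \<Longrightarrow> \<xi> < j \<Longrightarrow> y = (LEAST m. m \<in> C \<and> cofmap K (s \<beta>) \<xi> \<le> m) \<Longrightarrow>
    y \<in> C \<Longrightarrow> y < \<beta> \<Longrightarrow> y \<in> walks K T C s j"

section \<open>Chains of countable sets guided by a cofinal family\<close>

locale covering =
  fixes K :: "'k::wellorder set" and F :: "'k set set" and T :: 'k
  assumes uncountable_K: "uncountable K" and T_max: "x \<in> K \<Longrightarrow> x < T"
    and F_countable: "A \<in> F \<Longrightarrow> countable A" and F_sub: "A \<in> F \<Longrightarrow> A \<subseteq> K"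
    and F_cofinal: "countable A \<Longrightarrow> A \<subseteq> K \<Longrightarrow> \<exists>B\<in>F. A \<subseteq> B"
begin

definition cover :: "'k set \<Rightarrow> 'k set" where
  "cover A = (SOME B. B \<in> F \<and> A \<subseteq> B)"

lemma cover:
  assumes "countable A" and "A \<subseteq> K"
  shows "cover A \<in> F" "A \<subseteq> cover A"
  using someI_ex[of "\<lambda>B. B \<in> F \<and> A \<subseteq> B"] F_cofinal[OF assms] unfolding cover_def by blast+

definition wides :: "'k set \<Rightarrow> 'k set" where
  "wides C = {\<beta>\<in>insert T C. wide K \<beta>}"

definition Idx :: "'k set wo set" where
  "Idx = insert Top (Elt ` F)"

text \<open>Each member of \<open>F\<close> yields a function bounding its elements below every
  coordinate. A function in the product has countable range, hence is covered by some member and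
  dominated by its function. This is why all pcf indices fit into \<open>Idx\<close>, a set no
  larger than \<open>F\<close>.\<close>

lemma scales_wides:
  assumes "C \<in> F"
  shows "scales K (wides C) Idx Top"
proof
  show "countable (wides C)"
    by (rule countable_subset[of _ "insert T C"]) (use F_countable[OF assms] in \<open>auto simp: wides_def\<close>)
  show "wide K n" if "n \<in> wides C" for n using that by (simp add: wides_def)
  show "Top \<in> Idx" by (simp add: Idx_def)
  define A where "A i = (case i of Elt X \<Rightarrow> X | Top \<Rightarrow> {})" for i :: "'k set wo"
  have A: "countable (A i)" if "i \<in> Idx" for i
    using that F_countable by (auto simp: A_def Idx_def)
  have "\<forall>p\<in>Idx \<times> wides C. \<exists>y. y \<in> K \<and> y < snd p \<and> (\<forall>a\<in>A (fst p). a \<in> K \<longrightarrow> a < snd p \<longrightarrow> a < y)"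
    by (intro ballI wide_countable_bound) (auto simp: wides_def A)
  from bchoice[OF this] obtain d where
    d: "\<And>i n. i \<in> Idx \<Longrightarrow> n \<in> wides C \<Longrightarrow> d (i, n) \<in> K \<and> d (i, n) < n \<and>
      (\<forall>a\<in>A i. a \<in> K \<longrightarrow> a < n \<longrightarrow> a < d (i, n))" by auto
  have "\<exists>i\<in>Idx. i < Top \<and> (\<forall>n\<in>wides C. h n \<le> d (i, n))" if h: "\<forall>n\<in>wides C. h n \<in> K \<and> h n < n" for h
  proof -
    obtain B where B: "B \<in> F" "h ` wides C \<subseteq> B"
      using F_cofinal[of "h ` wides C"] h \<open>countable (wides C)\<close> by auto
    have "h n \<le> d (Elt B, n)" if n: "n \<in> wides C" for n
    proof -
      have "h n \<in> A (Elt B)" using B(2) n by (auto simp: A_def)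
      then show ?thesis using d[of "Elt B" n] B(1) n h by (auto simp: Idx_def intro: less_imp_le)
    qed
    then show ?thesis using B(1) by (intro bexI[of _ "Elt B"]) (auto simp: Idx_def)
  qed
  then show "\<exists>d. (\<forall>i\<in>Idx. \<forall>n\<in>wides C. d i n \<in> K \<and> d i n < n) \<and>
      (\<forall>h. (\<forall>n\<in>wides C. h n \<in> K \<and> h n < n) \<longrightarrow> (\<exists>i\<in>Idx. i < Top \<and> (\<forall>n\<in>wides C. h n \<le> d i n)))"
    using d by (intro exI[of _ "\<lambda>i n. d (i, n)"]) auto
qed

abbreviation dem :: "'k set \<Rightarrow> (omega1 \<Rightarrow> 'k set) \<Rightarrow> omega1 \<Rightarrow> ('k \<Rightarrow> 'k) set" where
  "dem C M j \<equiv> scales.demands K (wides C) Idx (\<lambda>i. strict_sup K (M i)) j"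

text \<open>What later stages must contain, in this order: a cover, so that covers of stages stay
  inside the chain; the values of the demands for all earlier covers; the suprema below wide points,
  which make the supremum of the whole chain a limit of its own elements; and cofinal sequences
  below the points that are not wide.\<close>

definition closing_set :: "(omega1 \<Rightarrow> 'k set) \<Rightarrow> omega1 \<Rightarrow> 'k set" where
  "closing_set M j = cover (M j) \<union>
     (\<Union>i\<in>{..j}. \<Union>j'\<in>{..j}. \<Union>h\<in>dem (cover (M i)) M j'. h ` wides (cover (M i))) \<union>
     strict_sup K (M j) ` wides (M j) \<union>
     (\<Union>\<beta>\<in>{\<beta>\<in>insert T (M j). \<not> wide K \<beta> \<and> (\<exists>x\<in>K. x < \<beta>)}. cofmap K \<beta> ` {..j})"

lemma countable_wides: "countable C \<Longrightarrow> countable (wides C)"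
  by (rule countable_subset[of _ "insert T C"]) (auto simp: wides_def)

lemma closing_set:
  assumes "\<And>i. i \<le> j \<Longrightarrow> countable (M i) \<and> M i \<subseteq> K"
  shows "countable (closing_set M j)" "closing_set M j \<subseteq> K"
proof -
  have cF: "cover (M i) \<in> F" if "i \<le> j" for i using assms[OF that] cover by blast
  note sc = scales_wides[OF cF]
  have cc: "countable (cover (M i))" if "i \<le> j" for i using F_countable[OF cF[OF that]] .
  have "countable (\<Union>i\<in>{..j}. \<Union>j'\<in>{..j}. \<Union>h\<in>dem (cover (M i)) M j'. h ` wides (cover (M i)))"
    by (intro countable_UN countable_omega1_atMost countable_image countable_wides cc
        scales.countable_demands[OF sc]) auto
  moreover have "countable (cofmap K \<beta> ` {..j})" for \<beta> by (simp add: countable_omega1_atMost)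
  then have "countable (\<Union>\<beta>\<in>{\<beta>\<in>insert T (M j). \<not> wide K \<beta> \<and> (\<exists>x\<in>K. x < \<beta>)}. cofmap K \<beta> ` {..j})"
    using assms[of j] by (intro countable_UN) (auto intro: countable_subset[of _ "insert T (M j)"])
  moreover have "countable (strict_sup K (M j) ` wides (M j))"
    using assms[of j] by (intro countable_image countable_wides) simp
  ultimately show "countable (closing_set M j)" unfolding closing_set_def using cc[of j] by simp
  have "h n \<in> K" if "i \<le> j" "h \<in> dem (cover (M i)) M j'" "n \<in> wides (cover (M i))" for i j' h n
  proof -
    have "h \<in> scales.P K (wides (cover (M i)))"
      using scales.demands_sub[OF sc[OF that(1)]] that(2) by blast
    then show ?thesis using that(3) unfolding scales.P_def[OF sc[OF that(1)]] by blast
  qed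
  moreover have "strict_sup K (M j) n \<in> K" if "n \<in> wides (M j)" for n
    using strict_sup_countable(1)[of K n "M j"] assms[of j] that by (auto simp: wides_def)
  moreover have "(\<Union>\<beta>\<in>{\<beta>\<in>insert T (M j). \<not> wide K \<beta> \<and> (\<exists>x\<in>K. x < \<beta>)}. cofmap K \<beta> ` {..j}) \<subseteq> K"
    using cofmap_not_wide(1) by blast
  ultimately show "closing_set M j \<subseteq> K"
    using F_sub[OF cF[of j]] unfolding closing_set_def by auto
qed

lemma closing_set_cong:
  assumes eq: "\<And>i. i \<le> j \<Longrightarrow> M i = M' i" and M: "\<And>i. i \<le> j \<Longrightarrow> countable (M i) \<and> M i \<subseteq> K"
  shows "closing_set M j = closing_set M' j"
proof -
  have "dem (cover (M i)) M j' = dem (cover (M' i)) M' j'" if "i \<le> j" "j' \<le> j" for i j'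
  proof -
    have "cover (M i) \<in> F" using M[OF that(1)] cover by blast
    from scales.demands_cong[OF scales_wides[OF this], of j' "\<lambda>i. strict_sup K (M i)" "\<lambda>i. strict_sup K (M' i)"]
    show ?thesis using eq that by simp
  qed
  then show ?thesis unfolding closing_set_def using eq by simp
qed

lemma chain_exists:
  fixes f :: "nat \<Rightarrow> 'k \<Rightarrow> 'k"
  assumes f: "\<And>n x. x \<in> K \<Longrightarrow> f n x \<in> K"
  shows "\<exists>M. \<forall>j. countable (M j) \<and> M j \<subseteq> K \<and> M j \<noteq> {} \<and> (\<forall>n. \<forall>x\<in>M j. f n x \<in> M j) \<and>
    (\<forall>i<j. M i \<union> closing_set M i \<subseteq> M j)"
proof -
  define G where "G A \<longleftrightarrow> countable A \<and> A \<subseteq> K \<and> A \<noteq> {} \<and> (\<forall>n. \<forall>x\<in>A. f n x \<in> A)" for A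
  obtain k where k: "k \<in> K" using uncountable_K by fastforce
  have ext: "\<exists>B. G B \<and> A \<subseteq> B" if "countable A" "A \<subseteq> K" for A
    using countable_closed_superset[of "insert k A" K f] that k f unfolding G_def by auto
  \<comment> \<open>The premise on earlier stages makes \<open>R\<close> depend only on the values
    of \<open>M\<close> below \<open>j\<close> even for arbitrary \<open>M\<close>, as the recursion
    requires; for the chain itself it always holds.\<close>
  define R where "R M j A \<longleftrightarrow> G A \<and> (\<forall>i<j. (\<forall>i'\<le>i. G (M i')) \<longrightarrow> M i \<union> closing_set M i \<subseteq> A)"
    for M :: "omega1 \<Rightarrow> 'k set" and j A
  have "\<exists>M. \<forall>j. R M j (M j)"
  proof (rule dependent_wellorder_choice)
    fix j A and M M' :: "omega1 \<Rightarrow> 'k set" assume eq: "\<And>x. x < j \<Longrightarrow> M x = M' x"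
    have "((\<forall>i'\<le>i. G (M i')) \<longrightarrow> M i \<union> closing_set M i \<subseteq> A) \<longleftrightarrow>
        ((\<forall>i'\<le>i. G (M' i')) \<longrightarrow> M' i \<union> closing_set M' i \<subseteq> A)" if "i < j" for i
    proof -
      have e: "M i' = M' i'" if "i' \<le> i" for i' using eq that \<open>i < j\<close> by simp
      show ?thesis
      proof (cases "\<forall>i'\<le>i. G (M i')")
        case True
        then have "closing_set M i = closing_set M' i" using e by (intro closing_set_cong) (auto simp: G_def)
        then show ?thesis using e by simp
      qed (use e in auto)
    qed
    then show "R M j A = R M' j A" unfolding R_def by simp
  next
    fix j M assume "\<And>i. i < j \<Longrightarrow> R M i (M i)"
    then have GM: "G (M i)" if "i < j" for i using that unfolding R_def by blast
    have "countable (M i \<union> closing_set M i) \<and> M i \<union> closing_set M i \<subseteq> K" if "i < j" for i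
      using closing_set[of i M] GM that unfolding G_def by auto
    then have "\<exists>B. G B \<and> (\<Union>i\<in>{..<j}. M i \<union> closing_set M i) \<subseteq> B"
      by (intro ext countable_UN countable_omega1_lessThan) auto
    then show "\<exists>A. R M j A" unfolding R_def by blast
  qed
  then obtain M where M: "\<And>j. R M j (M j)" by blast
  then have "G (M j)" for j unfolding R_def by blast
  with M have "G (M j) \<and> (\<forall>i<j. M i \<union> closing_set M i \<subseteq> M j)" for j unfolding R_def by blast
  then show ?thesis unfolding G_def by (intro exI[of _ M] allI) simp
qed

text \<open>Uses a member of \<open>F\<close> and finitely many index pairs but no chain; for the
  right pairs it returns \<open>sup_below\<close> on that member.\<close>

definition guess :: "'k set \<Rightarrow> ('k set wo \<times> 'k set wo) set \<Rightarrow> 'k \<Rightarrow> 'k" where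
  "guess C \<Phi> \<beta> = (if wide K \<beta> then Max ((\<lambda>(l, g). scales.limit_fun K (wides C) Idx l g \<beta>) ` \<Phi>) else \<beta>)"

section \<open>Suprema and next points of a fixed chain\<close>

context
  fixes M :: "omega1 \<Rightarrow> 'k set" and f :: "nat \<Rightarrow> 'k \<Rightarrow> 'k"
  assumes M_countable: "\<And>j. countable (M j)" and M_sub: "\<And>j. M j \<subseteq> K" and M_ne: "\<And>j. M j \<noteq> {}"
    and M_f: "\<And>n x j. x \<in> M j \<Longrightarrow> f n x \<in> M j"
    and M_closing_set: "\<And>i j. i < j \<Longrightarrow> M i \<union> closing_set M i \<subseteq> M j"
begin

definition "chain_union = (\<Union>j. M j)"

definition "sup_below \<beta> = (if wide K \<beta> then strict_sup K chain_union \<beta> else \<beta>)"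

definition "next_point \<beta> \<xi> = (LEAST m. m \<in> chain_union \<and> cofmap K (sup_below \<beta>) \<xi> \<le> m)"

lemma M_mono: "i \<le> j \<Longrightarrow> M i \<subseteq> M j"
  using M_closing_set[of i j] by (cases "i = j") auto

lemma closing_set_chain_union: "closing_set M j \<subseteq> chain_union"
  using omega1_gt_ex[of j] M_closing_set unfolding chain_union_def by blast

lemma chain_union_sub: "chain_union \<subseteq> K"
  using M_sub unfolding chain_union_def by blast

lemma cover_M: "cover (M j) \<in> F" "M j \<subseteq> cover (M j)" "cover (M j) \<subseteq> chain_union"
  using cover[OF M_countable M_sub] closing_set_chain_union[of j] unfolding closing_set_def by auto

text \<open>The union may be uncountable, but the suprema of its stages are only
  \<open>omega1\<close> many points below \<open>\<beta>\<close>, so wideness bounds them.\<close>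

lemma strict_sup_chain_union:
  assumes "wide K \<beta>"
  shows "strict_sup K chain_union \<beta> \<in> K" "strict_sup K chain_union \<beta> < \<beta>" "m \<in> chain_union \<Longrightarrow> m < \<beta> \<Longrightarrow> m < strict_sup K chain_union \<beta>"
proof -
  have "\<forall>j. strict_sup K (M j) \<beta> \<in> K \<and> strict_sup K (M j) \<beta> < \<beta>"
    using strict_sup_countable[OF assms M_countable M_sub] by blast
  moreover have "(\<forall>j. strict_sup K (M j) \<beta> \<in> K \<and> strict_sup K (M j) \<beta> < \<beta>) \<longrightarrow> (\<exists>y\<in>K. y < \<beta> \<and> (\<forall>j. strict_sup K (M j) \<beta> < y))"
    using assms unfolding wide_def by (elim conjE allE[of _ "\<lambda>j. strict_sup K (M j) \<beta>"])
  ultimately obtain y where y: "y \<in> K" "y < \<beta>" "\<And>j. strict_sup K (M j) \<beta> < y" by blast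
  have ub: "m < y" if "m \<in> chain_union" "m < \<beta>" for m
  proof -
    obtain j where "m \<in> M j" using \<open>m \<in> chain_union\<close> unfolding chain_union_def by blast
    then have "m < strict_sup K (M j) \<beta>" using strict_sup_countable(3)[OF assms M_countable M_sub] that by blast
    then show ?thesis using y(3) less_trans by blast
  qed
  show "strict_sup K chain_union \<beta> \<in> K" "m \<in> chain_union \<Longrightarrow> m < \<beta> \<Longrightarrow> m < strict_sup K chain_union \<beta>"
    using strict_sup[OF y(1), of chain_union \<beta>] ub by blast+
  have "strict_sup K chain_union \<beta> \<le> y" using strict_sup(2)[OF y(1), of chain_union \<beta>] ub by blast
  then show "strict_sup K chain_union \<beta> < \<beta>" using y(2) by simp
qed

lemma strict_sup_M_mono:
  assumes "wide K n" and "A \<subseteq> B" and "strict_sup K B n \<in> K" "\<And>m. m \<in> B \<Longrightarrow> m < n \<Longrightarrow> m < strict_sup K B n"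
  shows "strict_sup K A n \<le> strict_sup K B n"
  by (rule strict_sup(2)) (use assms in blast)+

text \<open>The suprema of the stages form an increasing chain in the product over the wide points
  of the cover, and \<open>closing_set\<close> makes it meet its demands, so
  \<open>X_finite_max\<close> applies.\<close>

lemma guess_catches:
  "\<exists>\<Phi>. finite \<Phi> \<and> \<Phi> \<subseteq> Idx \<times> Idx \<and> (\<forall>\<beta>\<in>insert T (cover (M i)). guess (cover (M i)) \<Phi> \<beta> = sup_below \<beta>)"
proof -
  let ?b = "wides (cover (M i))"
  note sc = scales_wides[OF cover_M(1)[of i]]
  have w: "wide K n" if "n \<in> ?b" for n using that by (simp add: wides_def)
  note cj = strict_sup_countable[OF w M_countable M_sub]
  have "\<exists>\<Phi>. finite \<Phi> \<and> \<Phi> \<subseteq> Idx \<times> Idx \<and>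
      (\<forall>n\<in>?b. strict_sup K chain_union n = Max ((\<lambda>(l, g). scales.limit_fun K ?b Idx l g n) ` \<Phi>))"
  proof (rule scales.X_finite_max[OF sc, of "\<lambda>j. strict_sup K (M j)"])
    show "strict_sup K (M j) \<in> scales.P K ?b" for j
      using cj unfolding scales.P_def[OF sc] by blast
    show "strict_sup K (M j) n \<le> strict_sup K (M j') n" if "j \<le> j'" "n \<in> ?b" for j j' n
      by (rule strict_sup_M_mono[OF w[OF that(2)] M_mono[OF that(1)]]) (use cj that(2) in blast)+
    show "\<exists>j'. \<forall>n\<in>?b. h n < strict_sup K (M j') n" if h: "h \<in> dem (cover (M i)) M j" for j h
    proof -
      obtain j' where j': "max i j < j'" using omega1_gt_ex by blast
      have "h n < strict_sup K (M j') n" if n: "n \<in> ?b" for n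
      proof (rule cj(3)[OF n])
        \<comment> \<open>Stage \<open>max i j\<close> is late enough to know both the cover of
          \<open>M i\<close> and the demands at \<open>j\<close>.\<close>
        have "h n \<in> closing_set M (max i j)"
          unfolding closing_set_def
          by (rule UnI1, rule UnI1, rule UnI2, intro UN_I[of i] UN_I[of j] UN_I[of h])
            (use h n in \<open>auto simp: le_max_iff_disj\<close>)
        then show "h n \<in> M j'" using M_closing_set[OF j'] by blast
        show "h n < n" using scales.demands_sub[OF sc] h n unfolding scales.P_def[OF sc] by blast
      qed
      then show ?thesis by blast
    qed
    show "strict_sup K chain_union n \<in> K" if "n \<in> ?b" for n by (rule strict_sup_chain_union(1)[OF w[OF that]])
    show "strict_sup K (M j) n \<le> strict_sup K chain_union n" if "n \<in> ?b" for j n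
      by (rule strict_sup_M_mono[OF w[OF that]]) (use strict_sup_chain_union[OF w[OF that]] in \<open>auto simp: chain_union_def\<close>)
    show "\<exists>j. y < strict_sup K (M j) n" if n: "n \<in> ?b" and y: "y \<in> K" "y < strict_sup K chain_union n" for n y
    proof -
      obtain m where m: "m \<in> chain_union" "m < n" "y \<le> m" using less_strict_supD[OF y(2,1)] by blast
      then obtain j where "m \<in> M j" unfolding chain_union_def by blast
      then have "m < strict_sup K (M j) n" using cj(3)[OF n] m(2) by blast
      then show ?thesis using m(3) le_less_trans by blast
    qed
  qed
  then obtain \<Phi> where \<Phi>: "finite \<Phi>" "\<Phi> \<subseteq> Idx \<times> Idx"
    "\<forall>n\<in>?b. strict_sup K chain_union n = Max ((\<lambda>(l, g). scales.limit_fun K ?b Idx l g n) ` \<Phi>)" by blast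
  have "guess (cover (M i)) \<Phi> \<beta> = sup_below \<beta>" if "\<beta> \<in> insert T (cover (M i))" for \<beta>
  proof (cases "wide K \<beta>")
    case True
    then have "\<beta> \<in> ?b" using that by (simp add: wides_def)
    then show ?thesis using \<Phi>(3) True unfolding guess_def sup_below_def by simp
  qed (simp add: guess_def sup_below_def)
  then show ?thesis using \<Phi>(1,2) by blast
qed

context
  fixes \<beta> m0
  assumes \<beta>: "\<beta> \<in> insert T chain_union" and m0: "m0 \<in> chain_union" "m0 < \<beta>"
begin

lemma \<beta>_M: "\<exists>j. \<beta> \<in> insert T (M j) \<and> i \<le> j"
proof (cases "\<beta> = T")
  case False
  then obtain j where "\<beta> \<in> M j" using \<beta> unfolding chain_union_def by blast
  then have "\<beta> \<in> M (max i j)" using M_mono[of j "max i j"] by auto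
  then show ?thesis by (intro exI[of _ "max i j"]) simp
qed auto

lemma less_sup_below: "m \<in> chain_union \<Longrightarrow> m < \<beta> \<Longrightarrow> m < sup_below \<beta>"
  using strict_sup_chain_union(3)[of \<beta> m] unfolding sup_below_def by simp

text \<open>Below a wide \<open>\<beta>\<close>, the suprema of sufficiently late stages belong to
  the chain by \<open>closing_set\<close>, hence form an \<open>omega1\<close>-sequence cofinal in
  \<open>sup_below \<beta>\<close>. Otherwise \<open>\<beta>\<close> itself has such a
  sequence.\<close>

lemma cofmap_sup_below:
  "cofmap K (sup_below \<beta>) \<xi> \<in> K" "cofmap K (sup_below \<beta>) \<xi> < sup_below \<beta>"
  "y \<in> K \<Longrightarrow> y < sup_below \<beta> \<Longrightarrow> \<exists>\<xi>. y \<le> cofmap K (sup_below \<beta>) \<xi>"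
proof -
  have "cofmap K (sup_below \<beta>) \<xi> \<in> K \<and> cofmap K (sup_below \<beta>) \<xi> < sup_below \<beta> \<and>
    (y \<in> K \<longrightarrow> y < sup_below \<beta> \<longrightarrow> (\<exists>\<xi>. y \<le> cofmap K (sup_below \<beta>) \<xi>))"
  proof (cases "wide K \<beta>")
    case True
    note cj = strict_sup_countable[OF True M_countable M_sub]
    obtain j0 where j0: "\<beta> \<in> insert T (M j0)" using \<beta>_M[of undefined] by blast
    define e where "e j = strict_sup K (M (max j j0)) \<beta>" for j
    have "e j \<in> chain_union" for j
    proof -
      have "\<beta> \<in> wides (M (max j j0))"
        using j0 True M_mono[of j0 "max j j0"] by (auto simp: wides_def)
      then have "e j \<in> closing_set M (max j j0)" unfolding closing_set_def e_def by blast
      then show ?thesis using closing_set_chain_union by blast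
    qed
    then have "e j < sup_below \<beta>" for j using cj(2) by (intro less_sup_below) (simp_all add: e_def)
    moreover have "\<exists>\<xi>. y \<le> e \<xi>" if y: "y \<in> K" "y < sup_below \<beta>" for y
    proof -
      obtain m where m: "m \<in> chain_union" "m < \<beta>" "y \<le> m"
        using less_strict_supD[of y K chain_union \<beta>] y True unfolding sup_below_def by auto
      then obtain j where "m \<in> M j" unfolding chain_union_def by blast
      then have "m \<in> M (max j j0)" using M_mono[of j "max j j0"] by auto
      then have "m < e j" using cj(3) m(2) unfolding e_def by blast
      then show ?thesis using m(3) by (intro exI[of _ j]) simp
    qed
    moreover have "e j \<in> K" for j using cj(1) unfolding e_def by blast
    ultimately show ?thesis using cofmap[of e K "sup_below \<beta>"] by blast
  next
    case False
    have "m0 \<in> K" using m0(1) chain_union_sub by blast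
    then show ?thesis using cofmap_not_wide[OF False _ m0(2)] False unfolding sup_below_def by auto
  qed
  then show "cofmap K (sup_below \<beta>) \<xi> \<in> K" "cofmap K (sup_below \<beta>) \<xi> < sup_below \<beta>"
    "y \<in> K \<Longrightarrow> y < sup_below \<beta> \<Longrightarrow> \<exists>\<xi>. y \<le> cofmap K (sup_below \<beta>) \<xi>" by blast+
qed

lemma chain_union_above: "\<exists>m\<in>chain_union. m < \<beta> \<and> cofmap K (sup_below \<beta>) \<xi> \<le> m"
proof (cases "wide K \<beta>")
  case True
  then show ?thesis using less_strict_supD[of "cofmap K (sup_below \<beta>) \<xi>" K chain_union \<beta>] cofmap_sup_below(1,2) unfolding sup_below_def by auto
next
  case False
  obtain j where j: "\<beta> \<in> insert T (M j)" "\<xi> \<le> j" using \<beta>_M by blast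
  have "m0 \<in> K" using m0(1) chain_union_sub by blast
  then have "cofmap K \<beta> \<xi> \<in> closing_set M j" using j False m0(2) unfolding closing_set_def by blast
  moreover have "sup_below \<beta> = \<beta>" using False unfolding sup_below_def by simp
  ultimately show ?thesis using closing_set_chain_union cofmap_sup_below(2)[of \<xi>] by auto
qed

lemma next_point: "next_point \<beta> \<xi> \<in> chain_union" "cofmap K (sup_below \<beta>) \<xi> \<le> next_point \<beta> \<xi>" "next_point \<beta> \<xi> < \<beta>"
proof -
  obtain m where m: "m \<in> chain_union" "m < \<beta>" "cofmap K (sup_below \<beta>) \<xi> \<le> m" using chain_union_above by blast
  have "next_point \<beta> \<xi> \<in> chain_union \<and> cofmap K (sup_below \<beta>) \<xi> \<le> next_point \<beta> \<xi>"
    unfolding next_point_def by (rule LeastI[of _ m]) (use m in blast)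
  moreover have "next_point \<beta> \<xi> \<le> m" unfolding next_point_def by (rule Least_le) (use m in blast)
  ultimately show "next_point \<beta> \<xi> \<in> chain_union" "cofmap K (sup_below \<beta>) \<xi> \<le> next_point \<beta> \<xi>" "next_point \<beta> \<xi> < \<beta>" using m(2) by auto
qed

lemma cofmap_above: "\<alpha> \<in> chain_union \<Longrightarrow> \<alpha> < \<beta> \<Longrightarrow> \<exists>\<xi>. \<alpha> \<le> cofmap K (sup_below \<beta>) \<xi>"
  using cofmap_sup_below(3)[of \<alpha>] less_sup_below chain_union_sub by blast

end

section \<open>Recovering a closed stage by walks\<close>

definition "chain_below j = (\<Union>i\<in>{..<j}. M i)"

lemma chain_below_directed:
  assumes "x \<in> insert T (chain_below j)" "y \<in> insert T (chain_below j)" "\<xi> < j"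
  shows "\<exists>i<j. x \<in> insert T (M i) \<and> y \<in> insert T (M i) \<and> \<xi> \<le> i"
proof -
  obtain a where a: "a < j" "x \<in> insert T (M a)" using assms(1,3) unfolding chain_below_def by blast
  obtain c where c: "c < j" "y \<in> insert T (M c)" using assms(2,3) unfolding chain_below_def by blast
  show ?thesis
    using a c assms(3) M_mono[of a "max \<xi> (max a c)"] M_mono[of c "max \<xi> (max a c)"]
    by (intro exI[of _ "max \<xi> (max a c)"]) (auto simp: le_max_iff_disj)
qed

lemma chain_below_sub_chain_union: "chain_below j \<subseteq> chain_union"
  unfolding chain_below_def chain_union_def by blast

text \<open>\<open>p i\<close> bounds both the stages at which the next points computed from
  \<open>M i\<close> appear and the indices needed to climb from one element of \<open>M i\<close>
  towards another; any stage closed under \<open>p\<close> works.\<close>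

lemma closed_stage:
  "\<exists>j>j0. (\<forall>\<beta>\<in>insert T (chain_below j). \<forall>\<xi><j. (\<exists>m\<in>chain_union. m < \<beta>) \<longrightarrow> next_point \<beta> \<xi> \<in> chain_below j) \<and>
    (\<forall>\<alpha>\<in>chain_below j. \<forall>\<beta>\<in>insert T (chain_below j). \<alpha> < \<beta> \<longrightarrow> (\<exists>\<xi><j. \<alpha> \<le> cofmap K (sup_below \<beta>) \<xi>))"
proof -
  define r where "r = (\<lambda>(\<beta>, \<xi>). SOME k. next_point \<beta> \<xi> \<in> M k)"
  define q where "q = (\<lambda>(\<alpha>, \<beta>). SOME \<xi>. \<alpha> \<le> cofmap K (sup_below \<beta>) \<xi>)"
  have "\<exists>y. \<forall>z\<in>r ` (insert T (M i) \<times> {..i}) \<union> q ` (M i \<times> insert T (M i)). z < y" for i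
    using M_countable countable_omega1_atMost
    by (intro countable_omega1_bounded countable_Un countable_image countable_SIGMA) auto
  then obtain p where p: "\<And>i z. z \<in> r ` (insert T (M i) \<times> {..i}) \<union> q ` (M i \<times> insert T (M i)) \<Longrightarrow> z < p i"
    by metis
  obtain j where j: "j0 < j" "closed_under p j" using closed_under_ex by blast
  have "next_point \<beta> \<xi> \<in> chain_below j" if b: "\<beta> \<in> insert T (chain_below j)" "\<xi> < j" and m: "m \<in> chain_union" "m < \<beta>" for \<beta> \<xi> m
  proof -
    obtain i where i: "i < j" "\<beta> \<in> insert T (M i)" "\<xi> \<le> i" using chain_below_directed[OF b(1) b(1,2)] by blast
    have "\<beta> \<in> insert T chain_union" using b(1) chain_below_sub_chain_union by blast
    then have "next_point \<beta> \<xi> \<in> chain_union" by (rule next_point(1)[OF _ m])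
    then have "\<exists>k. next_point \<beta> \<xi> \<in> M k" unfolding chain_union_def by blast
    then have "next_point \<beta> \<xi> \<in> M (r (\<beta>, \<xi>))" unfolding r_def prod.case by (rule someI_ex)
    moreover have "r (\<beta>, \<xi>) < p i" using i by (intro p) blast
    then have "r (\<beta>, \<xi>) < j" using j(2) i(1) unfolding closed_under_def by (meson less_trans)
    ultimately show ?thesis unfolding chain_below_def by blast
  qed
  moreover have "\<exists>\<xi><j. \<alpha> \<le> cofmap K (sup_below \<beta>) \<xi>"
    if a: "\<alpha> \<in> chain_below j" and b: "\<beta> \<in> insert T (chain_below j)" and "\<alpha> < \<beta>" for \<alpha> \<beta>
  proof -
    obtain i where i: "i < j" "\<alpha> \<in> insert T (M i)" "\<beta> \<in> insert T (M i)"
      using chain_below_directed[of \<alpha> j \<beta> j0] a b j(1) by blast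
    have am: "\<alpha> \<in> chain_union" "\<beta> \<in> insert T chain_union" using a b chain_below_sub_chain_union by auto
    then have "\<alpha> \<noteq> T" using chain_union_sub T_max by blast
    then have "\<alpha> \<in> M i" using i(2) by blast
    have "\<exists>\<xi>. \<alpha> \<le> cofmap K (sup_below \<beta>) \<xi>"
      by (rule cofmap_above[OF am(2) am(1) \<open>\<alpha> < \<beta>\<close> am(1) \<open>\<alpha> < \<beta>\<close>])
    then have "\<alpha> \<le> cofmap K (sup_below \<beta>) (q (\<alpha>, \<beta>))" unfolding q_def prod.case by (rule someI_ex)
    moreover have "q (\<alpha>, \<beta>) < p i" using i(3) \<open>\<alpha> \<in> M i\<close> by (intro p) blast
    then have "q (\<alpha>, \<beta>) < j" using j(2) i(1) unfolding closed_under_def by (meson less_trans)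
    ultimately show ?thesis by blast
  qed
  ultimately show ?thesis using j(1) by blast
qed

text \<open>The next point is a minimum over the whole chain and already lies in
  \<open>chain_below j\<close>. Since \<open>C\<close> is between the two, the minimum over
  \<open>C\<close> is the same, and knowing \<open>C\<close> instead of the chain suffices for
  walking.\<close>

lemma walks_eq:
  assumes tgj: "\<And>\<beta> \<xi> m. \<beta> \<in> insert T (chain_below j) \<Longrightarrow> \<xi> < j \<Longrightarrow> m \<in> chain_union \<Longrightarrow> m < \<beta> \<Longrightarrow> next_point \<beta> \<xi> \<in> chain_below j"
    and cof: "\<And>\<alpha> \<beta>. \<alpha> \<in> chain_below j \<Longrightarrow> \<beta> \<in> insert T (chain_below j) \<Longrightarrow> \<alpha> < \<beta> \<Longrightarrow> \<exists>\<xi><j. \<alpha> \<le> cofmap K (sup_below \<beta>) \<xi>"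
    and C: "chain_below j \<subseteq> C" "C \<subseteq> chain_union" and s: "\<And>\<beta>. \<beta> \<in> insert T C \<Longrightarrow> s \<beta> = sup_below \<beta>"
  shows "walks K T C s j = insert T (chain_below j)"
proof
  have least_eq: "(LEAST m. m \<in> C \<and> cofmap K (s \<beta>) \<xi> \<le> m) = next_point \<beta> \<xi>"
    if b: "\<beta> \<in> insert T (chain_below j)" "\<xi> < j" and m: "m \<in> chain_union" "m < \<beta>" for \<beta> \<xi> m
  proof (rule Least_equality)
    have "\<beta> \<in> insert T C" "\<beta> \<in> insert T chain_union" using b(1) C by auto
    then show "next_point \<beta> \<xi> \<in> C \<and> cofmap K (s \<beta>) \<xi> \<le> next_point \<beta> \<xi>"
      using tgj[OF b m] C(1) next_point(2)[OF _ m] s by auto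
    show "next_point \<beta> \<xi> \<le> y" if "y \<in> C \<and> cofmap K (s \<beta>) \<xi> \<le> y" for y
      unfolding next_point_def by (rule Least_le) (use that C(2) s[OF \<open>\<beta> \<in> insert T C\<close>] in auto)
  qed
  show "walks K T C s j \<subseteq> insert T (chain_below j)"
  proof
    fix x assume "x \<in> walks K T C s j"
    then show "x \<in> insert T (chain_below j)"
    proof (induction rule: walks.induct)
      case (step \<beta> \<xi> y)
      have y: "y \<in> chain_union" using step.hyps(4) C(2) by blast
      have "y = next_point \<beta> \<xi>" using least_eq[OF step.IH step.hyps(2) y step.hyps(5)] step.hyps(3) by simp
      then show ?case using tgj[OF step.IH step.hyps(2) y step.hyps(5)] by simp
    qed simp
  qed
  show "insert T (chain_below j) \<subseteq> walks K T C s j"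
  proof (rule insert_subsetI[OF walks.top], rule subsetI, rule ccontr)
    fix \<alpha> assume a: "\<alpha> \<in> chain_below j" "\<alpha> \<notin> walks K T C s j"
    have aM: "\<alpha> \<in> chain_union" using a(1) chain_below_sub_chain_union by blast
    have "T \<in> walks K T C s j \<and> \<alpha> < T" using aM chain_union_sub T_max by (blast intro: walks.top)
    then obtain \<beta> where b: "\<beta> \<in> walks K T C s j \<and> \<alpha> < \<beta>"
      and least: "\<And>y. y \<in> walks K T C s j \<and> \<alpha> < y \<Longrightarrow> \<beta> \<le> y"
      by (rule ex_leastE[of "\<lambda>\<beta>. \<beta> \<in> walks K T C s j \<and> \<alpha> < \<beta>"]) blast
    have bM: "\<beta> \<in> insert T (chain_below j)" using b \<open>walks K T C s j \<subseteq> insert T (chain_below j)\<close> by blast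
    then have bMt: "\<beta> \<in> insert T chain_union" using chain_below_sub_chain_union by blast
    obtain \<xi> where \<xi>: "\<xi> < j" "\<alpha> \<le> cofmap K (sup_below \<beta>) \<xi>" using cof[OF a(1) bM] b by blast
    have tgb: "next_point \<beta> \<xi> \<in> chain_below j" using tgj[OF bM \<xi>(1) aM] b by blast
    have "next_point \<beta> \<xi> \<in> walks K T C s j"
    proof (rule walks.step[of \<beta>])
      show "next_point \<beta> \<xi> = (LEAST m. m \<in> C \<and> cofmap K (s \<beta>) \<xi> \<le> m)" using least_eq[OF bM \<xi>(1) aM] b by simp
      show "next_point \<beta> \<xi> < \<beta>" using next_point(3)[OF bMt aM] b by blast
    qed (use b \<xi>(1) tgb C(1) in auto)
    moreover have "\<alpha> \<le> next_point \<beta> \<xi>" using \<xi>(2) next_point(2)[OF bMt aM, of \<xi>] b by (auto intro: order_trans)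
    moreover have "next_point \<beta> \<xi> < \<beta>" using next_point(3)[OF bMt aM] b by blast
    ultimately show False using least[of "next_point \<beta> \<xi>"] a(2) by (metis leD order_le_less)
  qed
qed

lemma closed_member:
  "\<exists>C\<in>F. \<exists>\<Phi> j. finite \<Phi> \<and> \<Phi> \<subseteq> Idx \<times> Idx \<and> walks K T C (guess C \<Phi>) j - {T} \<noteq> {} \<and>
    countable (walks K T C (guess C \<Phi>) j - {T}) \<and> walks K T C (guess C \<Phi>) j - {T} \<subseteq> K \<and>
    (\<forall>n. \<forall>x\<in>walks K T C (guess C \<Phi>) j - {T}. f n x \<in> walks K T C (guess C \<Phi>) j - {T})"
proof -
  \<comment> \<open>Any starting point would do; being above one makes \<open>chain_below j\<close>
    nonempty.\<close>
  obtain j :: omega1 where j: "undefined < j"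
    "\<And>\<beta> \<xi> m. \<beta> \<in> insert T (chain_below j) \<Longrightarrow> \<xi> < j \<Longrightarrow> m \<in> chain_union \<Longrightarrow> m < \<beta> \<Longrightarrow> next_point \<beta> \<xi> \<in> chain_below j"
    "\<And>\<alpha> \<beta>. \<alpha> \<in> chain_below j \<Longrightarrow> \<beta> \<in> insert T (chain_below j) \<Longrightarrow> \<alpha> < \<beta> \<Longrightarrow> \<exists>\<xi><j. \<alpha> \<le> cofmap K (sup_below \<beta>) \<xi>"
    using closed_stage[of undefined] by blast
  obtain \<Phi> where \<Phi>: "finite \<Phi>" "\<Phi> \<subseteq> Idx \<times> Idx"
    "\<And>\<beta>. \<beta> \<in> insert T (cover (M j)) \<Longrightarrow> guess (cover (M j)) \<Phi> \<beta> = sup_below \<beta>"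
    using guess_catches[of j] by blast
  have "chain_below j \<subseteq> M j" using M_mono unfolding chain_below_def by (auto dest: less_imp_le)
  then have "chain_below j \<subseteq> cover (M j)" using cover_M(2) by blast
  then have "walks K T (cover (M j)) (guess (cover (M j)) \<Phi>) j = insert T (chain_below j)"
    using j(2,3) cover_M(3) \<Phi>(3) by (intro walks_eq) auto
  moreover have "T \<notin> chain_below j" using chain_below_sub_chain_union chain_union_sub T_max by blast
  ultimately have eq: "walks K T (cover (M j)) (guess (cover (M j)) \<Phi>) j - {T} = chain_below j" by blast
  have "chain_below j \<noteq> {}" using j(1) M_ne unfolding chain_below_def by blast
  moreover have "countable (chain_below j)"
    unfolding chain_below_def using M_countable countable_omega1_lessThan by blast
  moreover have "chain_below j \<subseteq> K" using chain_below_sub_chain_union chain_union_sub by blast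
  moreover have "\<forall>n. \<forall>x\<in>chain_below j. f n x \<in> chain_below j" using M_f unfolding chain_below_def by blast
  ultimately show ?thesis
    using \<Phi>(1,2) eq by (intro bexI[OF _ cover_M(1)[of j]] exI[of _ \<Phi>] exI[of _ j]) simp
qed

end

text \<open>Lets \<open>|F|\<close> absorb the countable ordinal that is part of the code of a
  stage.\<close>

lemma uncountable_F: "uncountable F"
proof
  assume "countable F"
  then have "countable (\<Union>F)" using F_countable by (intro countable_UN[of F id, simplified])
  moreover have "K \<subseteq> \<Union>F"
  proof
    fix x assume "x \<in> K"
    then show "x \<in> \<Union>F" using F_cofinal[of "{x}"] by auto
  qed
  ultimately show False using uncountable_K countable_subset by blast
qed

end

section \<open>Counting the codes\<close>

lemma omega1_embeds_uncountable:
  assumes "uncountable F"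
  shows "|UNIV :: omega1 set| \<le>o |F|"
proof -
  have "\<exists>g :: omega1 \<Rightarrow> 'a. \<forall>\<xi>. g \<xi> \<in> F \<and> g \<xi> \<notin> g ` {..<\<xi>}"
  proof (rule dependent_wellorder_choice)
    fix \<xi> and g :: "omega1 \<Rightarrow> 'a"
    have "countable (g ` {..<\<xi>})" by (simp add: countable_omega1_lessThan)
    then have "\<not> F \<subseteq> g ` {..<\<xi>}" using assms countable_subset by blast
    then show "\<exists>r. r \<in> F \<and> r \<notin> g ` {..<\<xi>}" by blast
  next
    fix r \<xi> and f g :: "omega1 \<Rightarrow> 'a" assume "\<And>x. x < \<xi> \<Longrightarrow> f x = g x"
    then have "f ` {..<\<xi>} = g ` {..<\<xi>}" by auto
    then show "(r \<in> F \<and> r \<notin> f ` {..<\<xi>}) = (r \<in> F \<and> r \<notin> g ` {..<\<xi>})" by simp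
  qed
  then obtain g :: "omega1 \<Rightarrow> 'a" where g: "\<And>\<xi>. g \<xi> \<in> F" "\<And>\<xi>. g \<xi> \<notin> g ` {..<\<xi>}" by blast
  have "inj g"
  proof (rule injI)
    fix x y assume eq: "g x = g y"
    have "x \<notin> {..<y}" "y \<notin> {..<x}" using g(2)[of x] g(2)[of y] eq by (metis imageI)+
    then show "x = y" by simp
  qed
  then show ?thesis using g(1) card_of_ordLeqI[of g UNIV F] by blast
qed

lemma card_of_finite_subsets_ordLeq:
  assumes inf: "infinite B" and A: "|A| \<le>o |B|"
  shows "|{X. finite X \<and> X \<subseteq> A}| \<le>o |B|"
proof -
  define S where "S = rec_nat {{}} (\<lambda>_ X. (\<lambda>(a, Y). insert a Y) ` (A \<times> X))"
  have S_Suc: "S (Suc n) = (\<lambda>(a, Y). insert a Y) ` (A \<times> S n)" and S_0: "S 0 = {{}}" for n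
    by (simp_all add: S_def)
  have "|S n| \<le>o |B|" for n
  proof (induction n)
    case 0
    show ?case unfolding S_0 by (rule card_of_singl_ordLeq) (use inf in auto)
  next
    case (Suc n)
    have "|A \<times> S n| \<le>o |B|" using Suc A by (intro card_of_Sigma_ordLeq_infinite inf) simp_all
    then show ?case unfolding S_Suc by (rule ordLeq_transitive[OF card_of_image])
  qed
  then have "|\<Union>n. S n| \<le>o |B|"
    using inf by (intro card_of_UNION_ordLeq_infinite) (simp_all add: infinite_iff_card_of_nat)
  moreover have "{X. finite X \<and> X \<subseteq> A} \<subseteq> (\<Union>n. S n)"
  proof clarify
    fix X assume "finite X" "X \<subseteq> A"
    then show "X \<in> (\<Union>n. S n)"
    proof (induction rule: finite_induct)
      case empty
      then show ?case using S_0 by blast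
    next
      case (insert a X)
      then obtain n where "X \<in> S n" by auto
      then have "insert a X \<in> S (Suc n)"
        using insert.prems unfolding S_Suc by (intro image_eqI[of _ _ "(a, X)"]) simp_all
      then show ?case by (rule UN_I[OF UNIV_I])
    qed
  qed
  ultimately show ?thesis by (rule ordLeq_transitive[OF card_of_mono1, rotated])
qed

context covering
begin

lemma stationary:
  "\<exists>S. |S| \<le>o |F| \<and> (\<forall>f :: nat \<Rightarrow> 'k \<Rightarrow> 'k. (\<forall>n. \<forall>x\<in>K. f n x \<in> K) \<longrightarrow>
    (\<exists>A\<in>S. A \<noteq> {} \<and> countable A \<and> A \<subseteq> K \<and> (\<forall>n. \<forall>x\<in>A. f n x \<in> A)))"
proof -
  have inf: "infinite F" using uncountable_F countable_finite by blast
  have "|{Top} \<union> Elt ` F| \<le>o |F|"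
    using inf by (intro card_of_Un_ordLeq_infinite_Field card_of_singl_ordLeq card_of_image)
      (auto simp: Field_card_of card_of_card_order_on)
  then have "|Idx| \<le>o |F|" unfolding Idx_def by simp
  then have "|Idx \<times> Idx| \<le>o |F|" by (intro card_of_Sigma_ordLeq_infinite inf) simp_all
  then have "|{\<Phi>. finite \<Phi> \<and> \<Phi> \<subseteq> Idx \<times> Idx}| \<le>o |F|" by (rule card_of_finite_subsets_ordLeq[OF inf])
  then have "|{\<Phi>. finite \<Phi> \<and> \<Phi> \<subseteq> Idx \<times> Idx} \<times> (UNIV :: omega1 set)| \<le>o |F|"
    using omega1_embeds_uncountable[OF uncountable_F] by (intro card_of_Sigma_ordLeq_infinite inf) simp_all
  then have "|F \<times> ({\<Phi>. finite \<Phi> \<and> \<Phi> \<subseteq> Idx \<times> Idx} \<times> (UNIV :: omega1 set))| \<le>o |F|"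
    by (intro card_of_Sigma_ordLeq_infinite inf) (simp_all add: ordLeq_refl card_of_Card_order)
  then have card: "|(\<lambda>(C, \<Phi>, j). walks K T C (guess C \<Phi>) j - {T}) `
      (F \<times> ({\<Phi>. finite \<Phi> \<and> \<Phi> \<subseteq> Idx \<times> Idx} \<times> (UNIV :: omega1 set)))| \<le>o |F|"
    by (rule ordLeq_transitive[OF card_of_image])
  have closed: "\<exists>A\<in>(\<lambda>(C, \<Phi>, j). walks K T C (guess C \<Phi>) j - {T}) `
      (F \<times> ({\<Phi>. finite \<Phi> \<and> \<Phi> \<subseteq> Idx \<times> Idx} \<times> (UNIV :: omega1 set))).
      A \<noteq> {} \<and> countable A \<and> A \<subseteq> K \<and> (\<forall>n. \<forall>x\<in>A. f n x \<in> A)"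
    if f: "\<forall>n. \<forall>x\<in>K. f n x \<in> K" for f :: "nat \<Rightarrow> 'k \<Rightarrow> 'k"
  proof -
    obtain M where M: "\<And>j. countable (M j)" "\<And>j. M j \<subseteq> K" "\<And>j. M j \<noteq> {}"
      "\<And>n x j. x \<in> M j \<Longrightarrow> f n x \<in> M j" "\<And>i j. i < j \<Longrightarrow> M i \<union> closing_set M i \<subseteq> M j"
      using chain_exists[of f] f by (metis (no_types, lifting))
    obtain C \<Phi> j where C: "C \<in> F" "finite \<Phi>" "\<Phi> \<subseteq> Idx \<times> Idx"
      and A: "walks K T C (guess C \<Phi>) j - {T} \<noteq> {} \<and>
        countable (walks K T C (guess C \<Phi>) j - {T}) \<and> walks K T C (guess C \<Phi>) j - {T} \<subseteq> K \<and>
        (\<forall>n. \<forall>x\<in>walks K T C (guess C \<Phi>) j - {T}. f n x \<in> walks K T C (guess C \<Phi>) j - {T})"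
      using closed_member[of M f, OF M] by blast
    have "(C, \<Phi>, j) \<in> F \<times> ({\<Phi>. finite \<Phi> \<and> \<Phi> \<subseteq> Idx \<times> Idx} \<times> UNIV)" using C by simp
    then have "walks K T C (guess C \<Phi>) j - {T} \<in> (\<lambda>(C, \<Phi>, j). walks K T C (guess C \<Phi>) j - {T}) `
      (F \<times> ({\<Phi>. finite \<Phi> \<and> \<Phi> \<subseteq> Idx \<times> Idx} \<times> (UNIV :: omega1 set)))"
      by (rule image_eqI[rotated]) simp
    with A show ?thesis by (intro bexI)
  qed
  show ?thesis using card closed by (intro exI conjI allI impI)
qed

end

lemma stationary_family:
  fixes B :: "'b set" and F :: "'b set set"
  assumes "infinite B" and F: "cofinal_family |B| F"
  shows "\<exists>S. |S| \<le>o |F| \<and> (\<forall>f :: nat \<Rightarrow> 'b \<Rightarrow> 'b. (\<forall>n. \<forall>x\<in>B. f n x \<in> B) \<longrightarrow>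
    (\<exists>A\<in>S. A \<noteq> {} \<and> countable A \<and> A \<subseteq> B \<and> (\<forall>n. \<forall>x\<in>A. f n x \<in> A)))"
proof (cases "countable B")
  case True
  then have "B \<in> countably_infinite_subsets |B|"
    using assms(1) by (simp add: countably_infinite_subsets_def Field_card_of)
  then have "F \<noteq> {}" using F unfolding cofinal_family_def by blast
  then have "|{B}| \<le>o |F|" by (rule card_of_singl_ordLeq)
  moreover have "B \<noteq> {}" using assms(1) by auto
  ultimately show ?thesis using True by (intro exI[of _ "{B}"]) simp
next
  case False
  have "A \<in> countably_infinite_subsets |B|" if "A \<in> F" for A
    using F that unfolding cofinal_family_def by (meson subsetD)
  then have FD: "countable A" "A \<subseteq> B" if "A \<in> F" for A
    using that by (simp_all add: countably_infinite_subsets_def Field_card_of)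
  \<comment> \<open>A cofinal family is only asked to cover infinite sets, so finite ones are first
    enlarged by \<open>B0\<close>.\<close>
  obtain B0 where B0: "B0 \<subseteq> B" "countable B0" "infinite B0"
    using infinite_countable_subset'[OF assms(1)] by blast
  have Fc: "\<exists>C\<in>F. A \<subseteq> C" if "countable A" "A \<subseteq> B" for A
  proof -
    have "A \<union> B0 \<in> countably_infinite_subsets |B|"
      using that B0 by (auto simp: countably_infinite_subsets_def Field_card_of)
    then obtain C where "C \<in> F" "A \<union> B0 \<subseteq> C" using F unfolding cofinal_family_def by meson
    then show ?thesis by blast
  qed
  define un where "un x = (case x of Elt a \<Rightarrow> a | Top \<Rightarrow> undefined)" for x :: "'b wo"
  have un: "un (Elt a) = a" for a by (simp add: un_def)
  have Elt_un: "Elt ` un ` A = A" "un ` A \<subseteq> B" if "A \<subseteq> Elt ` B" for A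
  proof -
    have "Elt (un x) = x" "un x \<in> B" if "x \<in> A" for x
      using \<open>A \<subseteq> Elt ` B\<close> that un by auto
    then show "Elt ` un ` A = A" "un ` A \<subseteq> B" by (auto simp: image_image)
  qed
  \<comment> \<open>The well-ordered copy of \<open>B\<close>, with \<open>Top\<close> as the point
    above everything from which walks start.\<close>
  interpret covering "Elt ` B" "(`) Elt ` F" Top
  proof
    show "uncountable (Elt ` B)"
      using False countable_image_inj_on[of Elt B] by (auto simp: inj_on_def)
    show "\<exists>C\<in>(`) Elt ` F. A \<subseteq> C" if A: "countable A" "A \<subseteq> Elt ` B" for A
    proof -
      obtain C where "C \<in> F" "un ` A \<subseteq> C" using Fc[of "un ` A"] A Elt_un(2)[OF A(2)] by auto
      then have "Elt ` un ` A \<subseteq> Elt ` C" by blast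
      then show ?thesis using \<open>C \<in> F\<close> Elt_un(1)[OF A(2)] by (intro bexI[of _ "Elt ` C"]) auto
    qed
  qed (use FD in auto)
  obtain S where S: "|S| \<le>o |(`) Elt ` F|"
    and cl: "\<And>f :: nat \<Rightarrow> _. \<forall>n. \<forall>x\<in>Elt ` B. f n x \<in> Elt ` B \<Longrightarrow>
      \<exists>A\<in>S. A \<noteq> {} \<and> countable A \<and> A \<subseteq> Elt ` B \<and> (\<forall>n. \<forall>x\<in>A. f n x \<in> A)"
    using stationary by (elim exE conjE) metis
  have "|(`) un ` S| \<le>o |F|"
    using ordLeq_transitive[OF card_of_image ordLeq_transitive[OF S card_of_image]] .
  moreover have "\<exists>A\<in>(`) un ` S. A \<noteq> {} \<and> countable A \<and> A \<subseteq> B \<and> (\<forall>n. \<forall>x\<in>A. f n x \<in> A)"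
    if f: "\<forall>n. \<forall>x\<in>B. f n x \<in> B" for f :: "nat \<Rightarrow> 'b \<Rightarrow> 'b"
  proof -
    have "\<forall>n. \<forall>x\<in>Elt ` B. Elt (f n (un x)) \<in> Elt ` B" using f by (simp add: un)
    then obtain A where A: "A \<in> S" "A \<noteq> {}" "countable A" "A \<subseteq> Elt ` B"
      "\<And>n x. x \<in> A \<Longrightarrow> Elt (f n (un x)) \<in> A"
      using cl[of "\<lambda>n x. Elt (f n (un x))"] by blast
    have "f n x \<in> un ` A" if x: "x \<in> un ` A" for n x
    proof -
      obtain a where "a \<in> A" "x = un a" using x by blast
      then show ?thesis using A(5)[of a n] un[of "f n x"] by (metis imageI)
    qed
    then show ?thesis using A(1-4) Elt_un(2)[OF A(4)] by (intro bexI[of _ "un ` A"]) auto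
  qed
  ultimately show ?thesis by blast
qed

section \<open>Plays coded by reals\<close>

text \<open>
  Digits to growing bases take arbitrarily large values while staying constant on open intervals. The
  digit \<open>0\<close> will mean a pass, which allows waiting until the base is large enough.
\<close>

definition cantor_digit :: "nat \<Rightarrow> real \<Rightarrow> nat" where
  "cantor_digit k z = nat (\<lfloor>fact (Suc k) * z\<rfloor> mod int (Suc k))"

text \<open>Factorials divide one another, so the floor at \<open>fact k\<close> determines the
  floors at all smaller factorials by integer division.\<close>

lemma cantor_digit_cong:
  assumes "\<lfloor>fact k * z\<rfloor> = \<lfloor>fact k * w\<rfloor>" and "i < k"
  shows "cantor_digit i z = cantor_digit i w"
proof -
  obtain c :: nat where c: "fact k = fact (Suc i) * c"
    using fact_dvd[of "Suc i" k, where 'a=nat] assms(2) by (auto simp: dvd_def)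
  then have c': "(fact k :: real) = fact (Suc i) * real c"
    by (metis of_nat_fact of_nat_mult)
  have "c \<noteq> 0" using c by (metis fact_nonzero mult_0_right)
  have "\<lfloor>fact (Suc i) * x\<rfloor> = \<lfloor>fact k * x\<rfloor> div int c" for x :: real
  proof -
    have "fact (Suc i) * x = (fact k * x) / real_of_int (int c)"
      unfolding c' using \<open>c \<noteq> 0\<close> by simp
    then show ?thesis using floor_divide_real_eq_div[of "int c" "fact k * x"] by simp
  qed
  then show ?thesis unfolding cantor_digit_def using assms(1) by simp
qed

text \<open>Right after a multiple \<open>c\<close> of \<open>1 / fact k\<close> the digits from
  \<open>k\<close> on start with zeros. As \<open>m + 1 \<le> l + 1\<close>, the whole interval
  stays within \<open>1 / fact i\<close> of \<open>c\<close> for every \<open>i \<le> l\<close>, and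
  position \<open>l\<close> is the first where it is seen.\<close>

lemma cantor_digits_block:
  fixes z c :: real
  assumes c: "fact k * c = of_int q" and "m \<le> l" "k \<le> l"
    and z: "c + real m / fact (Suc l) < z" "z < c + (real m + 1) / fact (Suc l)"
  shows "\<lfloor>fact k * z\<rfloor> = q" and "k \<le> i \<Longrightarrow> i < l \<Longrightarrow> cantor_digit i z = 0" and "cantor_digit l z = m"
proof -
  have F: "(fact (Suc l) :: real) = fact l * (real l + 1)" "(fact (Suc l) :: real) > 0"
    by (simp add: algebra_simps) (rule fact_gt_zero)
  have quot: "\<exists>d. fact i = fact k * d \<and> (fact i :: real) * c = of_int (q * int d)" if ki: "k \<le> i" for i
  proof -
    obtain d :: nat where d: "fact i = fact k * d" using fact_dvd[OF ki, where 'a=nat] by (auto simp: dvd_def)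
    then have "(fact i :: real) = fact k * real d" by (metis of_nat_fact of_nat_mult)
    then have "(fact i :: real) * c = of_int (q * int d)" using c by (simp add: mult.commute mult.left_commute)
    then show ?thesis using d by blast
  qed
  have floors: "\<lfloor>fact i * z\<rfloor> = q * int d" if i: "k \<le> i" "i \<le> l" and d: "(fact i :: real) * c = of_int (q * int d)" for i d
  proof (rule floor_unique)
    have "fact i * (real m + 1) \<le> fact l * (real l + 1)"
      using assms(2) i(2) by (intro mult_mono fact_mono) auto
    then have "fact i * ((real m + 1) / fact (Suc l)) \<le> 1"
      using F by (simp only: times_divide_eq_right divide_le_eq_1_pos)
    moreover have "fact i * (z - c) < fact i * ((real m + 1) / fact (Suc l))"
      using z(2) by (intro mult_strict_left_mono) auto
    ultimately have "fact i * (z - c) < 1" by linarith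
    then show "fact i * z < of_int (q * int d) + 1" using d by (simp add: right_diff_distrib)
    have "0 \<le> real m / fact (Suc l)" by simp
    then have "0 \<le> z - c" using z(1) by linarith
    then have "0 \<le> fact i * (z - c)" by simp
    then show "of_int (q * int d) \<le> fact i * z" using d by (simp add: right_diff_distrib)
  qed
  show "\<lfloor>fact k * z\<rfloor> = q" using floors[of k 1] c assms(3) by simp
  show "cantor_digit i z = 0" if i: "k \<le> i" "i < l" for i
  proof -
    obtain d where d: "(fact i :: real) * c = of_int (q * int d)" using quot[OF i(1)] by blast
    have "(fact (Suc i) :: real) * c = real (Suc i) * (fact i * c)" by (simp add: algebra_simps)
    then have "(fact (Suc i) :: real) * c = of_int (q * int (Suc i * d))" using d by (simp add: algebra_simps)
    then have "\<lfloor>fact (Suc i) * z\<rfloor> = q * int (Suc i * d)" using i by (intro floors) auto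
    then have "\<lfloor>fact (Suc i) * z\<rfloor> = (q * int d) * int (Suc i)" by (simp only: of_nat_mult mult_ac)
    then show ?thesis unfolding cantor_digit_def by (simp only: mod_mult_self2_is_0 nat_0)
  qed
  show "cantor_digit l z = m"
  proof -
    obtain d where d: "(fact l :: real) * c = of_int (q * int d)" using quot[OF assms(3)] by blast
    have "(fact (Suc l) :: real) * c = real (Suc l) * (fact l * c)" by (simp add: algebra_simps)
    then have dl: "(fact (Suc l) :: real) * c = of_int (q * int d * int (Suc l))" using d by (simp add: algebra_simps)
    have "\<lfloor>fact (Suc l) * z\<rfloor> = q * int d * int (Suc l) + int m"
    proof (rule floor_unique)
      have "real m < fact (Suc l) * (z - c)" "fact (Suc l) * (z - c) < real m + 1"
        using z F(2) pos_divide_less_eq[OF F(2), of "real m" "z - c"]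
          pos_less_divide_eq[OF F(2), of "z - c" "real m + 1"] by (simp_all only: mult.commute) linarith+
      then show "of_int (q * int d * int (Suc l) + int m) \<le> fact (Suc l) * z"
        "fact (Suc l) * z < of_int (q * int d * int (Suc l) + int m) + 1"
        unfolding right_diff_distrib dl of_int_add of_int_of_nat_eq by linarith+
    qed
    moreover have "(q * int d * int (Suc l) + int m) mod int (Suc l) = int m"
      using assms(2) by simp
    ultimately show ?thesis unfolding cantor_digit_def by (simp only: nat_int)
  qed
qed

text \<open>The length \<open>k\<close> of the prefix kept from \<open>x\<close> depends on
  \<open>V\<close> alone; any \<open>m\<close> can then be placed at position
  \<open>max k m\<close>, where the base admits it, after zeros.\<close>

lemma cantor_digits_dense:
  fixes V :: "real set"
  assumes "open V" and "x \<in> V"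
  shows "\<exists>k. \<forall>m. \<exists>l\<ge>k. \<exists>W. open W \<and> W \<noteq> {} \<and> W \<subseteq> V \<and>
    (\<forall>z\<in>W. (\<forall>i<k. cantor_digit i z = cantor_digit i x) \<and>
      (\<forall>i. k \<le> i \<longrightarrow> i < l \<longrightarrow> cantor_digit i z = 0) \<and> cantor_digit l z = m)"
proof -
  obtain e where e: "e > 0" "\<And>y. \<bar>y - x\<bar> < e \<Longrightarrow> y \<in> V"
    using assms unfolding open_dist dist_real_def by blast
  obtain k :: nat where k: "1 / e < real k" using reals_Archimedean2 by blast
  have "real k \<le> fact k" using fact_ge_self[of k] by (metis of_nat_fact of_nat_le_iff)
  then have "1 / e < fact k" using k by linarith
  then have fk: "1 / fact k < e" using e(1) by (simp add: divide_less_eq mult.commute)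
  define q where "q = \<lfloor>fact k * x\<rfloor>"
  define c :: real where "c = q / fact k"
  have c: "fact k * c = of_int q" by (simp add: c_def)
  have cx: "c \<le> x" "x < c + 1 / fact k"
  proof -
    have "of_int q \<le> fact k * x" "fact k * x < of_int q + 1" unfolding q_def by linarith+
    moreover have "c + 1 / fact k = (of_int q + 1) / fact k" unfolding c_def by (simp add: add_divide_distrib)
    ultimately show "c \<le> x" "x < c + 1 / fact k"
      unfolding c_def by (simp_all add: divide_le_eq less_divide_eq mult.commute)
  qed
  have "\<exists>W. open W \<and> W \<noteq> {} \<and> W \<subseteq> V \<and>
    (\<forall>z\<in>W. (\<forall>i<k. cantor_digit i z = cantor_digit i x) \<and>
      (\<forall>i. k \<le> i \<longrightarrow> i < max k m \<longrightarrow> cantor_digit i z = 0) \<and> cantor_digit (max k m) z = m)" for m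
  proof -
    define l where "l = max k m"
    have ml: "m \<le> l" "k \<le> l" by (simp_all add: l_def)
    define W where "W = {c + real m / fact (Suc l) <..< c + (real m + 1) / fact (Suc l)}"
    have blk: "\<lfloor>fact k * z\<rfloor> = q" "k \<le> i \<Longrightarrow> i < l \<Longrightarrow> cantor_digit i z = 0" "cantor_digit l z = m"
      if "z \<in> W" for z i
      using cantor_digits_block[OF c ml, of z] that unfolding W_def by auto
    have "W \<noteq> {}" unfolding W_def greaterThanLessThan_empty_iff not_le
      by (intro add_strict_left_mono divide_strict_right_mono) (simp_all del: fact_Suc)
    moreover have "W \<subseteq> V"
    proof
      fix z assume z: "z \<in> W"
      have "0 \<le> real m / fact (Suc l)" by simp
      moreover have "c + real m / fact (Suc l) < z" using z unfolding W_def greaterThanLessThan_iff ..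
      ultimately have "c < z" by linarith
      moreover have "z < c + 1 / fact k"
      proof -
        have "fact k * z < of_int q + 1" using blk(1)[OF z] by linarith
        then have "fact k * (z - c) < 1" using c by (simp add: right_diff_distrib)
        then have "z - c < 1 / fact k" by (simp add: less_divide_eq mult.commute)
        then show ?thesis by linarith
      qed
      ultimately show "z \<in> V" using cx fk by (intro e(2)) linarith
    qed
    moreover have "cantor_digit i z = cantor_digit i x" if "z \<in> W" "i < k" for z i
      by (rule cantor_digit_cong[OF _ that(2)]) (simp add: blk(1)[OF that(1)] q_def)
    moreover have "open W" by (simp add: W_def)
    ultimately show ?thesis using blk(2,3) unfolding l_def[symmetric]
      by (intro exI[of _ W] conjI ballI allI impI) simp_all
  qed
  then show ?thesis by (metis max.cobounded1)
qed

primrec play :: "(nat \<Rightarrow> 's \<Rightarrow> 's) \<Rightarrow> 's \<Rightarrow> real \<Rightarrow> nat \<Rightarrow> 's" where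
  "play st s z 0 = s"
| "play st s z (Suc k) = st (cantor_digit k z) (play st s z k)"

lemma play_cong: "(\<And>i. i < k \<Longrightarrow> cantor_digit i z = cantor_digit i w) \<Longrightarrow> play st s z k = play st s w k"
  by (induction k) simp_all

lemma play_pass:
  assumes "\<And>s. st 0 s = s" and "k \<le> l" and "\<And>i. k \<le> i \<Longrightarrow> i < l \<Longrightarrow> cantor_digit i z = 0"
  shows "play st s z l = play st s z k"
  using assms(2,3) by (induction l rule: dec_induct) (simp_all add: assms(1))

lemma play_invariant:
  assumes "R s" and "\<And>m s. R s \<Longrightarrow> R (st m s)"
  shows "R (play st s z k)"
  by (induction k) (simp_all add: assms)

text \<open>Inside any open set, keep a prefix of some point, choose a good move for the state
  reached there, pass until the base admits that move, and play it. This gives an open subset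
  disjoint from the set in question.\<close>

lemma play_nowhere_dense:
  assumes st: "\<And>s. st 0 s = s" and R: "R s" "\<And>m s. R s \<Longrightarrow> R (st m s)"
    and good: "\<And>s. R s \<Longrightarrow> \<exists>m. good s m"
  shows "nowhere_dense_in euclidean {z. \<forall>k. \<not> good (play st s z k) (cantor_digit k z)}"
proof -
  let ?N = "{z. \<forall>k. \<not> good (play st s z k) (cantor_digit k z)}"
  have "x \<notin> interior (closure ?N)" for x
  proof
    assume "x \<in> interior (closure ?N)"
    from cantor_digits_dense[OF open_interior this] obtain k where
      k: "\<And>m. \<exists>l\<ge>k. \<exists>W. open W \<and> W \<noteq> {} \<and> W \<subseteq> interior (closure ?N) \<and>
        (\<forall>z\<in>W. (\<forall>i<k. cantor_digit i z = cantor_digit i x) \<and>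
          (\<forall>i. k \<le> i \<longrightarrow> i < l \<longrightarrow> cantor_digit i z = 0) \<and> cantor_digit l z = m)" by blast
    obtain m where m: "good (play st s x k) m"
      using good[of "play st s x k"] play_invariant[of R s st x k] R by blast
    obtain l W where l: "k \<le> l" and W: "open W" "W \<noteq> {}" "W \<subseteq> interior (closure ?N)"
      and dig: "\<And>z i. z \<in> W \<Longrightarrow> i < k \<Longrightarrow> cantor_digit i z = cantor_digit i x"
        "\<And>z i. z \<in> W \<Longrightarrow> k \<le> i \<Longrightarrow> i < l \<Longrightarrow> cantor_digit i z = 0"
        "\<And>z. z \<in> W \<Longrightarrow> cantor_digit l z = m"
      using k[of m] by blast
    have "good (play st s z l) (cantor_digit l z)" if "z \<in> W" for z
    proof -
      have "play st s z l = play st s z k" using st l dig(2)[OF that] by (rule play_pass)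
      also have "\<dots> = play st s x k" using dig(1)[OF that] by (rule play_cong)
      finally show ?thesis using m dig(3)[OF that] by simp
    qed
    then have "W \<inter> ?N = {}" by blast
    then have "W \<inter> closure ?N = {}" using open_Int_closure_eq_empty[OF W(1)] by blast
    moreover have "W \<subseteq> closure ?N" using W(3) interior_subset by blast
    ultimately show False using W(2) by blast
  qed
  then show ?thesis unfolding nowhere_dense_in_def by (simp add: euclidean_interior_of euclidean_closure_of) blast
qed

section \<open>Non-meager sets in locally compact spaces\<close>

lemma nowhere_dense_in_subset:
  assumes "nowhere_dense_in X N" and "M \<subseteq> N"
  shows "nowhere_dense_in X M"
proof -
  have "X interior_of (X closure_of M) \<subseteq> X interior_of (X closure_of N)"
    using assms(2) by (intro interior_of_mono closure_of_mono)
  then show ?thesis using assms unfolding nowhere_dense_in_def by blast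
qed

lemma nonmeager_avoids:
  assumes "Z \<subseteq> topspace X" and "Z \<notin> meager_sets X" and N: "\<And>n :: nat. nowhere_dense_in X (N n)"
  shows "\<exists>z\<in>Z. \<forall>n. z \<notin> N n"
proof (rule ccontr)
  assume "\<not> ?thesis"
  then have "Z = \<Union>(range (\<lambda>n. Z \<inter> N n))" by blast
  moreover have "\<forall>M\<in>range (\<lambda>n. Z \<inter> N n). nowhere_dense_in X M"
    using N by (auto intro: nowhere_dense_in_subset)
  ultimately have "Z \<in> meager_sets X" unfolding meager_sets_def mem_Collect_eq
    by (intro exI[of _ "range (\<lambda>n. Z \<inter> N n)"] conjI) simp_all
  then show False using assms(2) by blast
qed

lemma meager_setsE:
  assumes "Z \<in> meager_sets X"
  obtains \<N> where "Z = \<Union>\<N>" "countable \<N>" "\<And>N. N \<in> \<N> \<Longrightarrow> nowhere_dense_in X N"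
proof -
  from assms obtain \<N> where "Z = \<Union>\<N> \<and> countable \<N> \<and> (\<forall>N\<in>\<N>. nowhere_dense_in X N)"
    unfolding meager_sets_def mem_Collect_eq ..
  then show thesis using that by simp
qed

text \<open>Baire's theorem guarantees that the minimum defining \<open>non_ideal\<close> for the
  reals is taken over a nonempty set.\<close>

lemma UNIV_not_meager: "(UNIV :: real set) \<notin> meager_sets euclidean"
proof
  assume "(UNIV :: real set) \<in> meager_sets euclidean"
  then obtain \<N> :: "real set set" where N: "UNIV = \<Union>\<N>" "countable \<N>"
    "\<And>N. N \<in> \<N> \<Longrightarrow> nowhere_dense_in euclidean N"
    by (rule meager_setsE) (rule that)
  have "UNIV \<subseteq> closure (\<Inter>((\<lambda>N. - closure N) ` \<N>))"
  proof (rule Baire)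
    fix T assume "T \<in> (\<lambda>N. - closure N) ` \<N>"
    then obtain N where "N \<in> \<N>" "T = - closure N" by blast
    moreover from this have "interior (closure N) = {}"
      using N(3) unfolding nowhere_dense_in_def by (simp add: euclidean_interior_of euclidean_closure_of)
    ultimately show "openin (top_of_set UNIV) T \<and> UNIV \<subseteq> closure T"
      by (simp add: closure_interior open_Compl)
  qed (use N(2) in auto)
  moreover have "x \<notin> \<Inter>((\<lambda>N. - closure N) ` \<N>)" for x
  proof -
    obtain N where "N \<in> \<N>" "x \<in> N" using N(1) by blast
    then have "x \<notin> - closure N" using closure_subset by blast
    then show ?thesis using \<open>N \<in> \<N>\<close> by blast
  qed
  then have "\<Inter>((\<lambda>N. - closure N) ` \<N>) = {}" by blast
  ultimately show False by simp
qed

lemma nest_compact_nonempty: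
  fixes C :: "nat \<Rightarrow> 'a set"
  assumes "\<And>n. closedin X (C n)" and "\<And>n. C n \<noteq> {}" and "\<And>n. C (Suc n) \<subseteq> C n" and "compactin X (C k)"
  shows "(\<Inter>n. C n) \<noteq> {}"
proof -
  have dec: "decseq C" by (rule decseq_SucI) (rule assms(3))
  have "(\<Inter>n. C (n + k)) \<noteq> {}"
  proof (rule compact_space_imp_nest)
    show "compact_space (subtopology X (C k))"
      using assms(4) by (simp add: compactin_subspace)
    show "closedin (subtopology X (C k)) (C (n + k))" for n
      using assms(1) dec by (intro closedin_subset_topspace) (auto simp: decseq_def)
    show "decseq (\<lambda>n. C (n + k))" using dec by (auto simp: decseq_def)
  qed (rule assms(2))
  then obtain x where "\<And>n. x \<in> C (n + k)" by blast
  then have "x \<in> C n" for n using dec unfolding decseq_def by (metis le_add1 subsetD)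
  then show ?thesis by blast
qed

text \<open>A minimal member of a finite base would contain two points; separating them gives a
  strictly smaller member.\<close>

lemma infinite_pi_base:
  assumes "Hausdorff_space X" and no_iso: "\<forall>x\<in>topspace X. \<not> openin X {x}"
    and U: "openin X U" "U \<noteq> {}" and B: "pi_base (subtopology X U) \<B>"
  shows "infinite \<B>"
proof
  assume fin: "finite \<B>"
  have opB: "openin X A" "A \<noteq> {}" "A \<subseteq> U" if "A \<in> \<B>" for A
    using B that U(1) unfolding pi_base_def by (auto simp: openin_open_subtopology)
  have piB: "\<exists>A\<in>\<B>. A \<subseteq> V" if "openin X V" "V \<subseteq> U" "V \<noteq> {}" for V
    using B that U(1) unfolding pi_base_def by (simp add: openin_open_subtopology)
  have "\<B> \<noteq> {}" using piB[OF U(1) subset_refl U(2)] by blast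
  with fin obtain A where A: "A \<in> \<B>" "\<And>A'. A' \<in> \<B> \<Longrightarrow> A' \<subseteq> A \<Longrightarrow> A' = A"
    using finite_has_minimal[OF fin] by (metis (no_types, lifting))
  obtain x where x: "x \<in> A" using opB(2)[OF A(1)] by blast
  have "x \<in> topspace X" using x opB(1)[OF A(1)] openin_subset by blast
  then have "A \<noteq> {x}" using no_iso opB(1)[OF A(1)] by blast
  then obtain y where y: "y \<in> A" "y \<noteq> x" using x by blast
  then have "y \<in> topspace X" using opB(1)[OF A(1)] openin_subset by blast
  then obtain V W where V: "openin X V" "openin X W" "x \<in> V" "y \<in> W" "disjnt V W"
    using assms(1) \<open>x \<in> topspace X\<close> y(2) unfolding Hausdorff_space_def by metis
  have "openin X (A \<inter> V)" using V(1) opB(1)[OF A(1)] by (rule openin_Int[rotated])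
  then obtain A' where A': "A' \<in> \<B>" "A' \<subseteq> A \<inter> V"
    using piB[of "A \<inter> V"] opB(3)[OF A(1)] x V(3) by blast
  then have "A' = A" using A(2) by blast
  then have "y \<in> V" using A'(2) y(1) by blast
  then show False using V(4,5) unfolding disjnt_def by blast
qed

lemma pi_base_shrink:
  assumes lc: "locally_compact_space X" and T2: "Hausdorff_space X"
    and U: "openin X U" and B: "pi_base (subtopology X U) \<B>"
    and N: "nowhere_dense_in X N" and A: "A \<in> \<B>"
  shows "\<exists>A'\<in>\<B>. compactin X (X closure_of A') \<and> X closure_of A' \<subseteq> A - N"
proof -
  have opA: "openin X A" "A \<noteq> {}" "A \<subseteq> U"
    using B A U unfolding pi_base_def by (auto simp: openin_open_subtopology)
  have "\<not> A \<subseteq> X closure_of N"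
  proof
    assume "A \<subseteq> X closure_of N"
    then have "A \<subseteq> X interior_of (X closure_of N)" using opA(1) by (rule interior_of_maximal)
    then show False using N opA(2) unfolding nowhere_dense_in_def by blast
  qed
  then obtain x where x: "x \<in> A - X closure_of N" by blast
  have "openin X (A - X closure_of N)" using opA(1) by (intro openin_diff) auto
  then obtain V C where V: "openin X V" "compactin X C" "x \<in> V" "V \<subseteq> C" "C \<subseteq> A - X closure_of N"
    using locally_compact_space_neighbourhood_base[of X] lc T2 x unfolding neighbourhood_base_of
    by (metis (no_types, lifting))
  have "openin (subtopology X U) V" "V \<noteq> {}"
    using V opA(3) U by (auto simp: openin_open_subtopology)
  then obtain A' where A': "A' \<in> \<B>" "A' \<subseteq> V" using B unfolding pi_base_def by blast
  have "closedin X C" using T2 V(2) by (rule compactin_imp_closedin)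
  then have sub: "X closure_of A' \<subseteq> C" using A'(2) V(4) by (intro closure_of_minimal) auto
  then have "compactin X (X closure_of A')" using V(2) by (intro closed_compactin[OF V(2)]) auto
  moreover have "N \<subseteq> X closure_of N" using N closure_of_subset unfolding nowhere_dense_in_def by blast
  ultimately show ?thesis using A'(1) sub V(5) by blast
qed

text \<open>Illegal proposals count as passes, so every real codes a play with nested
  closures.\<close>

definition move :: "'a topology \<Rightarrow> 'a set set \<Rightarrow> nat \<Rightarrow> 'a set \<Rightarrow> 'a set" where
  "move X A m V = (case m of 0 \<Rightarrow> V | Suc i \<Rightarrow>
     if compactin X (X closure_of from_nat_into A i) \<and> X closure_of from_nat_into A i \<subseteq> V
     then from_nat_into A i else V)"

definition outcome :: "'a topology \<Rightarrow> 'a set set \<Rightarrow> real \<Rightarrow> 'a" where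
  "outcome X A z = (SOME y. y \<in> (\<Inter>k. X closure_of play (move X A) (from_nat_into A 0) z k))"

text \<open>For each \<open>n\<close>, the reals whose play never answers a position
  \<open>V\<close> by \<open>f n V\<close> are nowhere dense, so some \<open>z\<close> in
  \<open>Z\<close> gives that answer for every \<open>n\<close>. Its outcome lies in the closure of
  the answer and hence outside \<open>N n\<close>.\<close>

lemma outcome_avoids:
  assumes A: "countable A" "A \<noteq> {}" and op: "\<And>V. V \<in> A \<Longrightarrow> openin X V \<and> V \<noteq> {}"
    and Z: "Z \<notin> meager_sets (euclidean :: real topology)"
    and f: "\<And>n V. V \<in> A \<Longrightarrow> f n V \<in> A \<and> compactin X (X closure_of f n V) \<and> X closure_of f n V \<subseteq> V - N n"
  shows "\<exists>z\<in>Z. outcome X A z \<in> topspace X \<and> (\<forall>n :: nat. outcome X A z \<notin> N n)"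
proof -
  define p where "p z k = play (move X A) (from_nat_into A 0) z k" for z k
  have mA: "move X A m V \<in> A" if "V \<in> A" for m V
    using that A(2) by (auto simp: move_def from_nat_into split: nat.split)
  have pA: "p z k \<in> A" for z k
    unfolding p_def by (rule play_invariant[where R="\<lambda>V. V \<in> A"]) (simp_all add: mA from_nat_into A(2))
  have pc: "closedin X (X closure_of p z k)" "X closure_of p z k \<noteq> {}" "p z k \<subseteq> X closure_of p z k" for z k
  proof -
    have "openin X (p z k)" "p z k \<noteq> {}" using op[OF pA] by auto
    then show "closedin X (X closure_of p z k)" "X closure_of p z k \<noteq> {}" "p z k \<subseteq> X closure_of p z k"
      using closure_of_subset[OF openin_subset] by auto
  qed
  have dec: "X closure_of p z (Suc k) \<subseteq> X closure_of p z k" for z k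
    using pc(3)[of z k] by (auto simp: p_def move_def split: nat.split)
  have "nowhere_dense_in euclidean {z. \<forall>k. \<not> move X A (cantor_digit k z) (p z k) = f n (p z k)}" for n
    unfolding p_def
  proof (rule play_nowhere_dense[where R="\<lambda>V. V \<in> A" and good="\<lambda>V m. move X A m V = f n V"])
    fix V assume V: "V \<in> A"
    obtain i where "from_nat_into A i = f n V" using from_nat_into_surj[OF A(1)] f[OF V] by blast
    then have "move X A (Suc i) V = f n V" using f[OF V, of n] by (auto simp: move_def)
    then show "\<exists>m. move X A m V = f n V" by blast
  qed (auto simp: move_def from_nat_into A(2) split: nat.split)
  then obtain z where z: "z \<in> Z" "\<And>n. \<exists>k. move X A (cantor_digit k z) (p z k) = f n (p z k)"
    using nonmeager_avoids[of Z euclidean "\<lambda>n. {z. \<forall>k. \<not> move X A (cantor_digit k z) (p z k) = f n (p z k)}"] Z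
    by auto
  then have hit: "\<exists>k. p z (Suc k) = f n (p z k)" for n unfolding p_def by simp
  \<comment> \<open>One answer by a shrinking makes a closure compact, which is what the nested
    intersection needs.\<close>
  obtain k where "p z (Suc k) = f 0 (p z k)" using hit by blast
  then have "compactin X (X closure_of p z (Suc k))" using f[OF pA] by simp
  then have "(\<Inter>k. X closure_of p z k) \<noteq> {}"
    using pc dec by (intro nest_compact_nonempty[of X _ "Suc k"]) auto
  then have "\<exists>y. y \<in> (\<Inter>k. X closure_of p z k)" by blast
  then have out: "outcome X A z \<in> (\<Inter>k. X closure_of p z k)"
    unfolding outcome_def p_def by (rule someI_ex)
  have "outcome X A z \<notin> N n" for n
  proof -
    obtain k where "p z (Suc k) = f n (p z k)" using hit by blast
    moreover have "outcome X A z \<in> X closure_of p z (Suc k)" using out by blast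
    ultimately show ?thesis using f[OF pA[of z k], of n] by auto
  qed
  moreover have "outcome X A z \<in> topspace X" using out closure_of_subset_topspace by fast
  ultimately show ?thesis using z(1) by blast
qed

lemma nonmeager_set_exists:
  assumes lc: "locally_compact_space X" and T2: "Hausdorff_space X"
    and no_iso: "\<forall>x\<in>topspace X. \<not> openin X {x}"
    and U: "openin X U" "U \<noteq> {}" and B: "pi_base (subtopology X U) \<B>"
    and F: "cofinal_family |\<B>| F" and Z: "Z \<notin> meager_sets (euclidean :: real topology)"
  shows "\<exists>Y. Y \<subseteq> topspace X \<and> Y \<notin> meager_sets X \<and> |Y| \<le>o |F \<times> Z|"
proof -
  have opB: "openin X V" "V \<noteq> {}" if "V \<in> \<B>" for V
    using B that U(1) unfolding pi_base_def by (auto simp: openin_open_subtopology)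
  obtain S where S: "|S| \<le>o |F|" and stat: "\<And>f :: nat \<Rightarrow> _. \<forall>n. \<forall>x\<in>\<B>. f n x \<in> \<B> \<Longrightarrow>
    \<exists>A\<in>S. A \<noteq> {} \<and> countable A \<and> A \<subseteq> \<B> \<and> (\<forall>n. \<forall>x\<in>A. f n x \<in> A)"
    using stationary_family[OF infinite_pi_base[OF T2 no_iso U B] F] by (elim exE conjE) metis
  \<comment> \<open>Where the closures have empty intersection, \<open>outcome\<close> is an
    arbitrary value and might leave the space.\<close>
  define Y where "Y = (\<lambda>(A, z). outcome X A z) ` (S \<times> Z) \<inter> topspace X"
  have "|Y| \<le>o |(\<lambda>(A, z). outcome X A z) ` (S \<times> Z)|" unfolding Y_def by (rule card_of_mono1) simp
  moreover have "|(\<lambda>(A, z). outcome X A z) ` (S \<times> Z)| \<le>o |S \<times> Z|" by (rule card_of_image)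
  moreover have "|S \<times> Z| \<le>o |F \<times> Z|" using S by (rule card_of_Times_mono1)
  ultimately have "|Y| \<le>o |F \<times> Z|" by (blast intro: ordLeq_transitive)
  moreover have "Y \<notin> meager_sets X"
  proof
    assume "Y \<in> meager_sets X"
    then obtain \<N> where \<N>: "Y = \<Union>\<N>" "countable \<N>" "\<And>N. N \<in> \<N> \<Longrightarrow> nowhere_dense_in X N"
      by (rule meager_setsE) (rule that)
    \<comment> \<open>Adding the empty set allows an enumeration even if \<open>\<N>\<close> is
      empty.\<close>
    define N where "N = from_nat_into (insert {} \<N>)"
    have rN: "range N = insert {} \<N>" unfolding N_def using \<N>(2) by (intro range_from_nat_into) auto
    have "nowhere_dense_in X {}" by (simp add: nowhere_dense_in_def)
    then have "nowhere_dense_in X (N n)" for n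
      using rN \<N>(3) by (metis insertE rangeI)
    then have "\<forall>n. \<forall>V\<in>\<B>. \<exists>V'. V' \<in> \<B> \<and> compactin X (X closure_of V') \<and> X closure_of V' \<subseteq> V - N n"
      using pi_base_shrink[OF lc T2 U(1) B] by blast
    then have "\<forall>n. \<exists>g. \<forall>V\<in>\<B>. g V \<in> \<B> \<and> compactin X (X closure_of g V) \<and> X closure_of g V \<subseteq> V - N n"
      by (intro allI bchoice) simp
    from choice[OF this] obtain f where "\<forall>n. \<forall>V\<in>\<B>. f n V \<in> \<B> \<and> compactin X (X closure_of f n V) \<and>
        X closure_of f n V \<subseteq> V - N n" ..
    then have f: "f n V \<in> \<B> \<and> compactin X (X closure_of f n V) \<and> X closure_of f n V \<subseteq> V - N n"
      if "V \<in> \<B>" for n V using that by simp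
    then obtain A where A: "A \<in> S" "A \<noteq> {}" "countable A" "A \<subseteq> \<B>" "\<And>n V. V \<in> A \<Longrightarrow> f n V \<in> A"
      using stat[of f] f by meson
    have "\<exists>z\<in>Z. outcome X A z \<in> topspace X \<and> (\<forall>n. outcome X A z \<notin> N n)"
    proof (rule outcome_avoids[OF A(3,2) _ Z])
      show "openin X V \<and> V \<noteq> {}" if "V \<in> A" for V using opB A(4) that by blast
      show "f n V \<in> A \<and> compactin X (X closure_of f n V) \<and> X closure_of f n V \<subseteq> V - N n" if "V \<in> A" for n V
        using f[OF subsetD[OF A(4) that]] A(5)[OF that] by blast
    qed
    then obtain z where z: "z \<in> Z" "outcome X A z \<in> topspace X" "\<And>n. outcome X A z \<notin> N n" by blast
    have "outcome X A z \<in> (\<lambda>(A, z). outcome X A z) ` (S \<times> Z)"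
      by (rule image_eqI[of _ _ "(A, z)"]) (use A(1) z(1) in auto)
    then have "outcome X A z \<in> Y" unfolding Y_def using z(2) by blast
    then obtain M where "M \<in> \<N>" "outcome X A z \<in> M" using \<N>(1) by blast
    then show False using z(3) rN by (metis insertI2 rangeE)
  qed
  ultimately show ?thesis unfolding Y_def by blast
qed

section \<open>From sets to the cardinals of the theorem\<close>

lemma pi_weight_eq: "\<exists>\<B>. pi_base X \<B> \<and> pi_weight X = |\<B>|"
proof -
  have "pi_base X {V. openin X V \<and> V \<noteq> {}}" unfolding pi_base_def by blast
  then have "pi_weight X \<in> {|\<B>| |\<B>. pi_base X \<B>}"
    unfolding pi_weight_def by (intro least_cardinal(1)) (auto simp: card_of_Card_order)
  then show ?thesis by blast
qed

theorem theorem5p2: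
  fixes X :: "'a topology" and \<kappa> :: "'a set rel"
  assumes "topspace X \<noteq> {}"
    and "locally_compact_space X"
    and "Hausdorff_space X"
    and no_isolated_points: "\<forall>x\<in>topspace X. \<not> openin X {x}"
    and "\<kappa> = pi_weight_down X"
  shows "non_ideal (topspace X) (meager_sets X)
           \<le>o cf_countable_subsets \<kappa> *c non_ideal UNIV (meager_sets (euclidean :: real topology))"
proof -
  have Card: "Card_order (pi_weight Y)" for Y :: "'a topology"
    using pi_weight_eq[of Y] by (auto simp: card_of_Card_order)
  have "pi_weight_down X \<in> {pi_weight (subtopology X U) |U. openin X U \<and> U \<noteq> {}}"
    unfolding pi_weight_down_def using assms(1) openin_topspace[of X] Card
    by (intro least_cardinal(1)) blast+
  then obtain U where U: "openin X U" "U \<noteq> {}" "\<kappa> = pi_weight (subtopology X U)"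
    using assms(5) by blast
  then obtain \<B> where B: "pi_base (subtopology X U) \<B>" "\<kappa> = |\<B>|"
    using pi_weight_eq by metis
  \<comment> \<open>Some cofinal family exists, so the minimum is attained and names an actual
    \<open>F\<close>.\<close>
  have "cofinal_family \<kappa> (countably_infinite_subsets \<kappa>)" unfolding cofinal_family_def by blast
  then have "cf_countable_subsets \<kappa> \<in> {|F| |F. cofinal_family \<kappa> F}"
    unfolding cf_countable_subsets_def by (intro least_cardinal(1)) (auto simp: card_of_Card_order)
  then obtain F where F: "cofinal_family |\<B>| F" "cf_countable_subsets \<kappa> = |F|" using B(2) by blast
  have "non_ideal UNIV (meager_sets (euclidean :: real topology)) \<in>
      {|Z| |Z. Z \<subseteq> UNIV \<and> Z \<notin> meager_sets (euclidean :: real topology)}"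
    unfolding non_ideal_def using UNIV_not_meager
    by (intro least_cardinal(1)) (auto simp: card_of_Card_order)
  then obtain Z where Z: "Z \<notin> meager_sets (euclidean :: real topology)"
    "non_ideal UNIV (meager_sets (euclidean :: real topology)) = |Z|" by blast
  obtain Y where Y: "Y \<subseteq> topspace X" "Y \<notin> meager_sets X" "|Y| \<le>o |F \<times> Z|"
    using nonmeager_set_exists[OF assms(2,3) no_isolated_points U(1,2) B(1) F(1) Z(1)] by blast
  have "non_ideal (topspace X) (meager_sets X) \<le>o |Y|"
    unfolding non_ideal_def using Y(1,2)
    by (intro least_cardinal(2)[rule_format]) (auto simp: card_of_Card_order)
  also have "|Y| \<le>o |F| *c |Z|" using Y(3) by (simp add: cprod_def Field_card_of)
  finally show ?thesis unfolding F(2) Z(2) .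
qed

end
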